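(* Assume $\sum_{i=1}^kc_i\dim(E_i)=\sum_{j=1}^md_j\dim(E^j)$, and let linear maps $Q_j:E_0\to E^j$, $1\le j\le m$, and $\Sigma\in\Pi(\mathrm{id}_{E_1},\dots,\mathrm{id}_{E_k})$ satisfy $$Q_j\Sigma Q_j^*=\mathrm{id}_{E^j}\ \text{ for each }1\le j\le m,\qquad\text{and}\qquad\sum_{j=1}^md_jQ_j^*Q_j\le\Lambda_{\mathbf c}.$$ If measurable functions $f_i:E_i\to[0,\infty)$, $1\le i\le k$, and $g_j:E^j\to[0,\infty)$, $1\le j\le m$, satisfy $$\prod_{i=1}^kf_i^{c_i}(\pi_{E_i}(x))\le\prod_{j=1}^mg_j^{d_j}(Q_jx)\qquad\forall x\in E_0,$$ then $$\prod_{i=1}^k\Big(\int_{E_i}f_i\Big)^{c_i}\le\prod_{j=1}^m\Big(\int_{E^j}g_j\Big)^{d_j}.$$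
   Context: $E_1,\dots,E_k$ and $E^1,\dots,E^m$ are Euclidean spaces (finite-dimensional real Hilbert spaces with Lebesgue measure), $E_0=\bigoplus_{i=1}^kE_i$ (orthogonal direct sum, each $E_i\subseteq E_0$), $\pi_{E_i}:E_0\to E_i$ is the orthogonal projection, and $(c_i)_{1\le i\le k}$, $(d_j)_{1\le j\le m}$ are positive real numbers. $\Lambda_{\mathbf c}=\bigoplus_{i=1}^kc_i\,\mathrm{id}_{E_i}$. For self-adjoint operators, $A\le B$ means $B-A$ is positive-semidefinite. $\Pi(\mathrm{id}_{E_1},\dots,\mathrm{id}_{E_k})$ is the set of self-adjoint positive-semidefinite operators $A$ on $E_0$ with $\langle Ax_i,x_i\rangle=\langle x_i,x_i\rangle$ for all $x_i\in E_i$, $1\le i\le k$. *)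

theory Defs
  imports "HOL-Analysis.Analysis"
begin

(* Conventions: the ambient Euclidean space E_0 is a type of class euclidean_space.  Its summands
   E_i are linear subspaces of it, and the target Euclidean spaces E^j are linear subspaces of a
   second such type (any finite family of Euclidean spaces embeds isometrically in one Euclidean
   space).  A linear map E_0 -> E^j is a linear map into the second type with range in E^j; the
   restriction of its library adjoint to E^j is then the adjoint of the map into E^j. *)

definition orthogonal_direct_sum :: "'i set \<Rightarrow> ('i \<Rightarrow> 'a::euclidean_space set) \<Rightarrow> bool" where
  "orthogonal_direct_sum I E \<longleftrightarrow>
     (\<forall>i\<in>I. subspace (E i)) \<and>
     (\<forall>i\<in>I. \<forall>i'\<in>I. i \<noteq> i' \<longrightarrow> (\<forall>x\<in>E i. \<forall>y\<in>E i'. x \<bullet> y = 0)) \<and>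
     span (\<Union>i\<in>I. E i) = UNIV"

definition orth_proj :: "'a::euclidean_space set \<Rightarrow> 'a \<Rightarrow> 'a" where
  "orth_proj S x = (THE y. y \<in> S \<and> (\<forall>z\<in>S. (x - y) \<bullet> z = 0))"

lemma orth_proj_unique:
  assumes "subspace S" and y: "y \<in> S" "\<forall>z\<in>S. (x - y) \<bullet> z = 0"
  shows "orth_proj S x = y"
  unfolding orth_proj_def
proof (rule the_equality)
  fix w assume w: "w \<in> S \<and> (\<forall>z\<in>S. (x - w) \<bullet> z = 0)"
  have "y - w \<in> S" using w y assms(1) by (auto intro: subspace_diff)
  then have "(x - w) \<bullet> (y - w) - (x - y) \<bullet> (y - w) = 0" using w y by simp
  then have "(y - w) \<bullet> (y - w) = 0" by (simp add: inner_diff_left)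
  then show "w = y" by simp
qed (use y in blast)

lemma orth_proj:
  assumes "subspace S"
  shows "orth_proj S x \<in> S" and "z \<in> S \<Longrightarrow> (x - orth_proj S x) \<bullet> z = 0"
proof -
  have sp: "span S = S" using assms by (simp add: span_eq_iff)
  obtain y w where yw: "y \<in> span S" "\<And>v. v \<in> span S \<Longrightarrow> orthogonal w v" "x = y + w"
    using orthogonal_subspace_decomp_exists by blast
  have "y \<in> S" "\<forall>z\<in>S. (x - y) \<bullet> z = 0"
    using yw by (auto simp: orthogonal_def sp)
  then show "orth_proj S x \<in> S" and "z \<in> S \<Longrightarrow> (x - orth_proj S x) \<bullet> z = 0"
    using orth_proj_unique[OF assms] by auto
qed

definition direct_sum_scaling :: "'i set \<Rightarrow> ('i \<Rightarrow> 'a::euclidean_space set) \<Rightarrow> ('i \<Rightarrow> real) \<Rightarrow> 'a \<Rightarrow> 'a" where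
  "direct_sum_scaling I E c x = (\<Sum>i\<in>I. c i *\<^sub>R orth_proj (E i) x)"

definition self_adjoint :: "('a::euclidean_space \<Rightarrow> 'a) \<Rightarrow> bool" where
  "self_adjoint A \<longleftrightarrow> linear A \<and> adjoint A = A"

definition psd :: "('a::euclidean_space \<Rightarrow> 'a) \<Rightarrow> bool" where
  "psd A \<longleftrightarrow> self_adjoint A \<and> (\<forall>x. 0 \<le> A x \<bullet> x)"

definition loewner_le :: "('a::euclidean_space \<Rightarrow> 'a) \<Rightarrow> ('a \<Rightarrow> 'a) \<Rightarrow> bool" where
  "loewner_le A B \<longleftrightarrow> self_adjoint A \<and> self_adjoint B \<and> psd (\<lambda>x. B x - A x)"

definition coupling_id :: "'i set \<Rightarrow> ('i \<Rightarrow> 'a::euclidean_space set) \<Rightarrow> ('a \<Rightarrow> 'a) set" where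
  "coupling_id I E = {A. psd A \<and> (\<forall>i\<in>I. \<forall>x\<in>E i. A x \<bullet> x = x \<bullet> x)}"

definition orthonormal_basis_of :: "'a::euclidean_space set \<Rightarrow> 'a set \<Rightarrow> bool" where
  "orthonormal_basis_of S B \<longleftrightarrow>
     finite B \<and> pairwise orthogonal B \<and> (\<forall>b\<in>B. norm b = 1) \<and> span B = S"

lemma orthonormal_basis_of_exists:
  assumes "subspace S"
  shows "\<exists>B. orthonormal_basis_of S B"
proof -
  obtain B where "B \<subseteq> S" "pairwise orthogonal B" "\<And>x. x \<in> B \<Longrightarrow> norm x = 1"
      "independent B" "card B = dim S" "span B = S"
    using orthonormal_basis_subspace[OF assms] by blast
  then show ?thesis
    unfolding orthonormal_basis_of_def using independent_imp_finite by blast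
qed

(* Lebesgue measure on a linear subspace S, as a measure space with carrier S and with the
   Lebesgue-measurable sets.  It is the completed image of the product Lebesgue measure under the
   coordinates of an orthonormal basis, as in the library definition of lborel; the choice
   of basis is immaterial because linear isometries preserve Lebesgue measure.
   For S = {0} the basis is empty and the measure is the unit mass at 0. *)
definition lebesgue_subspace :: "'a::euclidean_space set \<Rightarrow> 'a measure" where
  "lebesgue_subspace S =
     (let B = (SOME B. orthonormal_basis_of S B)
      in completion (distr (\<Pi>\<^sub>M b\<in>B. lborel) (restrict_space borel S) (\<lambda>t. \<Sum>b\<in>B. t b *\<^sub>R b)))"

lemma space_lebesgue_subspace [simp]: "space (lebesgue_subspace S) = S"
  by (simp add: lebesgue_subspace_def Let_def space_restrict_space)

lemma orthonormal_coordinates_measurable: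
  assumes "orthonormal_basis_of S B"
  shows "(\<lambda>t. \<Sum>b\<in>B. t b *\<^sub>R b) \<in> measurable (\<Pi>\<^sub>M b\<in>B. lborel) (restrict_space borel S)"
proof (rule measurable_restrict_space2)
  show "(\<lambda>t. \<Sum>b\<in>B. t b *\<^sub>R b) \<in> space (\<Pi>\<^sub>M b\<in>B. lborel) \<rightarrow> S"
    using assms by (auto simp: orthonormal_basis_of_def intro!: span_sum span_scale intro: span_base)
  show "(\<lambda>t. \<Sum>b\<in>B. t b *\<^sub>R b) \<in> borel_measurable (\<Pi>\<^sub>M b\<in>B. lborel)"
    by measurable
qed

(* Real powers of extended nonnegative numbers, for exponents p > 0 only: infinity to the power p
   is infinity and 0 to the power p is 0. *)
definition ennreal_powr :: "ennreal \<Rightarrow> real \<Rightarrow> ennreal" where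
  "ennreal_powr x p = (if x = \<infinity> then \<infinity> else ennreal (enn2real x powr p))"

end

theory Submission
  imports Defs "HOL-Probability.Probability"
begin

text \<open>
  Let \<open>W\<close> be a Gaussian vector on \<open>E\<^sub>0\<close> with covariance \<open>\<Sigma>\<close>; its projections to the \<open>E\<^sub>i\<close> and its
  images under the \<open>Q\<^sub>j\<close> are standard Gaussian. For \<open>f\<^sub>i = exp \<phi>\<^sub>i\<close>, \<open>g\<^sub>j = exp \<psi>\<^sub>j\<close> bounded above and
  away from \<open>0\<close> and evolved by the heat flows of these images, the pointwise inequality
  \<open>\<Sum> c\<^sub>i \<phi>\<^sub>i(x\<^sub>i) \<le> \<Sum> d\<^sub>j \<psi>\<^sub>j(Q\<^sub>j x)\<close> is preserved. This is a discretisation of Lehec's argument with the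
  Borell--Foellmer drift: over a time step \<open>h\<close>, Cameron--Martin and Jensen give
  \<open>ln P\<^sub>h e\<^sup>\<psi>(y) \<ge> P\<^sub>h \<psi>(y + h v) - h |v|\<^sup>2 / 2\<close> for every \<open>v\<close>, while for \<open>\<phi>\<close> with Lipschitz gradient the
  drift \<open>u = \<nabla>\<phi>(x)\<close> turns this into an equality up to \<open>O(h\<^sup>2)\<close>. Applying the bounds with
  \<open>v\<^sub>j = Q\<^sub>j u\<close>, the drift energies compare by \<open>\<Sum> d\<^sub>j Q\<^sub>j\<^sup>* Q\<^sub>j \<le> \<Lambda>\<^sub>c\<close>, and the errors of the \<open>1/h\<close> steps sum to
  \<open>O(h)\<close>. No regularity of the \<open>\<psi>\<^sub>j\<close> is needed, and general \<open>\<phi>\<^sub>i\<close> are first replaced by the averages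
  \<open>P\<^sub>\<tau> \<phi>\<^sub>i\<close>. The inequality for Gaussian measures of variance \<open>R\<^sup>2\<close> becomes the one for Lebesgue measure as
  \<open>R \<rightarrow> \<infinity>\<close>, because the normalising constants cancel by the dimension condition.
\<close>

section \<open>Gaussian measures\<close>

text \<open>\<open>\<Sigma>\<close> may be singular, so \<open>W\<close> is realised as
  \<open>A z\<close> with \<open>z\<close> standard Gaussian and \<open>A\<close> composed with its
  adjoint equal to \<open>\<Sigma>\<close>; densities are used only for \<open>z\<close> and for the
  images in the summands and targets. The laws of these images are identified by their behaviour
  under translations, which avoids rotating the arbitrary basis hidden in
  \<open>lebesgue_subspace\<close>. Smoothing acts on the logarithms because the hypothesis is
  linear in them: it survives averaging along the one vector \<open>W\<close>, whereas for averaged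
  exponentials this survival is the claim itself. On the \<open>\<psi>\<close> side Jensen removes
  the smoothing at once; on the \<open>\<phi>\<close> side a limit is needed, and since
  \<open>\<phi>\<close> is only measurable it is taken in mean. The steps can be iterated because
  the gradient bounds of the evolved logarithms do not depend on the time. Two obstacles remain at
  the end. The functions are measurable only for a completed measure while the hypothesis is
  pointwise, so Borel minorants and majorants are needed; and \<open>0 * \<infinity> = 0\<close>
  makes the product of integrals discontinuous, so vanishing and infinite integrals are treated
  apart.\<close>

definition gauss :: "'a::euclidean_space measure" where
  "gauss = density lborel (\<lambda>x. ennreal (\<Prod>b\<in>Basis. std_normal_density (x \<bullet> b)))"

lemma sets_gauss [measurable_cong, simp]: "sets gauss = sets borel"
  by (simp add: gauss_def)

lemma space_gauss [simp]: "space gauss = UNIV"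
  by (simp add: gauss_def)

lemma sum_Basis_power2:
  fixes x :: "'a::euclidean_space"
  shows "(\<Sum>b\<in>Basis. (x \<bullet> b)\<^sup>2) = x \<bullet> x"
  by (subst euclidean_inner) (simp add: power2_eq_square)

lemma prod_std_normal_density:
  fixes x :: "'a::euclidean_space"
  shows "(\<Prod>b\<in>Basis. std_normal_density (x \<bullet> b))
    = (1 / sqrt (2 * pi)) ^ DIM('a) * exp (- (x \<bullet> x) / 2)"
proof -
  have "(\<Prod>b\<in>Basis. std_normal_density (x \<bullet> b))
      = (\<Prod>b\<in>(Basis::'a set). 1 / sqrt (2 * pi)) * exp (\<Sum>b\<in>Basis. - (x \<bullet> b)\<^sup>2 / 2)"
    by (simp only: std_normal_density_def prod.distrib exp_sum finite_Basis)
  also have "(\<Sum>b\<in>Basis. - (x \<bullet> b)\<^sup>2 / 2) = - (x \<bullet> x) / 2"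
    by (simp add: sum_Basis_power2[symmetric] sum_divide_distrib sum_negf)
  finally show ?thesis by simp
qed

lemma prob_space_gauss: "prob_space (gauss :: 'a::euclidean_space measure)"
proof
  have "emeasure gauss (space gauss :: 'a set)
      = (\<integral>\<^sup>+x. (\<Prod>b\<in>Basis. ennreal (std_normal_density (x \<bullet> b))) \<partial>(lborel :: 'a measure))"
    unfolding gauss_def by (simp add: emeasure_density prod_ennreal del: std_normal_density_def)
  also have "\<dots> = (\<Prod>b\<in>(Basis::'a set). (\<integral>\<^sup>+x. ennreal (std_normal_density x) \<partial>lborel))"
    by (rule nn_integral_lborel_prod) auto
  also have "(\<integral>\<^sup>+x. ennreal (std_normal_density x) \<partial>lborel) = 1"
    using prob_space.emeasure_space_1[OF prob_space_normal_density[of 1 0]]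
    by (simp add: emeasure_density)
  finally show "emeasure gauss (space gauss :: 'a set) = 1" by simp
qed

interpretation gauss: prob_space gauss
  by (rule prob_space_gauss)

lemma measure_gauss_UNIV [simp]: "measure gauss UNIV = 1"
  using gauss.prob_space by simp

lemma gauss_nn_integral:
  assumes [measurable]: "F \<in> borel_measurable borel"
  shows "(\<integral>\<^sup>+z. F z \<partial>gauss)
    = (\<integral>\<^sup>+z. ennreal ((1 / sqrt (2 * pi)) ^ DIM('a) * exp (- (z \<bullet> z) / 2)) * F z \<partial>(lborel :: 'a::euclidean_space measure))"
  unfolding gauss_def prod_std_normal_density by (subst nn_integral_density) simp_all

lemma lborel_nn_integral_affine:
  fixes F :: "'a::euclidean_space \<Rightarrow> ennreal"
  assumes [measurable]: "F \<in> borel_measurable borel" and "c \<noteq> 0"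
  shows "(\<integral>\<^sup>+z. F z \<partial>lborel) = ennreal (\<bar>c\<bar> ^ DIM('a)) * (\<integral>\<^sup>+z. F (t + c *\<^sub>R z) \<partial>lborel)"
  by (subst lborel_affine[OF \<open>c \<noteq> 0\<close>, of t])
     (simp add: nn_integral_density nn_integral_distr nn_integral_cmult)

text \<open>The Cameron--Martin formula: translate Lebesgue measure and complete the square in the
  Gaussian exponent.\<close>

lemma gauss_shift_nn_integral:
  fixes F :: "'a::euclidean_space \<Rightarrow> ennreal"
  assumes [measurable]: "F \<in> borel_measurable borel"
  shows "(\<integral>\<^sup>+z. F (z + a) \<partial>gauss) = (\<integral>\<^sup>+z. ennreal (exp (a \<bullet> z - a \<bullet> a / 2)) * F z \<partial>gauss)"
proof -
  let ?c = "(1 / sqrt (2 * pi)) ^ DIM('a)"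
  have "(\<integral>\<^sup>+z. ennreal (exp (a \<bullet> z - a \<bullet> a / 2)) * F z \<partial>gauss)
    = (\<integral>\<^sup>+z. ennreal (?c * exp (- (z \<bullet> z) / 2)) * (ennreal (exp (a \<bullet> z - a \<bullet> a / 2)) * F z) \<partial>lborel)"
    by (rule gauss_nn_integral) simp
  also have "\<dots> = (\<integral>\<^sup>+z. ennreal (?c * exp (- ((z - a) \<bullet> (z - a)) / 2)) * F z \<partial>lborel)"
  proof (intro nn_integral_cong)
    fix z :: 'a
    have "exp (- (z \<bullet> z) / 2) * exp (a \<bullet> z - a \<bullet> a / 2) = exp (- ((z - a) \<bullet> (z - a)) / 2)"
      unfolding exp_add[symmetric]
      by (rule arg_cong[where f=exp]) (simp add: inner_diff_left inner_diff_right inner_commute[of z a] diff_divide_distrib add_divide_distrib)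
    then show "ennreal (?c * exp (- (z \<bullet> z) / 2)) * (ennreal (exp (a \<bullet> z - a \<bullet> a / 2)) * F z)
        = ennreal (?c * exp (- ((z - a) \<bullet> (z - a)) / 2)) * F z"
      by (simp add: mult.assoc[symmetric] ennreal_mult[symmetric]) (simp add: mult.assoc)
  qed
  also have "\<dots> = (\<integral>\<^sup>+z. ennreal (?c * exp (- (z \<bullet> z) / 2)) * F (z + a) \<partial>lborel)"
    by (subst lborel_nn_integral_affine[where c=1 and t=a]) (simp_all add: add.commute)
  also have "\<dots> = (\<integral>\<^sup>+z. F (z + a) \<partial>gauss)"
    by (rule gauss_nn_integral[symmetric]) simp
  finally show ?thesis by simp
qed

lemma gauss_shift_distr:
  "distr gauss borel (\<lambda>z. z + a) = density gauss (\<lambda>z. ennreal (exp (a \<bullet> z - a \<bullet> a / 2)))"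
proof (rule measure_eqI)
  fix X assume "X \<in> sets (distr gauss borel (\<lambda>z. z + a))"
  then have [measurable]: "X \<in> sets borel" by simp
  show "emeasure (distr gauss borel (\<lambda>z. z + a)) X
      = emeasure (density gauss (\<lambda>z. ennreal (exp (a \<bullet> z - a \<bullet> a / 2)))) X"
    using gauss_shift_nn_integral[of "indicator X" a]
    by (subst nn_integral_indicator[symmetric], simp, subst nn_integral_distr)
       (auto simp: emeasure_density)
qed simp

lemma gauss_shift:
  fixes F :: "'a::euclidean_space \<Rightarrow> real"
  assumes [measurable]: "F \<in> borel_measurable borel"
  shows "(\<integral>z. F (z + a) \<partial>gauss) = (\<integral>z. exp (a \<bullet> z - a \<bullet> a / 2) * F z \<partial>gauss)"
proof -
  have "(\<integral>z. F (z + a) \<partial>gauss) = (\<integral>z. F z \<partial>distr gauss borel (\<lambda>z. z + a))"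
    by (subst integral_distr) simp_all
  also have "\<dots> = (\<integral>z. exp (a \<bullet> z - a \<bullet> a / 2) * F z \<partial>gauss)"
    unfolding gauss_shift_distr by (subst integral_density) simp_all
  finally show ?thesis .
qed

text \<open>Reflection symmetry replaces the computation of first moments: a linear functional is
  odd, so its mean is zero.\<close>

lemma gauss_uminus:
  fixes F :: "'a::euclidean_space \<Rightarrow> real"
  assumes [measurable]: "F \<in> borel_measurable borel"
  shows "(\<integral>z. F (- z) \<partial>gauss) = (\<integral>z. F z \<partial>gauss)"
proof -
  have "distr gauss borel uminus = (gauss :: 'a measure)"
  proof (rule measure_eqI)
    fix X :: "'a set" assume "X \<in> sets (distr gauss borel uminus)"
    then have [measurable]: "X \<in> sets borel" by simp
    show "emeasure (distr gauss borel uminus) X = emeasure gauss X"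
      by (subst (1 2) nn_integral_indicator[symmetric], simp, simp, subst nn_integral_distr, simp, simp,
          subst (1 2) gauss_nn_integral, simp, simp,
          subst (2) lborel_nn_integral_affine[where c="-1" and t=0]) simp_all
  qed simp
  then have "(\<integral>z. F z \<partial>gauss) = (\<integral>z. F z \<partial>distr gauss borel uminus)" by simp
  also have "\<dots> = (\<integral>z. F (- z) \<partial>gauss)"
    by (subst integral_distr) simp_all
  finally show ?thesis by simp
qed

lemma gauss_integral_inner: "(\<integral>z. a \<bullet> z \<partial>gauss) = 0"
  using gauss_uminus[of "\<lambda>z. a \<bullet> z"] by simp

lemma nn_integral_exp_square:
  assumes "0 < r"
  shows "(\<integral>\<^sup>+t. ennreal (exp (- r * t\<^sup>2 / 2)) \<partial>lborel) = ennreal (sqrt (2 * pi / r))"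
proof -
  have eq: "exp (- r * t\<^sup>2 / 2) = sqrt (2 * pi / r) * normal_density 0 (sqrt (1/r)) t" for t
    using assms by (simp add: normal_density_def real_sqrt_divide field_simps real_sqrt_mult)
  have "(\<integral>\<^sup>+t. ennreal (normal_density 0 (sqrt (1/r)) t) \<partial>lborel) = 1"
    using prob_space.emeasure_space_1[OF prob_space_normal_density[of "sqrt (1/r)" 0]] assms
    by (simp add: emeasure_density)
  then show ?thesis
    unfolding eq using assms by (simp add: ennreal_mult nn_integral_cmult)
qed

text \<open>Multiplied by the Gaussian weight this still leaves
  \<open>exp (- (z \<bullet> z) / 4)\<close>. It is the common dominating function for the linear
  and exponential integrands below.\<close>

lemma gauss_integrable_exp_square:
  "integrable (gauss :: 'a::euclidean_space measure) (\<lambda>z. exp ((z \<bullet> z) / 4))"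
proof (rule integrableI_nonneg)
  have "(\<integral>\<^sup>+z. ennreal (exp ((z \<bullet> z) / 4)) \<partial>(gauss :: 'a measure))
     = (\<integral>\<^sup>+z. ennreal ((1 / sqrt (2 * pi)) ^ DIM('a)) * (\<Prod>b\<in>Basis. ennreal (exp (- (1/2) * (z \<bullet> b)\<^sup>2 / 2))) \<partial>(lborel :: 'a measure))"
  proof (subst gauss_nn_integral, simp, intro nn_integral_cong)
    fix z :: 'a
    have "(\<Prod>b\<in>Basis. exp (- (1/2) * (z \<bullet> b)\<^sup>2 / 2)) = exp (- (z \<bullet> z) / 4)"
      by (simp add: sum_Basis_power2[symmetric] exp_sum[symmetric] sum_divide_distrib sum_negf)
    then show "ennreal ((1 / sqrt (2 * pi)) ^ DIM('a) * exp (- (z \<bullet> z) / 2)) * ennreal (exp (z \<bullet> z / 4))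
       = ennreal ((1 / sqrt (2 * pi)) ^ DIM('a)) * (\<Prod>b\<in>Basis. ennreal (exp (- (1/2) * (z \<bullet> b)\<^sup>2 / 2)))"
      by (simp add: prod_ennreal ennreal_mult[symmetric] mult.assoc exp_add[symmetric])
  qed
  also have "\<dots> = ennreal ((1 / sqrt (2 * pi)) ^ DIM('a)) * (\<Prod>b\<in>(Basis::'a set). ennreal (sqrt (2 * pi / (1/2))))"
    by (subst nn_integral_cmult, simp, subst nn_integral_lborel_prod, simp_all only: nn_integral_exp_square) simp_all
  also have "\<dots> < \<infinity>"
    by (simp add: ennreal_mult_less_top ennreal_power)
  finally show "(\<integral>\<^sup>+z. ennreal (exp ((z \<bullet> z) / 4)) \<partial>(gauss :: 'a measure)) < \<infinity>" .
qed simp_all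

lemma gauss_integrable_dominated:
  fixes F :: "'a::euclidean_space \<Rightarrow> real"
  assumes [measurable]: "F \<in> borel_measurable borel" and F: "\<And>z. \<bar>F z\<bar> \<le> C * exp ((z \<bullet> z) / 4)"
  shows "integrable gauss F"
  by (rule Bochner_Integration.integrable_bound[of gauss "\<lambda>z. C * exp ((z \<bullet> z) / 4)"])
     (use F in \<open>auto intro!: gauss_integrable_exp_square order_trans[OF F]\<close>)

lemma gauss_integrable_bounded:
  fixes F :: "'a::euclidean_space \<Rightarrow> real"
  assumes "F \<in> borel_measurable borel" and "\<And>z. \<bar>F z\<bar> \<le> C"
  shows "integrable gauss F"
  by (rule gauss.integrable_const_bound[where B=C]) (use assms in auto)

text \<open>A probability measure whose translates have the Gaussian densities becomes translation
  invariant after multiplication by the inverse Gaussian weight; uniqueness of an invariant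
  measure (by Fubini) then identifies it.\<close>
lemma gaussian_law_unique:
  fixes \<nu> :: "'c::euclidean_space measure" and J :: "'t \<Rightarrow> 'c"
  assumes "prob_space \<nu>" "sigma_finite_measure M"
    and [measurable_cong]: "sets \<nu> = sets borel" and [measurable]: "J \<in> M \<rightarrow>\<^sub>M borel"
    and supp: "AE y in \<nu>. y \<in> S" "\<And>t. t \<in> space M \<Longrightarrow> J t \<in> S"
    and shift: "\<And>u F. u \<in> S \<Longrightarrow> F \<in> borel_measurable borel \<Longrightarrow>
      (\<integral>\<^sup>+y. F (y + u) \<partial>\<nu>) = (\<integral>\<^sup>+y. ennreal (exp (r * (u \<bullet> y) - r * (u \<bullet> u) / 2)) * F y \<partial>\<nu>)"
    and invar: "\<And>u F. u \<in> S \<Longrightarrow> F \<in> borel_measurable borel \<Longrightarrow>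
      (\<integral>\<^sup>+t. F (J t + u) \<partial>M) = (\<integral>\<^sup>+t. F (J t) \<partial>M)"
    and F [measurable]: "F \<in> borel_measurable borel"
  shows "(\<integral>\<^sup>+y. F y \<partial>\<nu>) * (\<integral>\<^sup>+t. ennreal (exp (- r * (J t \<bullet> J t) / 2)) \<partial>M)
    = (\<integral>\<^sup>+t. ennreal (exp (- r * (J t \<bullet> J t) / 2)) * F (J t) \<partial>M)"
proof -
  interpret \<nu>: prob_space \<nu> by fact
  interpret M: sigma_finite_measure M by fact
  interpret P: pair_sigma_finite \<nu> M ..
  \<comment> \<open>\<open>w\<close> undoes the Gaussian weight \<open>G\<close>. The measure
    \<open>w\<close> times \<open>\<nu>\<close> may be infinite, which is why the argument uses
    nonnegative integrals throughout.\<close>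
  define w where "w y = ennreal (exp (r * (y \<bullet> y) / 2))" for y :: 'c
  define G where "G y = ennreal (exp (- r * (y \<bullet> y) / 2))" for y :: 'c
  define H where "H y = G y * F y" for y
  have [measurable]: "w \<in> borel_measurable borel" "G \<in> borel_measurable borel" "H \<in> borel_measurable borel"
    unfolding w_def G_def H_def by measurable
  have wG: "w y * G y = 1" for y
    by (simp add: w_def G_def ennreal_mult[symmetric] exp_add[symmetric])
  have Geven: "G (y - x) = G (x - y)" for x y
    unfolding G_def by (simp add: inner_diff_left inner_diff_right inner_commute[of x y])
  have inv: "(\<integral>\<^sup>+x. w x * K (x + y) \<partial>\<nu>) = (\<integral>\<^sup>+x. w x * K x \<partial>\<nu>)"
    if "y \<in> S" and [measurable]: "K \<in> borel_measurable borel" for y K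
  proof -
    have "(\<integral>\<^sup>+x. w x * K (x + y) \<partial>\<nu>) = (\<integral>\<^sup>+x. w ((x + y) - y) * K (x + y) \<partial>\<nu>)" by simp
    also have "\<dots> = (\<integral>\<^sup>+x. ennreal (exp (r * (y \<bullet> x) - r * (y \<bullet> y) / 2)) * (w (x - y) * K x) \<partial>\<nu>)"
      by (rule shift[OF that(1), of "\<lambda>x. w (x - y) * K x"]) simp
    also have "\<dots> = (\<integral>\<^sup>+x. w x * K x \<partial>\<nu>)"
    proof (intro nn_integral_cong)
      fix x
      have "exp (r * (y \<bullet> x) - r * (y \<bullet> y) / 2) * exp (r * ((x - y) \<bullet> (x - y)) / 2) = exp (r * (x \<bullet> x) / 2)"
        unfolding exp_add[symmetric]
        by (rule arg_cong[where f=exp])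
           (simp add: inner_diff_left inner_diff_right inner_commute[of x y] algebra_simps add_divide_distrib diff_divide_distrib)
      then show "ennreal (exp (r * (y \<bullet> x) - r * (y \<bullet> y) / 2)) * (w (x - y) * K x) = w x * K x"
        by (simp add: w_def ennreal_mult[symmetric] mult.assoc[symmetric])
    qed
    finally show ?thesis .
  qed
  have FH: "F x = w x * H x" for x
    using wG[of x] by (simp add: H_def mult.assoc[symmetric])
  \<comment> \<open>The double integral of \<open>w x * H (x + J t) * G (J t)\<close> is evaluated
    twice. Integrating over \<open>x\<close> first gives the left side by \<open>inv\<close>.
    Shifting the \<open>M\<close> variable by \<open>x\<close>, which lies in \<open>S\<close>
    almost surely, and then moving \<open>x\<close> by \<open>J t\<close> leaves the integral of
    \<open>H (J t)\<close>, since \<open>w y * G y = 1\<close> and \<open>\<nu>\<close> has mass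
    one.\<close>
  have "(\<integral>\<^sup>+y. F y \<partial>\<nu>) * (\<integral>\<^sup>+t. G (J t) \<partial>M) = (\<integral>\<^sup>+t. (\<integral>\<^sup>+x. w x * H x \<partial>\<nu>) * G (J t) \<partial>M)"
    by (simp add: FH nn_integral_cmult)
  also have "\<dots> = (\<integral>\<^sup>+t. (\<integral>\<^sup>+x. w x * H (x + J t) \<partial>\<nu>) * G (J t) \<partial>M)"
    by (rule nn_integral_cong) (simp add: inv supp(2))
  also have "\<dots> = (\<integral>\<^sup>+t. (\<integral>\<^sup>+x. w x * H (x + J t) * G (J t) \<partial>\<nu>) \<partial>M)"
    by (simp add: nn_integral_multc)
  also have "\<dots> = (\<integral>\<^sup>+x. (\<integral>\<^sup>+t. w x * H (x + J t) * G (J t) \<partial>M) \<partial>\<nu>)"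
    by (rule P.Fubini') measurable
  also have "\<dots> = (\<integral>\<^sup>+x. w x * (\<integral>\<^sup>+t. H (J t + x) * G (J t + x - x) \<partial>M) \<partial>\<nu>)"
    by (simp add: nn_integral_cmult[symmetric] mult.assoc add.commute)
  also have "\<dots> = (\<integral>\<^sup>+x. w x * (\<integral>\<^sup>+t. H (J t) * G (J t - x) \<partial>M) \<partial>\<nu>)"
  proof (rule nn_integral_cong_AE, use supp(1) in eventually_elim)
    fix x assume "x \<in> S"
    from invar[OF this, of "\<lambda>y. H y * G (y - x)"]
    show "w x * (\<integral>\<^sup>+t. H (J t + x) * G (J t + x - x) \<partial>M) = w x * (\<integral>\<^sup>+t. H (J t) * G (J t - x) \<partial>M)"
      by simp
  qed
  also have "\<dots> = (\<integral>\<^sup>+x. (\<integral>\<^sup>+t. H (J t) * (w x * G (x - J t)) \<partial>M) \<partial>\<nu>)"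
    by (simp add: nn_integral_cmult[symmetric] Geven[of _ "_ :: 'c"] mult_ac)
  also have "\<dots> = (\<integral>\<^sup>+t. (\<integral>\<^sup>+x. H (J t) * (w x * G (x - J t)) \<partial>\<nu>) \<partial>M)"
    by (rule P.Fubini'[symmetric]) measurable
  also have "\<dots> = (\<integral>\<^sup>+t. H (J t) * (\<integral>\<^sup>+x. w x * G (x - J t) \<partial>\<nu>) \<partial>M)"
    by (simp add: nn_integral_cmult)
  also have "\<dots> = (\<integral>\<^sup>+t. H (J t) \<partial>M)"
  proof (rule nn_integral_cong)
    fix t assume "t \<in> space M"
    then have "(\<integral>\<^sup>+x. w x * G (x - J t) \<partial>\<nu>) = (\<integral>\<^sup>+x. w x * G (x + J t - J t) \<partial>\<nu>)"
      by (intro inv[symmetric, of "J t" "\<lambda>x. G (x - J t)"] supp(2)) auto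
    then show "H (J t) * (\<integral>\<^sup>+x. w x * G (x - J t) \<partial>\<nu>) = H (J t)"
      by (simp add: wG \<nu>.emeasure_space_1)
  qed
  finally show ?thesis unfolding G_def H_def .
qed

lemma nn_integral_exp_inner:
  assumes "0 < r"
  shows "(\<integral>\<^sup>+z. ennreal (exp (- r * (z \<bullet> z) / 2)) \<partial>(lborel :: 'a::euclidean_space measure))
    = ennreal (sqrt (2 * pi / r)) ^ DIM('a)"
proof -
  have "exp (- r * (z \<bullet> z) / 2) = (\<Prod>b\<in>Basis. exp (- r * (z \<bullet> b)\<^sup>2 / 2))" for z :: 'a
    by (simp add: sum_Basis_power2[symmetric] exp_sum[symmetric] sum_divide_distrib sum_negf sum_distrib_left)
  then show ?thesis
    by (simp only: prod_ennreal[symmetric] exp_ge_zero)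
       (subst nn_integral_lborel_prod, simp_all only: nn_integral_exp_square[OF assms], simp_all)
qed

text \<open>Both laws obey the translation formula with precision \<open>1 / \<rho>\<^sup>2\<close>,
  so \<open>gaussian_law_unique\<close>, with Lebesgue measure as reference, determines each of
  them.\<close>

lemma gauss_conv_distr:
  assumes "\<alpha>\<^sup>2 + \<beta>\<^sup>2 = \<rho>\<^sup>2" "0 < \<rho>"
  shows "distr (gauss \<Otimes>\<^sub>M gauss) borel (\<lambda>(z, z'). \<alpha> *\<^sub>R z + \<beta> *\<^sub>R z')
    = distr gauss borel (\<lambda>z :: 'a::euclidean_space. \<rho> *\<^sub>R z)" (is "?\<nu> = ?\<nu>'")
proof (rule measure_eqI)
  interpret P: pair_prob_space "gauss :: 'a measure" "gauss :: 'a measure" ..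
  define r where "r = 1 / \<rho>\<^sup>2"
  define Z where "Z = (\<integral>\<^sup>+z. ennreal (exp (- r * (z \<bullet> z) / 2)) \<partial>(lborel :: 'a measure))"
  have r: "0 < r" "\<rho> \<noteq> 0" "r * \<rho>\<^sup>2 = 1" using assms by (auto simp: r_def)
  have Z: "Z \<noteq> 0" "Z \<noteq> \<top>"
    unfolding Z_def nn_integral_exp_inner[OF r(1)] using r(1)
    by (auto simp: ennreal_power power_eq_top_ennreal)
  have inv: "(\<integral>\<^sup>+t. F (t + u) \<partial>lborel) = (\<integral>\<^sup>+t. F t \<partial>lborel)"
    if "F \<in> borel_measurable borel" for F and u :: 'a
    using lborel_nn_integral_affine[OF that, of 1 u] by (simp add: add.commute)
  have *: "(\<integral>\<^sup>+y. F y \<partial>\<nu>) * Z = (\<integral>\<^sup>+t. ennreal (exp (- r * (t \<bullet> t) / 2)) * F t \<partial>lborel)"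
    if "prob_space \<nu>" "sets \<nu> = sets borel" "F \<in> borel_measurable borel"
      "\<And>u F. F \<in> borel_measurable borel \<Longrightarrow>
        (\<integral>\<^sup>+y. F (y + u) \<partial>\<nu>) = (\<integral>\<^sup>+y. ennreal (exp (r * (u \<bullet> y) - r * (u \<bullet> u) / 2)) * F y \<partial>\<nu>)"
    for \<nu> :: "'a measure" and F
    unfolding Z_def
    by (rule gaussian_law_unique[where S=UNIV and J="\<lambda>x. x"])
       (rule that sigma_finite_lborel inv | assumption | simp)+
  fix X assume "X \<in> sets ?\<nu>"
  then have [measurable]: "X \<in> sets borel" by simp
  have "(\<integral>\<^sup>+y. indicator X y \<partial>?\<nu>) * Z = (\<integral>\<^sup>+t. ennreal (exp (- r * (t \<bullet> t) / 2)) * indicator X t \<partial>lborel)"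
  proof (rule *)
    show "prob_space ?\<nu>" by (rule P.prob_space_distr) simp
    fix u :: 'a and F :: "'a \<Rightarrow> ennreal" assume [measurable]: "F \<in> borel_measurable borel"
    \<comment> \<open>The shift \<open>u\<close> is split between the two independent variables in
      proportion to their coefficients. With this choice the two Cameron--Martin exponents add up to
      a function of \<open>\<alpha> *\<^sub>R x + \<beta> *\<^sub>R y\<close> alone.\<close>
    define a where "a = (\<alpha> * r) *\<^sub>R u"
    define b where "b = (\<beta> * r) *\<^sub>R u"
    have u: "\<alpha> *\<^sub>R a + \<beta> *\<^sub>R b = u"
    proof -
      have "\<alpha> *\<^sub>R a + \<beta> *\<^sub>R b = (r * (\<alpha>\<^sup>2 + \<beta>\<^sup>2)) *\<^sub>R u"
        by (simp add: a_def b_def power2_eq_square algebra_simps)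
      then show ?thesis using assms r by simp
    qed
    have ab: "exp (a \<bullet> x - a \<bullet> a / 2) * exp (b \<bullet> y - b \<bullet> b / 2)
      = exp (r * (u \<bullet> (\<alpha> *\<^sub>R x + \<beta> *\<^sub>R y)) - r * (u \<bullet> u) / 2)" for x y
    proof -
      have "a \<bullet> a + b \<bullet> b = r * (u \<bullet> (\<alpha> *\<^sub>R a + \<beta> *\<^sub>R b))"
        by (simp add: a_def b_def inner_add_right algebra_simps)
      then have "a \<bullet> a + b \<bullet> b = r * (u \<bullet> u)" by (simp only: u)
      moreover have "a \<bullet> x + b \<bullet> y = r * (u \<bullet> (\<alpha> *\<^sub>R x + \<beta> *\<^sub>R y))"
        by (simp add: a_def b_def inner_add_right algebra_simps)
      ultimately show ?thesis
        unfolding exp_add[symmetric] by (intro arg_cong[where f=exp]) linarith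
    qed
    have "(\<integral>\<^sup>+y. F (y + u) \<partial>?\<nu>) = (\<integral>\<^sup>+z. \<integral>\<^sup>+z'. F (\<alpha> *\<^sub>R z + \<beta> *\<^sub>R z' + (\<alpha> *\<^sub>R a + \<beta> *\<^sub>R b)) \<partial>gauss \<partial>gauss)"
      unfolding u by (subst nn_integral_distr, simp, simp, subst gauss.nn_integral_fst[symmetric]) (auto simp: split_beta)
    also have "\<dots> = (\<integral>\<^sup>+z. \<integral>\<^sup>+z'. F (\<alpha> *\<^sub>R (z + a) + \<beta> *\<^sub>R (z' + b)) \<partial>gauss \<partial>gauss)"
      by (simp add: algebra_simps)
    also have "\<dots> = (\<integral>\<^sup>+z. ennreal (exp (a \<bullet> z - a \<bullet> a / 2)) *
        (\<integral>\<^sup>+z'. ennreal (exp (b \<bullet> z' - b \<bullet> b / 2)) * F (\<alpha> *\<^sub>R z + \<beta> *\<^sub>R z') \<partial>gauss) \<partial>gauss)"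
      by (subst gauss_shift_nn_integral[where F="\<lambda>z'. F (_ + \<beta> *\<^sub>R z')"], simp)
         (rule gauss_shift_nn_integral[where F="\<lambda>z. \<integral>\<^sup>+z'. ennreal (exp (b \<bullet> z' - b \<bullet> b / 2)) * F (\<alpha> *\<^sub>R z + \<beta> *\<^sub>R z') \<partial>gauss"], measurable)
    also have "\<dots> = (\<integral>\<^sup>+z. \<integral>\<^sup>+z'. ennreal (exp (r * (u \<bullet> (\<alpha> *\<^sub>R z + \<beta> *\<^sub>R z')) - r * (u \<bullet> u) / 2)) *
         F (\<alpha> *\<^sub>R z + \<beta> *\<^sub>R z') \<partial>gauss \<partial>gauss)"
      by (subst nn_integral_cmult[symmetric], simp)
         (simp add: mult.assoc[symmetric] ennreal_mult[symmetric] ab)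
    also have "\<dots> = (\<integral>\<^sup>+y. ennreal (exp (r * (u \<bullet> y) - r * (u \<bullet> u) / 2)) * F y \<partial>?\<nu>)"
      by (subst nn_integral_distr, simp, simp, subst gauss.nn_integral_fst[symmetric]) (auto simp: split_beta)
    finally show "(\<integral>\<^sup>+y. F (y + u) \<partial>?\<nu>) = (\<integral>\<^sup>+y. ennreal (exp (r * (u \<bullet> y) - r * (u \<bullet> u) / 2)) * F y \<partial>?\<nu>)" .
  qed simp_all
  moreover have "(\<integral>\<^sup>+y. indicator X y \<partial>?\<nu>') * Z = (\<integral>\<^sup>+t. ennreal (exp (- r * (t \<bullet> t) / 2)) * indicator X t \<partial>lborel)"
  proof (rule *)
    show "prob_space ?\<nu>'" by (rule gauss.prob_space_distr) simp
    fix u :: 'a and F :: "'a \<Rightarrow> ennreal" assume [measurable]: "F \<in> borel_measurable borel"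
    have "(\<integral>\<^sup>+y. F (y + u) \<partial>?\<nu>') = (\<integral>\<^sup>+z. F (\<rho> *\<^sub>R (z + (1 / \<rho>) *\<^sub>R u)) \<partial>gauss)"
      using r by (subst nn_integral_distr) (auto simp: algebra_simps)
    also have "\<dots> = (\<integral>\<^sup>+z. ennreal (exp (r * (u \<bullet> (\<rho> *\<^sub>R z)) - r * (u \<bullet> u) / 2)) * F (\<rho> *\<^sub>R z) \<partial>gauss)"
      using r(2) by (subst gauss_shift_nn_integral[where F="\<lambda>z. F (\<rho> *\<^sub>R z)"])
         (auto simp: r_def power2_eq_square)
    finally show "(\<integral>\<^sup>+y. F (y + u) \<partial>?\<nu>') = (\<integral>\<^sup>+y. ennreal (exp (r * (u \<bullet> y) - r * (u \<bullet> u) / 2)) * F y \<partial>?\<nu>')"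
      by (subst nn_integral_distr) auto
  qed simp_all
  ultimately have "emeasure ?\<nu> X * Z = emeasure ?\<nu>' X * Z" by simp
  then show "emeasure ?\<nu> X = emeasure ?\<nu>' X"
    using Z by (simp add: mult.commute[of _ Z] ennreal_mult_cancel_left)
qed simp

section \<open>Coisometries and the heat flow\<close>

text \<open>Supplies translation invariance for coordinates of a subspace. Uniqueness of the product
  measure reduces it to boxes; the restriction to \<open>B\<close> keeps the shifted point
  extensional.\<close>

lemma PiM_lborel_translate:
  assumes "finite B"
  shows "distr (\<Pi>\<^sub>M b\<in>B. (lborel :: real measure)) (\<Pi>\<^sub>M b\<in>B. lborel) (\<lambda>t. \<lambda>b\<in>B. t b + s b)
    = (\<Pi>\<^sub>M b\<in>B. lborel)"
proof -
  interpret product_sigma_finite "\<lambda>_. lborel :: real measure"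
    by standard (rule lborel.sigma_finite_countable)
  show ?thesis
  proof (rule PiM_eqI[OF assms])
    fix A :: "'a \<Rightarrow> real set" assume A: "\<And>b. b \<in> B \<Longrightarrow> A b \<in> sets lborel"
    have eq: "(\<lambda>t. \<lambda>b\<in>B. t b + s b) -` Pi\<^sub>E B A \<inter> space (\<Pi>\<^sub>M b\<in>B. (lborel :: real measure))
        = Pi\<^sub>E B (\<lambda>b. (\<lambda>t. s b + t) -` A b)"
      by (auto simp: space_PiM PiE_iff add.commute)
    have m: "(\<lambda>t. s b + t) -` A b \<in> sets lborel" if "b \<in> B" for b
      using measurable_sets[of "\<lambda>t. s b + t" borel borel "A b"] A[OF that] by simp
    have "emeasure lborel ((\<lambda>t. s b + t) -` A b) = emeasure lborel (A b)" if "b \<in> B" for b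
      using A[OF that] by (subst (2) lborel_distr_plus[of "s b", symmetric]) (simp add: emeasure_distr)
    then show "emeasure (distr (\<Pi>\<^sub>M b\<in>B. (lborel :: real measure)) (\<Pi>\<^sub>M b\<in>B. lborel) (\<lambda>t. \<lambda>b\<in>B. t b + s b)) (Pi\<^sub>E B A)
        = (\<Prod>b\<in>B. emeasure lborel (A b))"
      using A m assms by (subst emeasure_distr) (auto simp: eq emeasure_PiM intro!: sets_PiM_I_finite)
  qed simp
qed

text \<open>Under \<open>gauss\<close> the vector \<open>T z\<close> has covariance \<open>T\<close>
  composed with \<open>adjoint T\<close>, and the last condition makes this the identity on
  \<open>S\<close>. Hence these are the maps sending the standard Gaussian to the standard Gaussian
  of \<open>S\<close>.\<close>

locale coisometry =
  fixes T :: "'a::euclidean_space \<Rightarrow> 'c::euclidean_space" and S :: "'c set"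
  assumes linear: "linear T" and subspace: "subspace S" and range: "T z \<in> S"
    and coisometry: "y \<in> S \<Longrightarrow> T (adjoint T y) = y"
begin

lemma borel_measurable [measurable]: "T \<in> borel_measurable borel"
  by (intro borel_measurable_continuous_onI linear_continuous_on) (simp add: linear linear_conv_bounded_linear[symmetric])

lemma inner_adjoint: "adjoint T y \<bullet> z = y \<bullet> T z"
  by (rule adjoint_clauses(2)[OF linear])

lemma inner_adjoint_adjoint: "y \<in> S \<Longrightarrow> adjoint T y \<bullet> adjoint T y = y \<bullet> y"
  by (simp add: inner_adjoint coisometry)

text \<open>\<open>adjoint T\<close> is isometric on \<open>S\<close>, so Cauchy--Schwarz for
  \<open>adjoint T (T z)\<close> and \<open>z\<close> bounds the square of \<open>norm (T z)\<close>
  by \<open>norm (T z) * norm z\<close>.\<close>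

lemma contraction: "norm (T z) \<le> norm z"
proof -
  have "norm (adjoint T (T z)) = norm (T z)"
    by (simp add: norm_eq_sqrt_inner inner_adjoint_adjoint range)
  moreover have "(norm (T z))\<^sup>2 = adjoint T (T z) \<bullet> z"
    by (simp add: inner_adjoint dot_square_norm)
  moreover have "\<dots> \<le> norm (adjoint T (T z)) * norm z"
    by (rule norm_cauchy_schwarz)
  ultimately have "norm (T z) * norm (T z) \<le> norm (T z) * norm z"
    by (simp add: power2_eq_square)
  then show ?thesis
    by (cases "norm (T z) = 0") (simp_all add: mult_le_cancel_left)
qed

text \<open>A translation by \<open>u\<close> in the image lifts to the translation of
  \<open>z\<close> by \<open>adjoint T u\<close>, a vector of the same length.\<close>

lemma shift:
  fixes F :: "'c \<Rightarrow> real"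
  assumes [measurable]: "F \<in> borel_measurable borel" and "u \<in> S" "0 < R"
  shows "(\<integral>z. F (x + R *\<^sub>R T z + R *\<^sub>R u) \<partial>gauss)
    = (\<integral>z. exp (u \<bullet> T z - u \<bullet> u / 2) * F (x + R *\<^sub>R T z) \<partial>gauss)"
proof -
  have "(\<integral>z. F (x + R *\<^sub>R T z + R *\<^sub>R u) \<partial>gauss) = (\<integral>z. F (x + R *\<^sub>R T (z + adjoint T u)) \<partial>gauss)"
    by (simp add: linear_add[OF linear] coisometry assms algebra_simps)
  also have "\<dots> = (\<integral>z. exp (adjoint T u \<bullet> z - adjoint T u \<bullet> adjoint T u / 2) * F (x + R *\<^sub>R T z) \<partial>gauss)"
    by (rule gauss_shift) simp
  finally show ?thesis by (simp add: inner_adjoint coisometry assms)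
qed

text \<open>Identifies the law of \<open>R *\<^sub>R T z\<close> with the Gaussian of variance
  \<open>R\<^sup>2\<close> on \<open>S\<close>. The reference measure is the coordinate measure in
  the very basis chosen inside \<open>lebesgue_subspace\<close>, so independence of the basis never
  enters.\<close>

lemma law:
  assumes [measurable]: "F \<in> borel_measurable borel" and "0 < R"
  shows "(\<integral>\<^sup>+z. F (R *\<^sub>R T z) \<partial>gauss) * ennreal (sqrt (2 * pi) * R) ^ dim S
    = (\<integral>\<^sup>+y. ennreal (exp (- (y \<bullet> y) / (2 * R\<^sup>2))) * F y \<partial>lebesgue_subspace S)"
proof -
  define B where "B = (SOME B. orthonormal_basis_of S B)"
  have onb: "orthonormal_basis_of S B"
    unfolding B_def by (rule someI_ex) (rule orthonormal_basis_of_exists[OF subspace])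
  then have B: "finite B" "pairwise orthogonal B" "\<And>b. b \<in> B \<Longrightarrow> norm b = 1" "span B = S"
    by (auto simp: orthonormal_basis_of_def)
  have "0 \<notin> B" using B(3) by force
  then have "independent B"
    using B(2) pairwise_orthogonal_independent by blast
  then have dim: "dim S = card B"
    using B(4) dim_span dim_eq_card_independent by metis
  have inner_B: "(\<Sum>b\<in>B. t b *\<^sub>R b) \<bullet> b' = t b'" if "b' \<in> B" for t and b' :: 'c
  proof -
    have "(\<Sum>b\<in>B. t b *\<^sub>R b) \<bullet> b' = (\<Sum>b\<in>B. if b = b' then t b else 0)"
      unfolding inner_sum_left
      using B(2,3) that by (intro sum.cong) (auto simp: pairwise_def orthogonal_def dot_square_norm)
    then show ?thesis using that B(1) by simp
  qed
  define J where "J t = (\<Sum>b\<in>B. t b *\<^sub>R b)" for t :: "'c \<Rightarrow> real"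
  define M where "M = (\<Pi>\<^sub>M b\<in>B. (lborel :: real measure))"
  define r where "r = 1 / R\<^sup>2"
  have r: "0 < r" using assms by (simp add: r_def)
  interpret product_sigma_finite "\<lambda>_. lborel :: real measure"
    by standard (rule lborel.sigma_finite_countable)
  have J_meas [measurable]: "J \<in> M \<rightarrow>\<^sub>M borel"
    unfolding J_def M_def by measurable
  have JJ: "J t \<bullet> J t = (\<Sum>b\<in>B. (t b)\<^sup>2)" for t
    unfolding J_def by (subst inner_sum_right) (simp add: inner_B power2_eq_square)
  have leb: "(\<integral>\<^sup>+y. G y \<partial>lebesgue_subspace S) = (\<integral>\<^sup>+t. G (J t) \<partial>M)"
    if [measurable]: "G \<in> borel_measurable borel" for G :: "'c \<Rightarrow> ennreal"
    unfolding lebesgue_subspace_def Let_def nn_integral_completion B_def[symmetric]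
    by (subst nn_integral_distr[OF orthonormal_coordinates_measurable[OF onb]])
       (auto simp: J_def M_def intro: measurable_restrict_space1)
  let ?\<nu> = "distr gauss borel (\<lambda>z. R *\<^sub>R T z)"
  have "(\<integral>\<^sup>+y. F y \<partial>?\<nu>) * (\<integral>\<^sup>+t. ennreal (exp (- r * (J t \<bullet> J t) / 2)) \<partial>M)
      = (\<integral>\<^sup>+t. ennreal (exp (- r * (J t \<bullet> J t) / 2)) * F (J t) \<partial>M)"
  proof (rule gaussian_law_unique[where S=S])
    show "prob_space ?\<nu>" by (rule gauss.prob_space_distr) simp
    show "sigma_finite_measure M"
      unfolding M_def by (rule sigma_finite[OF B(1)])
    have "S \<in> sets borel"
      using borel_closed[OF closed_subspace[OF subspace]] by simp
    then show "AE y in ?\<nu>. y \<in> S"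
      by (subst AE_distr_iff) (auto simp: range subspace_scale[OF subspace])
    show "J t \<in> S" for t
      unfolding J_def B(4)[symmetric] by (intro span_sum span_scale span_base)
  next
    fix u and G :: "'c \<Rightarrow> ennreal" assume u: "u \<in> S" and [measurable]: "G \<in> borel_measurable borel"
    let ?a = "(1 / R) *\<^sub>R adjoint T u"
    have "(\<integral>\<^sup>+y. G (y + u) \<partial>?\<nu>) = (\<integral>\<^sup>+z. G (R *\<^sub>R T (z + ?a)) \<partial>gauss)"
      using assms u
      by (subst nn_integral_distr) (auto simp: linear_add[OF linear] linear_scale[OF linear] coisometry algebra_simps)
    also have "\<dots> = (\<integral>\<^sup>+z. ennreal (exp (?a \<bullet> z - ?a \<bullet> ?a / 2)) * G (R *\<^sub>R T z) \<partial>gauss)"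
      by (rule gauss_shift_nn_integral) simp
    also have "\<dots> = (\<integral>\<^sup>+y. ennreal (exp (r * (u \<bullet> y) - r * (u \<bullet> u) / 2)) * G y \<partial>?\<nu>)"
      using assms u
      by (subst nn_integral_distr) (auto simp: inner_adjoint linear_scale[OF linear] coisometry r_def power2_eq_square)
    finally show "(\<integral>\<^sup>+y. G (y + u) \<partial>?\<nu>) = (\<integral>\<^sup>+y. ennreal (exp (r * (u \<bullet> y) - r * (u \<bullet> u) / 2)) * G y \<partial>?\<nu>)" .
    \<comment> \<open>The coordinates of \<open>u\<close>: adding them in the product space is
      translation by \<open>u\<close> in \<open>S\<close>.\<close>
    define s where "s b = u \<bullet> b" for b
    have Ju: "J (\<lambda>b\<in>B. t b + s b) = J t + u" for t
    proof -
      have "u = J s"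
      proof -
        have "u \<in> span B" using u B(4) by simp
        then obtain s' where s': "u = (\<Sum>b\<in>B. s' b *\<^sub>R b)"
          using B(1) by (auto simp: span_finite)
        then have "s b = s' b" if "b \<in> B" for b
          using that inner_B by (simp add: s_def)
        then show ?thesis unfolding J_def s' by (intro sum.cong) auto
      qed
      then show ?thesis
        by (simp add: J_def scaleR_add_left sum.distrib)
    qed
    have "(\<integral>\<^sup>+t. G (J t) \<partial>M) = (\<integral>\<^sup>+t. G (J t) \<partial>distr M M (\<lambda>t. \<lambda>b\<in>B. t b + s b))"
      unfolding M_def using PiM_lborel_translate[OF B(1), of s] by simp
    also have "\<dots> = (\<integral>\<^sup>+t. G (J t + u) \<partial>M)"
      by (subst nn_integral_distr) (auto simp: Ju, simp add: M_def)
    finally show "(\<integral>\<^sup>+t. G (J t + u) \<partial>M) = (\<integral>\<^sup>+t. G (J t) \<partial>M)" by simp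
  qed simp_all
  also have "(\<integral>\<^sup>+t. ennreal (exp (- r * (J t \<bullet> J t) / 2)) \<partial>M)
      = (\<integral>\<^sup>+t. (\<Prod>b\<in>B. ennreal (exp (- r * (t b)\<^sup>2 / 2))) \<partial>M)"
    by (simp add: JJ prod_ennreal exp_sum[symmetric] B(1) sum_distrib_left sum_divide_distrib sum_negf)
  also have "\<dots> = ennreal (sqrt (2 * pi / r)) ^ dim S"
    unfolding M_def by (subst product_nn_integral_prod[OF B(1)]) (simp_all add: nn_integral_exp_square[OF r, simplified] dim)
  also have "sqrt (2 * pi / r) = sqrt (2 * pi) * R"
    using assms by (simp add: r_def real_sqrt_mult)
  also have "(\<integral>\<^sup>+y. F y \<partial>?\<nu>) = (\<integral>\<^sup>+z. F (R *\<^sub>R T z) \<partial>gauss)"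
    by (subst nn_integral_distr) auto
  also have "(\<integral>\<^sup>+t. ennreal (exp (- r * (J t \<bullet> J t) / 2)) * F (J t) \<partial>M)
      = (\<integral>\<^sup>+y. ennreal (exp (- (y \<bullet> y) / (2 * R\<^sup>2))) * F y \<partial>lebesgue_subspace S)"
    by (subst leb) (auto simp: r_def field_simps)
  finally show ?thesis .
qed

end

text \<open>Time is variance, so the generator is half the Laplacian along the image of
  \<open>T\<close>; this is the normalisation in which a drift \<open>v\<close> over time
  \<open>h\<close> costs \<open>h * (v \<bullet> v) / 2\<close>.\<close>

definition heat :: "('a::euclidean_space \<Rightarrow> 'c::euclidean_space) \<Rightarrow> real \<Rightarrow> ('c \<Rightarrow> real) \<Rightarrow> 'c \<Rightarrow> real" where
  "heat T t \<phi> x = (\<integral>z. \<phi> (x + sqrt t *\<^sub>R T z) \<partial>gauss)"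

context coisometry begin

lemma heat_measurable [measurable]:
  assumes [measurable]: "\<phi> \<in> borel_measurable borel"
  shows "heat T t \<phi> \<in> borel_measurable borel"
  unfolding heat_def by measurable

lemma heat_bounds:
  assumes [measurable]: "\<phi> \<in> borel_measurable borel" and "\<And>x. \<phi> x \<in> {lo..hi}"
  shows "heat T t \<phi> x \<in> {lo..hi}"
proof -
  have "\<bar>\<phi> y\<bar> \<le> \<bar>lo\<bar> + \<bar>hi\<bar>" for y
    using assms(2)[of y] by auto
  then have "integrable gauss (\<lambda>z. \<phi> (x + sqrt t *\<^sub>R T z))"
    by (intro gauss_integrable_bounded) auto
  then show ?thesis
    using gauss.integral_ge_const[of "\<lambda>z. \<phi> (x + sqrt t *\<^sub>R T z)" lo]
      gauss.integral_le_const[of "\<lambda>z. \<phi> (x + sqrt t *\<^sub>R T z)" hi] assms(2)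
    by (auto simp: heat_def)
qed

text \<open>The semigroup law: independent increments of variances \<open>s\<close> and
  \<open>t\<close> combine to one of variance \<open>s + t\<close>. The case
  \<open>s + t = 0\<close> is separate because \<open>gauss_conv_distr\<close> needs a positive
  scale.\<close>

lemma heat_heat:
  assumes [measurable]: "\<phi> \<in> borel_measurable borel" and C: "\<And>x. \<bar>\<phi> x\<bar> \<le> C"
    and "0 \<le> s" "0 \<le> t"
  shows "heat T s (heat T t \<phi>) x = heat T (s + t) \<phi> x"
proof (cases "s + t = 0")
  case True
  then have "s = 0" "t = 0" using assms by auto
  then show ?thesis by (simp add: heat_def)
next
  case False
  interpret P: pair_prob_space "gauss :: 'a measure" "gauss :: 'a measure" ..
  let ?F = "\<lambda>z. \<phi> (x + T z)"
  have "heat T s (heat T t \<phi>) x = (\<integral>z. (\<integral>z'. ?F (sqrt s *\<^sub>R z + sqrt t *\<^sub>R z') \<partial>gauss) \<partial>gauss)"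
    by (simp add: heat_def linear_add[OF linear] linear_scale[OF linear] add.assoc)
  also have "\<dots> = (\<integral>(z, z'). ?F (sqrt s *\<^sub>R z + sqrt t *\<^sub>R z') \<partial>(gauss \<Otimes>\<^sub>M gauss))"
    by (subst P.integral_fst'[symmetric], rule P.integrable_const_bound[where B=C]) (use C in \<open>auto simp: split_beta\<close>)
  also have "\<dots> = (\<integral>z. ?F z \<partial>distr (gauss \<Otimes>\<^sub>M gauss) borel (\<lambda>(z, z'). sqrt s *\<^sub>R z + sqrt t *\<^sub>R z'))"
    by (subst integral_distr) (auto simp: case_prod_unfold)
  also have "\<dots> = (\<integral>z. ?F z \<partial>distr gauss borel (\<lambda>z. sqrt (s + t) *\<^sub>R z))"
    using assms False by (subst gauss_conv_distr[where \<rho>="sqrt (s + t)"]) auto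
  also have "\<dots> = heat T (s + t) \<phi> x"
    by (subst integral_distr) (auto simp: heat_def linear_scale[OF linear])
  finally show ?thesis .
qed

end

section \<open>Elementary exponential estimates and Jensen's inequality\<close>

lemma norm_le_exp_square: "norm (z::'a::euclidean_space) \<le> exp ((z \<bullet> z) / 4)"
proof -
  have "0 \<le> (norm z / 2 - 1)\<^sup>2" by simp
  then have "norm z \<le> 1 + (z \<bullet> z) / 4"
    by (simp add: power2_diff power_divide dot_square_norm)
  then show ?thesis using exp_ge_add_one_self[of "(z \<bullet> z) / 4"] by linarith
qed

lemma exp_norm_le_exp_square: "exp (c * norm (z::'a::euclidean_space)) \<le> exp (c\<^sup>2) * exp ((z \<bullet> z) / 4)"
proof -
  have "0 \<le> (norm z / 2 - c)\<^sup>2" by simp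
  then have "c * norm z \<le> c\<^sup>2 + (z \<bullet> z) / 4"
    by (simp add: power2_diff power_divide dot_square_norm mult.commute)
  then show ?thesis by (simp add: exp_add[symmetric])
qed

lemma exp_bound_quadratic:
  fixes x :: real
  shows "\<bar>exp x - 1 - x\<bar> \<le> x\<^sup>2 * exp \<bar>x\<bar>"
proof -
  obtain t where "\<bar>t\<bar> \<le> \<bar>x\<bar>" "exp x = (\<Sum>m<2. x ^ m / fact m) + exp t / fact 2 * x ^ 2"
    using Maclaurin_exp_le[of x 2] by blast
  then have eq: "exp x - 1 - x = exp t / 2 * x\<^sup>2" and t: "exp t \<le> exp \<bar>x\<bar>"
    by (simp_all add: numeral_2_eq_2)
  have "\<bar>exp x - 1 - x\<bar> = exp t / 2 * x\<^sup>2" unfolding eq by simp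
  also have "\<dots> \<le> exp \<bar>x\<bar> * x\<^sup>2"
  proof (rule mult_right_mono)
    show "exp t / 2 \<le> exp \<bar>x\<bar>" using t exp_gt_zero[of t] by linarith
  qed simp
  finally show ?thesis by (simp add: mult.commute)
qed

lemma exp_lipschitz:
  fixes a b :: real
  assumes "a \<le> C" "b \<le> C"
  shows "\<bar>exp a - exp b\<bar> \<le> exp C * \<bar>a - b\<bar>"
proof -
  have *: "exp y - exp x \<le> exp C * (y - x)" if "x \<le> y" "y \<le> C" for x y :: real
  proof -
    have "exp y * (1 + (x - y)) \<le> exp y * exp (x - y)"
      by (intro mult_left_mono exp_ge_add_one_self) auto
    then have "exp y - exp x \<le> exp y * (y - x)"
      by (simp add: exp_add[symmetric] algebra_simps)
    also have "\<dots> \<le> exp C * (y - x)"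
      using that by (intro mult_right_mono) auto
    finally show ?thesis .
  qed
  show ?thesis
    using *[of a b] *[of b a] assms exp_le_cancel_iff[of a b] exp_le_cancel_iff[of b a]
    by (cases "a \<le> b") auto
qed

lemma power2_le_exp: "0 \<le> x \<Longrightarrow> (x::real)\<^sup>2 \<le> 2 * exp x"
  using exp_lower_Taylor_quadratic[of x] by simp

text \<open>Jensen's inequality, obtained by integrating the tangent line of \<open>exp\<close> at
  the mean of \<open>Y\<close>.\<close>

lemma gauss_jensen_exp:
  fixes Y :: "'a::euclidean_space \<Rightarrow> real"
  assumes "integrable gauss Y" "integrable gauss (\<lambda>z. exp (Y z))"
  shows "exp (\<integral>z. Y z \<partial>gauss) \<le> (\<integral>z. exp (Y z) \<partial>gauss)"
proof -
  define m where "m = (\<integral>z. Y z \<partial>gauss)"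
  have "(\<integral>z. exp m * (1 + Y z - m) \<partial>gauss) \<le> (\<integral>z. exp (Y z) \<partial>gauss)"
  proof (rule Bochner_Integration.integral_mono)
    fix z
    have "exp m * (1 + (Y z - m)) \<le> exp m * exp (Y z - m)"
      by (intro mult_left_mono exp_ge_add_one_self) auto
    then show "exp m * (1 + Y z - m) \<le> exp (Y z)"
      by (simp add: exp_add[symmetric] algebra_simps)
  qed (use assms in auto)
  moreover have "(\<integral>z. exp m * (1 + Y z - m) \<partial>gauss) = exp m"
    using assms by (simp add: m_def)
  ultimately show ?thesis by (simp add: m_def)
qed

context coisometry begin

lemma inner_le: "\<bar>u \<bullet> T z\<bar> \<le> norm u * norm z"
  using Cauchy_Schwarz_ineq2[of u "T z"] contraction[of z]
  by (meson mult_left_mono norm_ge_zero order_trans)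

lemma integrable_inner: "integrable gauss (\<lambda>z. u \<bullet> T z)"
proof (rule gauss_integrable_dominated[where C="norm u"])
  fix z
  show "\<bar>u \<bullet> T z\<bar> \<le> norm u * exp ((z \<bullet> z) / 4)"
    using inner_le[of u z] norm_le_exp_square[of z] by (meson mult_left_mono norm_ge_zero order_trans)
qed simp

lemma integral_inner: "(\<integral>z. u \<bullet> T z \<partial>gauss) = 0"
  using gauss_integral_inner[of "adjoint T u"] by (simp add: inner_adjoint)

lemma integrable_exp_inner: "integrable gauss (\<lambda>z. exp (u \<bullet> T z))"
proof (rule gauss_integrable_dominated)
  fix z
  show "\<bar>exp (u \<bullet> T z)\<bar> \<le> exp ((norm u)\<^sup>2) * exp ((z \<bullet> z) / 4)"
    using inner_le[of u z] exp_norm_le_exp_square[of "norm u" z]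
    by (smt (verit) exp_ge_zero exp_le_cancel_iff)
qed simp

text \<open>Translating the noise by \<open>- sqrt h *\<^sub>R u\<close> exactly offsets the
  displacement of the base point by \<open>h *\<^sub>R u\<close>; the price is the Cameron--Martin
  density.\<close>

lemma tilt:
  fixes F :: "'c \<Rightarrow> real"
  assumes [measurable]: "F \<in> borel_measurable borel" and "u \<in> S" "0 < h"
  shows "(\<integral>z. F (x + sqrt h *\<^sub>R T z) \<partial>gauss)
    = (\<integral>z. exp (- sqrt h * (u \<bullet> T z) - h * (u \<bullet> u) / 2) * F (x + h *\<^sub>R u + sqrt h *\<^sub>R T z) \<partial>gauss)"
proof -
  have "- sqrt h *\<^sub>R u \<in> S" using assms(2) by (rule subspace_scale[OF subspace])
  moreover have sqrt_sqrt: "sqrt h * (sqrt h * c) = h * c" for c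
    using assms(3) by (simp flip: mult.assoc)
  ultimately show ?thesis
    using shift[of F "- sqrt h *\<^sub>R u" "sqrt h" "x + h *\<^sub>R u"] assms by (simp add: sqrt_sqrt algebra_simps)
qed

lemma heat_exp_lower:
  assumes [measurable]: "\<psi> \<in> borel_measurable borel" and C: "\<And>x. \<bar>\<psi> x\<bar> \<le> C"
    and "v \<in> S" "0 < h"
  shows "heat T h \<psi> (y + h *\<^sub>R v) - h * (v \<bullet> v) / 2 \<le> ln (heat T h (\<lambda>x. exp (\<psi> x)) y)"
proof -
  \<comment> \<open>The full exponent after recentring at \<open>y + h *\<^sub>R v\<close>. Its
    linear term has mean zero, so Jensen leaves only the drift cost.\<close>
  define Y where "Y z = \<psi> (y + h *\<^sub>R v + sqrt h *\<^sub>R T z) - sqrt h * (v \<bullet> T z) - h * (v \<bullet> v) / 2" for z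
  have [measurable]: "Y \<in> borel_measurable borel" unfolding Y_def by measurable
  have int\<psi>: "integrable gauss (\<lambda>z. \<psi> (y + h *\<^sub>R v + sqrt h *\<^sub>R T z))"
    by (rule gauss_integrable_bounded[where C=C]) (use C in auto)
  have intY: "integrable gauss Y"
    unfolding Y_def using int\<psi> integrable_inner[of v] by auto
  have "heat T h (\<lambda>x. exp (\<psi> x)) y = (\<integral>z. exp (Y z) \<partial>gauss)"
    unfolding heat_def by (subst tilt[OF _ assms(3,4)]) (simp_all add: Y_def exp_add[symmetric] algebra_simps)
  moreover have "integrable gauss (\<lambda>z. exp (Y z))"
  proof (rule Bochner_Integration.integrable_bound)
    show "integrable gauss (\<lambda>z. exp C * exp ((- sqrt h *\<^sub>R v) \<bullet> T z))"
      using integrable_exp_inner[of "- sqrt h *\<^sub>R v"] by simp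
    have "Y z \<le> C + (- sqrt h *\<^sub>R v) \<bullet> T z" for z
      using C[of "y + h *\<^sub>R v + sqrt h *\<^sub>R T z"] assms(4) by (simp add: Y_def add_increasing2)
        (smt (verit) divide_nonneg_nonneg inner_ge_zero mult_nonneg_nonneg)
    then show "AE z in gauss. norm (exp (Y z)) \<le> norm (exp C * exp ((- sqrt h *\<^sub>R v) \<bullet> T z))"
      by (simp add: exp_add[symmetric])
  qed simp
  moreover have "(\<integral>z. Y z \<partial>gauss) = heat T h \<psi> (y + h *\<^sub>R v) - h * (v \<bullet> v) / 2"
    unfolding Y_def using int\<psi> integrable_inner[of v] by (simp add: heat_def integral_inner)
  ultimately show ?thesis
    using gauss_jensen_exp[OF intY] by (metis exp_gt_zero ln_ge_iff order_less_le_trans)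
qed

text \<open>With the drift \<open>u\<close> equal to the gradient of \<open>\<phi>\<close> at \<open>x\<close>, the Cameron--Martin exponent cancels
  the linear part of \<open>\<phi>\<close>, so Jensen's inequality above loses only a quadratic error.\<close>
lemma heat_exp_upper:
  assumes [measurable]: "\<phi> \<in> borel_measurable borel" and C: "\<And>x. \<bar>\<phi> x\<bar> \<le> C"
    and "u \<in> S" "norm u \<le> K" and h: "0 < h" "h \<le> 1" "32 * K * h \<le> 1"
    and quad: "\<And>w. w \<in> S \<Longrightarrow> \<bar>\<phi> (x + w) - \<phi> x - u \<bullet> w\<bar> \<le> K * (w \<bullet> w)"
  shows "ln (heat T h (\<lambda>x. exp (\<phi> x)) x) \<le> heat T h \<phi> (x + h *\<^sub>R u) - h * (u \<bullet> u) / 2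
    + 2048 * K\<^sup>2 * exp (K\<^sup>2 / 8) * (\<integral>z. exp ((z \<bullet> z) / 4) \<partial>(gauss :: 'a measure)) * h\<^sup>2"
proof -
  have K: "0 \<le> K" using assms(4) norm_ge_zero[of u] by linarith
  \<comment> \<open>The error of the linear approximation at the random displacement, which has size
    about \<open>sqrt h\<close>; hence \<open>R\<close> is of order \<open>h\<close> and its square
    of order \<open>h\<^sup>2\<close>.\<close>
  define R where "R z = \<phi> (x + h *\<^sub>R u + sqrt h *\<^sub>R T z) - \<phi> x - u \<bullet> (h *\<^sub>R u + sqrt h *\<^sub>R T z)" for z
  \<comment> \<open>Writing \<open>2 * K * h * q\<close> through \<open>q / 16\<close> gives
    \<open>1024\<close> after squaring, \<open>power2_le_exp\<close> doubles it, and
    \<open>exp (K\<^sup>2 / 8)\<close> comes from the summand \<open>K\<^sup>2\<close> of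
    \<open>q = z \<bullet> z + K\<^sup>2\<close>.\<close>
  define D where "D = 2048 * K\<^sup>2 * exp (K\<^sup>2 / 8) * h\<^sup>2"
  have [measurable]: "R \<in> borel_measurable borel" unfolding R_def by measurable
  have R: "\<bar>R z\<bar> \<le> 2 * K * h * (z \<bullet> z + K\<^sup>2)" for z
  proof -
    let ?w = "h *\<^sub>R u + sqrt h *\<^sub>R T z"
    have "?w \<in> S" using subspace range assms(3) by (auto intro: subspace_add subspace_scale)
    then have *: "\<bar>R z\<bar> \<le> K * (?w \<bullet> ?w)"
      using quad[of ?w] by (simp add: R_def add.assoc)
    have "?w \<bullet> ?w \<le> 2 * ((h *\<^sub>R u) \<bullet> (h *\<^sub>R u) + (sqrt h *\<^sub>R T z) \<bullet> (sqrt h *\<^sub>R T z))"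
      using inner_ge_zero[of "h *\<^sub>R u - sqrt h *\<^sub>R T z"]
      by (simp add: inner_add_left inner_add_right inner_diff_left inner_diff_right inner_commute algebra_simps)
    moreover have "(h *\<^sub>R u) \<bullet> (h *\<^sub>R u) \<le> h * K\<^sup>2"
    proof -
      have "u \<bullet> u \<le> K\<^sup>2" using assms(4) by (simp add: dot_square_norm power_mono)
      then have "(h * h) * (u \<bullet> u) \<le> h * K\<^sup>2"
        using h by (intro mult_mono mult_left_le) auto
      then show ?thesis by (simp add: mult.assoc)
    qed
    moreover have "(sqrt h *\<^sub>R T z) \<bullet> (sqrt h *\<^sub>R T z) \<le> h * (z \<bullet> z)"
    proof -
      have "T z \<bullet> T z \<le> z \<bullet> z" using contraction[of z] by (simp add: dot_square_norm power_mono)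
      then show ?thesis using h by (simp add: mult_left_mono flip: mult.assoc)
    qed
    ultimately have "?w \<bullet> ?w \<le> 2 * h * (z \<bullet> z + K\<^sup>2)" by (simp add: algebra_simps)
    then have "K * (?w \<bullet> ?w) \<le> K * (2 * h * (z \<bullet> z + K\<^sup>2))"
      using K by (rule mult_left_mono)
    with * show ?thesis by (simp add: mult_ac)
  qed
  have R2: "(R z)\<^sup>2 * exp \<bar>R z\<bar> \<le> D * exp ((z \<bullet> z) / 4)" for z
  proof -
    define q where "q = z \<bullet> z + K\<^sup>2"
    have q: "0 \<le> q" by (simp add: q_def)
    \<comment> \<open>Here the step size restriction enters: both exponential factors are then at
      most \<open>exp (q / 16)\<close>, and their product stays below a multiple of the integrable
      \<open>exp ((z \<bullet> z) / 4)\<close>.\<close>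
    have "2 * K * h * q \<le> q / 16"
      using mult_right_mono[OF h(3) q] by simp
    then have Rq: "\<bar>R z\<bar> \<le> q / 16" using R[of z] by (simp add: q_def)
    have "(R z)\<^sup>2 \<le> (2 * K * h * q)\<^sup>2"
      using R[of z] by (intro power2_le_iff_abs_le[THEN iffD2]) (auto simp: q_def K h less_imp_le)
    also have "\<dots> = 1024 * K\<^sup>2 * h\<^sup>2 * (q / 16)\<^sup>2"
      by (simp add: power2_eq_square)
    also have "\<dots> \<le> 1024 * K\<^sup>2 * h\<^sup>2 * (2 * exp (q / 16))"
      using q by (intro mult_left_mono power2_le_exp) auto
    finally have "(R z)\<^sup>2 * exp \<bar>R z\<bar> \<le> 1024 * K\<^sup>2 * h\<^sup>2 * (2 * exp (q / 16)) * exp (q / 16)"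
      using Rq by (intro mult_mono) auto
    also have "\<dots> = 2048 * K\<^sup>2 * h\<^sup>2 * exp (q / 8)"
      by (simp add: mult.assoc exp_add[symmetric])
    also have "\<dots> \<le> 2048 * K\<^sup>2 * h\<^sup>2 * (exp (K\<^sup>2 / 8) * exp ((z \<bullet> z) / 4))"
      unfolding exp_add[symmetric] q_def by (intro mult_left_mono) (auto simp: add_divide_distrib)
    finally show ?thesis by (simp add: D_def mult_ac)
  qed
  have int\<phi>: "integrable gauss (\<lambda>z. \<phi> (x + h *\<^sub>R u + sqrt h *\<^sub>R T z))"
    by (rule gauss_integrable_bounded[where C=C]) (use C in auto)
  have intR: "integrable gauss R"
    unfolding R_def using int\<phi> integrable_inner[of u] by (auto simp: inner_add_right)
  have expR: "exp (R z) \<le> 1 + R z + D * exp ((z \<bullet> z) / 4)" for z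
    using exp_bound_quadratic[of "R z"] R2[of z] by linarith
  have int_up: "integrable gauss (\<lambda>z. 1 + R z + D * exp ((z \<bullet> z) / 4))"
    using intR gauss_integrable_exp_square[where 'a='a] by auto
  have int_exp: "integrable gauss (\<lambda>z. exp (R z))"
    by (rule Bochner_Integration.integrable_bound[OF int_up]) (auto intro!: AE_I2 order_trans[OF expR])
  \<comment> \<open>After tilting by \<open>u\<close> the exponent is
    \<open>\<phi> x + h * (u \<bullet> u) / 2 + R z\<close>: the linear noise cancels, and only
    \<open>R\<close> is random.\<close>
  have "heat T h (\<lambda>x. exp (\<phi> x)) x = (\<integral>z. exp (\<phi> x + h * (u \<bullet> u) / 2) * exp (R z) \<partial>gauss)"
    unfolding heat_def using h
    by (subst tilt[OF _ assms(3) h(1)]) (simp_all add: R_def exp_add[symmetric] inner_add_right algebra_simps)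
  also have "\<dots> = exp (\<phi> x + h * (u \<bullet> u) / 2) * (\<integral>z. exp (R z) \<partial>gauss)" by simp
  finally have heat: "heat T h (\<lambda>x. exp (\<phi> x)) x = exp (\<phi> x + h * (u \<bullet> u) / 2) * (\<integral>z. exp (R z) \<partial>gauss)" .
  have pos: "0 < (\<integral>z. exp (R z) \<partial>gauss)"
    using gauss_jensen_exp[OF intR int_exp] by (rule order_less_le_trans[OF exp_gt_zero])
  have "ln (heat T h (\<lambda>x. exp (\<phi> x)) x) = \<phi> x + h * (u \<bullet> u) / 2 + ln (\<integral>z. exp (R z) \<partial>gauss)"
    using pos by (simp add: heat ln_mult)
  also have "ln (\<integral>z. exp (R z) \<partial>gauss) \<le> (\<integral>z. exp (R z) \<partial>gauss) - 1"
    using pos by (rule ln_le_minus_one)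
  also have "(\<integral>z. exp (R z) \<partial>gauss) \<le> (\<integral>z. 1 + R z + D * exp ((z \<bullet> z) / 4) \<partial>gauss)"
    by (rule Bochner_Integration.integral_mono[OF int_exp int_up expR])
  also have "\<dots> = 1 + (\<integral>z. R z \<partial>gauss) + D * (\<integral>z. exp ((z \<bullet> z) / 4) \<partial>(gauss :: 'a measure))"
    using intR gauss_integrable_exp_square[where 'a='a] by simp
  \<comment> \<open>The mean of \<open>R\<close> restores the average of \<open>\<phi>\<close> at
    the drifted point and turns the energy term \<open>h * (u \<bullet> u) / 2\<close> into its
    negative.\<close>
  also have "(\<integral>z. R z \<partial>gauss) = heat T h \<phi> (x + h *\<^sub>R u) - \<phi> x - h * (u \<bullet> u)"
    unfolding R_def using int\<phi> integrable_inner[of u]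
    by (simp add: inner_add_right heat_def integral_inner)
  finally show ?thesis by (simp add: D_def mult_ac)
qed

end

section \<open>Functions with Lipschitz gradient\<close>

text \<open>A derivative-free way of saying that \<open>\<phi>\<close> is Lipschitz with Lipschitz gradient along \<open>S\<close>.
  In this form the property is stable under averaging over translations.\<close>
definition C11 :: "'c::euclidean_space set \<Rightarrow> real \<Rightarrow> ('c \<Rightarrow> real) \<Rightarrow> bool" where
  "C11 S K \<phi> \<longleftrightarrow> (\<exists>v\<in>borel_measurable borel. \<forall>x. norm (v x) \<le> K \<and>
     (\<forall>w\<in>S. \<bar>\<phi> (x + w) - \<phi> x\<bar> \<le> K * norm w \<and> \<bar>\<phi> (x + w) - \<phi> x - v x \<bullet> w\<bar> \<le> K * (w \<bullet> w)))"

text \<open>The chain rule with gradient \<open>\<theta>' (\<phi> x) *\<^sub>R v x\<close>. In the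
  constant, \<open>M * K\<^sup>2\<close> is the second-order error of \<open>\<theta>\<close> along
  the increment of \<open>\<phi>\<close>, and \<open>M * K\<close> is the error of
  \<open>\<phi>\<close> multiplied by the slope of \<open>\<theta>\<close>.\<close>

lemma C11_compose:
  assumes "C11 S K \<phi>" and [measurable]: "\<phi> \<in> borel_measurable borel" "\<theta>' \<in> borel_measurable borel"
    and range: "\<And>x. \<phi> x \<in> {lo..hi}"
    and \<theta>': "\<And>a. a \<in> {lo..hi} \<Longrightarrow> \<bar>\<theta>' a\<bar> \<le> M"
    and \<theta>: "\<And>a b. a \<in> {lo..hi} \<Longrightarrow> b \<in> {lo..hi} \<Longrightarrow> \<bar>\<theta> b - \<theta> a\<bar> \<le> M * \<bar>b - a\<bar>"
      "\<And>a b. a \<in> {lo..hi} \<Longrightarrow> b \<in> {lo..hi} \<Longrightarrow> \<bar>\<theta> b - \<theta> a - \<theta>' a * (b - a)\<bar> \<le> M * (b - a)\<^sup>2"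
  shows "C11 S (M * K\<^sup>2 + M * K) (\<lambda>x. \<theta> (\<phi> x))"
proof -
  obtain v where [measurable]: "v \<in> borel_measurable borel" and v: "\<And>x. norm (v x) \<le> K"
    and lip: "\<And>x w. w \<in> S \<Longrightarrow> \<bar>\<phi> (x + w) - \<phi> x\<bar> \<le> K * norm w"
    and quad: "\<And>x w. w \<in> S \<Longrightarrow> \<bar>\<phi> (x + w) - \<phi> x - v x \<bullet> w\<bar> \<le> K * (w \<bullet> w)"
    using assms(1) unfolding C11_def by blast
  have K: "0 \<le> K" using v[of 0] norm_ge_zero order_trans by blast
  have M: "0 \<le> M" using \<theta>'[OF range[of 0]] by linarith
  have le: "M * K * c \<le> (M * K\<^sup>2 + M * K) * c" if "0 \<le> c" for c
    using K M that by (intro mult_right_mono) auto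
  show ?thesis
    unfolding C11_def
  proof (intro bexI[of _ "\<lambda>x. \<theta>' (\<phi> x) *\<^sub>R v x"] allI conjI ballI)
    fix x
    have "norm (\<theta>' (\<phi> x) *\<^sub>R v x) \<le> M * K"
      using \<theta>'[OF range] v K M by (auto intro!: mult_mono)
    then show "norm (\<theta>' (\<phi> x) *\<^sub>R v x) \<le> M * K\<^sup>2 + M * K"
      using le[of 1] by simp
  next
    fix x w assume w: "w \<in> S"
    have "\<bar>\<theta> (\<phi> (x + w)) - \<theta> (\<phi> x)\<bar> \<le> M * \<bar>\<phi> (x + w) - \<phi> x\<bar>"
      by (rule \<theta>(1)[OF range range])
    also have "\<dots> \<le> M * (K * norm w)"
      using lip[OF w] M by (rule mult_left_mono)
    also have "\<dots> \<le> (M * K\<^sup>2 + M * K) * norm w"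
      using le[of "norm w"] by (simp add: mult.assoc)
    finally show "\<bar>\<theta> (\<phi> (x + w)) - \<theta> (\<phi> x)\<bar> \<le> (M * K\<^sup>2 + M * K) * norm w" .
    let ?d = "\<phi> (x + w) - \<phi> x"
    have "\<bar>\<theta> (\<phi> (x + w)) - \<theta> (\<phi> x) - (\<theta>' (\<phi> x) *\<^sub>R v x) \<bullet> w\<bar>
      = \<bar>(\<theta> (\<phi> (x + w)) - \<theta> (\<phi> x) - \<theta>' (\<phi> x) * ?d) + \<theta>' (\<phi> x) * (?d - v x \<bullet> w)\<bar>"
      by (simp add: algebra_simps)
    also have "\<dots> \<le> \<bar>\<theta> (\<phi> (x + w)) - \<theta> (\<phi> x) - \<theta>' (\<phi> x) * ?d\<bar> + \<bar>\<theta>' (\<phi> x)\<bar> * \<bar>?d - v x \<bullet> w\<bar>"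
      by (metis abs_mult abs_triangle_ineq)
    also have "\<dots> \<le> M * ?d\<^sup>2 + M * (K * (w \<bullet> w))"
      by (intro add_mono mult_mono \<theta>(2) \<theta>' range quad w M) auto
    also have "\<dots> \<le> M * (K\<^sup>2 * (w \<bullet> w)) + M * (K * (w \<bullet> w))"
    proof -
      have "?d\<^sup>2 \<le> (K * norm w)\<^sup>2"
        using lip[OF w, of x] K by (intro power2_le_iff_abs_le[THEN iffD2]) auto
      then have "?d\<^sup>2 \<le> K\<^sup>2 * (w \<bullet> w)"
        by (simp add: power_mult_distrib dot_square_norm)
      then show ?thesis using M by (simp add: mult_left_mono)
    qed
    finally show "\<bar>\<theta> (\<phi> (x + w)) - \<theta> (\<phi> x) - (\<theta>' (\<phi> x) *\<^sub>R v x) \<bullet> w\<bar> \<le> (M * K\<^sup>2 + M * K) * (w \<bullet> w)"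
      by (simp add: algebra_simps)
  qed measurable
qed

lemma C11_exp:
  assumes "C11 S K \<phi>" "\<phi> \<in> borel_measurable borel" "\<And>x. \<phi> x \<in> {lo..hi}"
  shows "C11 S (exp hi * K\<^sup>2 + exp hi * K) (\<lambda>x. exp (\<phi> x))"
proof (rule C11_compose[OF assms(1,2) _ assms(3)])
  have mono: "exp a * (b - a) \<le> exp b - exp a" for a b :: real
  proof -
    have "exp a * (1 + (b - a)) \<le> exp a * exp (b - a)"
      by (intro mult_left_mono exp_ge_add_one_self) auto
    then show ?thesis by (simp add: exp_add[symmetric] algebra_simps)
  qed
  fix a b :: real assume a: "a \<in> {lo..hi}"
  then show "\<bar>exp a\<bar> \<le> exp hi" by simp
  assume b: "b \<in> {lo..hi}"
  show lip: "\<bar>exp b - exp a\<bar> \<le> exp hi * \<bar>b - a\<bar>"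
    using a b by (intro exp_lipschitz) auto
  \<comment> \<open>Tangent lines at both end points: the one at \<open>a\<close> makes the
    remainder nonnegative, the one at \<open>b\<close> bounds it by a product of two
    increments.\<close>
  have "exp b - exp a - exp a * (b - a) \<le> (exp b - exp a) * (b - a)"
    using mono[of b a] by (simp add: algebra_simps)
  also have "\<dots> \<le> \<bar>exp b - exp a\<bar> * \<bar>b - a\<bar>"
    by (metis abs_ge_self abs_mult)
  also have "\<dots> \<le> exp hi * \<bar>b - a\<bar> * \<bar>b - a\<bar>"
    using lip by (rule mult_right_mono) simp
  finally show "\<bar>exp b - exp a - exp a * (b - a)\<bar> \<le> exp hi * (b - a)\<^sup>2"
    using mono[of a b] by (simp add: power2_eq_square mult.assoc)
qed measurable

text \<open>The positive lower bound controls both terms of \<open>M\<close>: \<open>1 / lo\<close>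
  bounds the slope, and \<open>1 / lo\<^sup>2\<close> bounds the second-order error, which concavity
  places between \<open>- (b - a)\<^sup>2 / (a * b)\<close> and \<open>0\<close>.\<close>

lemma C11_ln:
  assumes "C11 S K \<phi>" "\<phi> \<in> borel_measurable borel" "\<And>x. \<phi> x \<in> {lo..hi}" and lo: "0 < lo"
  defines "M \<equiv> 1 / lo + 1 / lo\<^sup>2"
  shows "C11 S (M * K\<^sup>2 + M * K) (\<lambda>x. ln (\<phi> x))"
proof (rule C11_compose[OF assms(1,2) _ assms(3)])
  have up: "ln b - ln a \<le> (b - a) / a" if "0 < a" "0 < b" for a b :: real
    using ln_le_minus_one[of "b / a"] that by (simp add: ln_div diff_divide_distrib)
  fix a b :: real assume "a \<in> {lo..hi}"
  then have a: "lo \<le> a" "0 < a" using lo by auto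
  then have a1: "1 / a \<le> 1 / lo" using lo by (simp add: frac_le)
  then show "\<bar>1 / a\<bar> \<le> M"
    using a by (simp add: M_def add_increasing2)
  assume "b \<in> {lo..hi}"
  then have b: "lo \<le> b" "0 < b" using lo by auto
  then have b1: "1 / b \<le> 1 / lo" using lo by (simp add: frac_le)
  have lip: "\<bar>ln b - ln a\<bar> \<le> 1 / lo * \<bar>b - a\<bar>"
    if "lo \<le> a" "lo \<le> b" for a b :: real
  proof -
    have pos: "0 < a" "0 < b" "1 / a \<le> 1 / lo" "1 / b \<le> 1 / lo"
      using that lo by (auto simp: frac_le)
    have "(b - a) / a \<le> 1 / lo * \<bar>b - a\<bar>" "(a - b) / b \<le> 1 / lo * \<bar>b - a\<bar>"
      using mult_mono[OF pos(3) abs_ge_self[of "b - a"]] mult_mono[OF pos(4) abs_ge_self[of "a - b"]] pos lo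
        mult_mono[OF pos(3) order_refl[of "\<bar>b - a\<bar>"]] mult_mono[OF pos(4) order_refl[of "\<bar>b - a\<bar>"]]
        divide_right_mono[OF abs_ge_self[of "b - a"], of a] divide_right_mono[OF abs_ge_self[of "a - b"], of b]
      by (auto simp: abs_minus_commute)
    then show ?thesis using up[OF pos(1,2)] up[OF pos(2,1)] by linarith
  qed
  have "\<bar>ln b - ln a\<bar> \<le> 1 / lo * \<bar>b - a\<bar>" by (rule lip[OF a(1) b(1)])
  also have "\<dots> \<le> M * \<bar>b - a\<bar>"
    by (rule mult_right_mono) (simp_all add: M_def)
  finally show "\<bar>ln b - ln a\<bar> \<le> M * \<bar>b - a\<bar>" .
  have "ln b - ln a - 1 / a * (b - a) \<le> 0"
    using up[OF a(2) b(2)] by simp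
  moreover have "- ((b - a)\<^sup>2 / (a * b)) \<le> ln b - ln a - 1 / a * (b - a)"
  proof -
    have "(b - a) / b - 1 / a * (b - a) = - ((b - a)\<^sup>2 / (a * b))"
      using a(2) b(2) by (simp add: power2_eq_square field_simps)
    moreover have "(a - b) / b = - ((b - a) / b)"
      by (simp add: diff_divide_distrib)
    ultimately show ?thesis using up[OF b(2) a(2)] by linarith
  qed
  moreover have "(b - a)\<^sup>2 / (a * b) \<le> M * (b - a)\<^sup>2"
  proof -
    have "1 / (a * b) \<le> 1 / (lo * lo)"
      using a b lo by (intro frac_le mult_mono) auto
    also have "\<dots> \<le> M"
      using lo by (simp add: M_def power2_eq_square)
    finally show ?thesis
      using mult_right_mono[of "1 / (a * b)" M "(b - a)\<^sup>2"] by simp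
  qed
  ultimately show "\<bar>ln b - ln a - 1 / a * (b - a)\<bar> \<le> M * (b - a)\<^sup>2" by linarith
qed measurable

context coisometry begin

text \<open>The three bounds are uniform in the base point, so they pass to averages over
  translates, with the averaged gradient and the same \<open>K\<close> for every \<open>t\<close>.
  The iteration relies on this uniformity in time.\<close>

lemma C11_heat:
  assumes [measurable]: "\<phi> \<in> borel_measurable borel" and C: "\<And>x. \<bar>\<phi> x\<bar> \<le> C"
    and "C11 S K \<phi>"
  shows "C11 S K (heat T t \<phi>)"
proof -
  obtain v where v_meas [measurable]: "v \<in> borel_measurable borel" and v: "\<And>x. norm (v x) \<le> K"
    and lip: "\<And>x w. w \<in> S \<Longrightarrow> \<bar>\<phi> (x + w) - \<phi> x\<bar> \<le> K * norm w"
    and quad: "\<And>x w. w \<in> S \<Longrightarrow> \<bar>\<phi> (x + w) - \<phi> x - v x \<bullet> w\<bar> \<le> K * (w \<bullet> w)"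
    using assms(3) unfolding C11_def by blast
  have int\<phi>: "integrable gauss (\<lambda>z. \<phi> (x + sqrt t *\<^sub>R T z))" for x
    by (rule gauss_integrable_bounded[where C=C]) (use C in auto)
  have intv: "integrable gauss (\<lambda>z. v (x + sqrt t *\<^sub>R T z))" for x
    by (rule gauss.integrable_const_bound[where B=K]) (use v in auto)
  have bound: "\<bar>\<integral>z. f z \<partial>gauss\<bar> \<le> c"
    if "integrable gauss f" "\<And>z. \<bar>f z\<bar> \<le> c" for c and f :: "'a \<Rightarrow> real"
  proof -
    have "\<bar>\<integral>z. f z \<partial>gauss\<bar> \<le> (\<integral>z. \<bar>f z\<bar> \<partial>gauss)"
      by (rule integral_abs_bound)
    also have "\<dots> \<le> c"
      using that by (intro gauss.integral_le_const) auto
    finally show ?thesis .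
  qed
  show ?thesis
    unfolding C11_def
  proof (intro bexI[of _ "\<lambda>x. \<integral>z. v (x + sqrt t *\<^sub>R T z) \<partial>gauss"] allI conjI ballI)
    fix x
    have "norm (\<integral>z. v (x + sqrt t *\<^sub>R T z) \<partial>gauss) \<le> (\<integral>z. norm (v (x + sqrt t *\<^sub>R T z)) \<partial>gauss)"
      by (rule integral_norm_bound)
    also have "\<dots> \<le> K"
      using intv v by (intro gauss.integral_le_const) auto
    finally show "norm (\<integral>z. v (x + sqrt t *\<^sub>R T z) \<partial>gauss) \<le> K" .
  next
    fix x w assume w: "w \<in> S"
    have comm: "x + w + y = x + y + w" for y by simp
    have "heat T t \<phi> (x + w) - heat T t \<phi> x
        = (\<integral>z. \<phi> (x + sqrt t *\<^sub>R T z + w) - \<phi> (x + sqrt t *\<^sub>R T z) \<partial>gauss)"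
      unfolding heat_def using int\<phi>[of x] int\<phi>[of "x + w"] by (simp add: comm)
    also have "\<bar>\<dots>\<bar> \<le> K * norm w"
      by (rule bound) (use int\<phi>[of x] int\<phi>[of "x + w"] lip[OF w] in \<open>auto simp: comm\<close>)
    finally show "\<bar>heat T t \<phi> (x + w) - heat T t \<phi> x\<bar> \<le> K * norm w" .
    have "heat T t \<phi> (x + w) - heat T t \<phi> x - (\<integral>z. v (x + sqrt t *\<^sub>R T z) \<partial>gauss) \<bullet> w
        = (\<integral>z. \<phi> (x + sqrt t *\<^sub>R T z + w) - \<phi> (x + sqrt t *\<^sub>R T z) - v (x + sqrt t *\<^sub>R T z) \<bullet> w \<partial>gauss)"
      unfolding heat_def using int\<phi>[of x] int\<phi>[of "x + w"] intv[of x] by (simp add: comm)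
    also have "\<bar>\<dots>\<bar> \<le> K * (w \<bullet> w)"
      by (rule bound) (use int\<phi>[of x] int\<phi>[of "x + w"] intv[of x] quad[OF w] in \<open>auto simp: comm\<close>)
    finally show "\<bar>heat T t \<phi> (x + w) - heat T t \<phi> x - (\<integral>z. v (x + sqrt t *\<^sub>R T z) \<partial>gauss) \<bullet> w\<bar>
      \<le> K * (w \<bullet> w)" .
  qed measurable
qed

end

lemma C11_mono:
  assumes "C11 S K \<phi>" "K \<le> K'"
  shows "C11 S K' \<phi>"
proof -
  have "K * c \<le> K' * c" if "0 \<le> c" for c
    using assms(2) that by (rule mult_right_mono)
  then show ?thesis
    using assms unfolding C11_def by (meson inner_ge_zero norm_ge_zero order_trans)
qed

context coisometry begin

text \<open>Translating a Gaussian average is the same as changing its density, so the derivative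
  falls on the smooth Cameron--Martin density and \<open>\<phi>\<close> need only be bounded and
  measurable.\<close>

lemma C11_heat_smoothing:
  assumes [measurable]: "\<phi> \<in> borel_measurable borel" and B: "\<And>x. \<bar>\<phi> x\<bar> \<le> B" and \<tau>: "0 < \<tau>"
  shows "\<exists>K. C11 S K (heat T \<tau> \<phi>)"
proof -
  have B0: "0 \<le> B" using B[of 0] by linarith
  define E where "E = (\<integral>z. exp ((z \<bullet> z) / 4) \<partial>(gauss :: 'a measure))"
  \<comment> \<open>The gradient: the derivative at zero of the Cameron--Martin density in the
    shift, integrated against \<open>\<phi>\<close>.\<close>
  define v where "v x = (1 / sqrt \<tau>) *\<^sub>R (\<integral>z. \<phi> (x + sqrt \<tau> *\<^sub>R T z) *\<^sub>R T z \<partial>gauss)" for x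
  \<comment> \<open>In the bound for \<open>Y\<close> below, \<open>2\<close> comes from
    \<open>power2_le_exp\<close>, \<open>exp 6\<close> is \<open>exp 2 * exp (2\<^sup>2)\<close>
    with the second factor from \<open>exp_norm_le_exp_square\<close>, and \<open>1 / 2\<close>
    accounts for the term \<open>u \<bullet> u / 2\<close> of the density.\<close>
  define D where "D = 2 * exp 6 + 1 / (2::real)"
  define K where "K = B * (D + 2) * E * (1 / sqrt \<tau> + 1 / \<tau>)"
  have int_exp: "integrable (gauss :: 'a measure) (\<lambda>z. exp ((z \<bullet> z) / 4))"
    by (rule gauss_integrable_exp_square)
  have E1: "1 \<le> E"
    unfolding E_def by (intro gauss.integral_ge_const int_exp) simp
  have intTz: "integrable gauss (\<lambda>z. \<phi> (x + sqrt \<tau> *\<^sub>R T z) *\<^sub>R T z)" for x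
  proof (rule Bochner_Integration.integrable_bound)
    show "integrable gauss (\<lambda>z::'a. B * exp ((z \<bullet> z) / 4))" using int_exp by simp
    have "norm (\<phi> (x + sqrt \<tau> *\<^sub>R T z) *\<^sub>R T z) \<le> B * exp ((z \<bullet> z) / 4)" for z
      using B contraction[of z] norm_le_exp_square[of z] B0
      by (auto intro!: mult_mono order_trans[OF contraction])
    then show "AE z in gauss. norm (\<phi> (x + sqrt \<tau> *\<^sub>R T z) *\<^sub>R T z) \<le> norm (B * exp ((z \<bullet> z) / 4))"
      using B0 by (auto simp: abs_mult)
  qed simp
  have v_inner: "v x \<bullet> w = (\<integral>z. ((1 / sqrt \<tau>) *\<^sub>R w \<bullet> T z) * \<phi> (x + sqrt \<tau> *\<^sub>R T z) \<partial>gauss)" for x w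
  proof -
    have "v x \<bullet> w = 1 / sqrt \<tau> * (\<integral>z. (\<phi> (x + sqrt \<tau> *\<^sub>R T z) *\<^sub>R T z) \<bullet> w \<partial>gauss)"
      unfolding v_def by (subst integral_inner_left) (simp_all add: intTz)
    also have "\<dots> = (\<integral>z. 1 / sqrt \<tau> * ((\<phi> (x + sqrt \<tau> *\<^sub>R T z) *\<^sub>R T z) \<bullet> w) \<partial>gauss)"
      by simp
    finally show ?thesis by (simp add: inner_commute mult_ac)
  qed
  have nv: "norm (v x) \<le> B * E * (1 / sqrt \<tau>)" for x
  proof -
    have "norm (\<integral>z. \<phi> (x + sqrt \<tau> *\<^sub>R T z) *\<^sub>R T z \<partial>gauss)
        \<le> (\<integral>z. norm (\<phi> (x + sqrt \<tau> *\<^sub>R T z) *\<^sub>R T z) \<partial>gauss)"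
      by (rule integral_norm_bound)
    also have "\<dots> \<le> (\<integral>z. B * exp ((z \<bullet> z) / 4) \<partial>(gauss :: 'a measure))"
      by (intro Bochner_Integration.integral_mono integrable_norm intTz)
         (use B B0 int_exp in \<open>auto intro!: mult_mono order_trans[OF contraction] norm_le_exp_square\<close>)
    finally show ?thesis
      using \<tau> by (simp add: v_def E_def divide_right_mono)
  qed
  have quad: "\<bar>heat T \<tau> \<phi> (x + w) - heat T \<tau> \<phi> x - v x \<bullet> w\<bar> \<le> B * D * E * (w \<bullet> w / \<tau>)"
    if w: "w \<in> S" "w \<bullet> w \<le> \<tau>" for x w
  proof -
    define u where "u = (1 / sqrt \<tau>) *\<^sub>R w"
    have u: "u \<in> S" "sqrt \<tau> *\<^sub>R u = w" "u \<bullet> u = w \<bullet> w / \<tau>" "u \<bullet> u \<le> 1"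
      using w \<tau> by (auto simp: u_def subspace_scale[OF subspace] power2_eq_square[symmetric])
    have nu: "norm u \<le> 1" using u(4) by (simp add: norm_eq_sqrt_inner)
    \<comment> \<open>The density minus its first-order expansion in \<open>u\<close>, hence
      quadratic in \<open>u\<close> up to an integrable factor.\<close>
    define Y where "Y z = exp (u \<bullet> T z - u \<bullet> u / 2) - 1 - u \<bullet> T z" for z
    have Y: "\<bar>Y z\<bar> \<le> (u \<bullet> u) * (D * exp ((z \<bullet> z) / 4))" for z
    proof -
      define t where "t = u \<bullet> T z - u \<bullet> u / 2"
      have uu: "u \<bullet> u = norm u * norm u" by (simp add: dot_square_norm power2_eq_square)
      have t: "\<bar>t\<bar> \<le> norm u * (norm z + 1)"
      proof -
        have "norm u * norm u \<le> norm u"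
          using mult_left_mono[OF nu norm_ge_zero[of u]] by simp
        then have "u \<bullet> u / 2 \<le> norm u * 1"
          unfolding uu using norm_ge_zero[of u] by linarith
        then show ?thesis
          using inner_le[of u z] inner_ge_zero[of u] unfolding t_def distrib_left by linarith
      qed
      then have t': "\<bar>t\<bar> \<le> norm z + 1"
        using mult_right_mono[OF nu, of "norm z + 1"] by simp
      have "\<bar>exp t - 1 - t\<bar> \<le> t\<^sup>2 * exp \<bar>t\<bar>" by (rule exp_bound_quadratic)
      also have "\<dots> \<le> (norm u * (norm z + 1))\<^sup>2 * exp (norm z + 1)"
        using t t' by (intro mult_mono power2_le_iff_abs_le[THEN iffD2]) auto
      also have "\<dots> = (u \<bullet> u) * ((norm z + 1)\<^sup>2 * exp (norm z + 1))"
        by (simp add: uu power2_eq_square)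
      also have "(norm z + 1)\<^sup>2 * exp (norm z + 1) \<le> (2 * exp (norm z + 1)) * exp (norm z + 1)"
        by (intro mult_right_mono power2_le_exp) auto
      also have "\<dots> = 2 * exp 2 * exp (2 * norm z)"
        by (simp add: exp_add[symmetric] mult.assoc algebra_simps)
      also have "\<dots> \<le> 2 * exp 2 * (exp (2\<^sup>2) * exp ((z \<bullet> z) / 4))"
        by (intro mult_left_mono exp_norm_le_exp_square) auto
      also have "\<dots> = 2 * exp 6 * exp ((z \<bullet> z) / 4)"
        by (simp add: exp_add[symmetric] mult.assoc)
      finally have "\<bar>exp t - 1 - t\<bar> \<le> (u \<bullet> u) * (2 * exp 6 * exp ((z \<bullet> z) / 4))"
        by (simp add: mult_left_mono)
      moreover have "u \<bullet> u / 2 \<le> (u \<bullet> u) * (1 / 2 * exp ((z \<bullet> z) / 4))"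
        using mult_left_mono[of 1 "exp ((z \<bullet> z) / 4)" "u \<bullet> u / 2"] by simp
      moreover have "Y z = (exp t - 1 - t) - u \<bullet> u / 2"
        by (simp add: Y_def t_def)
      moreover have "(u \<bullet> u) * (D * exp ((z \<bullet> z) / 4))
          = (u \<bullet> u) * (2 * exp 6 * exp ((z \<bullet> z) / 4)) + (u \<bullet> u) * (1 / 2 * exp ((z \<bullet> z) / 4))"
        by (simp add: D_def algebra_simps)
      ultimately show ?thesis using inner_ge_zero[of u] by linarith
    qed
    have [measurable]: "Y \<in> borel_measurable borel" unfolding Y_def by measurable
    have comm: "x + w + y = x + y + w" for y by simp
    have int1: "integrable gauss (\<lambda>z. \<phi> (x + sqrt \<tau> *\<^sub>R T z))"
      by (rule gauss_integrable_bounded[where C=B]) (use B in auto)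
    have int2: "integrable gauss (\<lambda>z. (u \<bullet> T z) * \<phi> (x + sqrt \<tau> *\<^sub>R T z))"
      by (rule Bochner_Integration.integrable_bound[OF integrable_mult_right[OF integrable_abs[OF integrable_inner[of u]], of B]])
         (use B B0 in \<open>auto simp: abs_mult mult.commute[of B] intro!: AE_I2 mult_left_mono\<close>)
    have bound: "\<bar>Y z * \<phi> (x + sqrt \<tau> *\<^sub>R T z)\<bar> \<le> B * ((u \<bullet> u) * D) * exp ((z \<bullet> z) / 4)" for z
      using mult_mono[OF Y[of z] B[of "x + sqrt \<tau> *\<^sub>R T z"]] by (simp add: abs_mult mult_ac D_def)
    have int3: "integrable gauss (\<lambda>z. Y z * \<phi> (x + sqrt \<tau> *\<^sub>R T z))"
      by (rule gauss_integrable_dominated[OF _ bound]) simp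
    have "heat T \<tau> \<phi> (x + w) = (\<integral>z. exp (u \<bullet> T z - u \<bullet> u / 2) * \<phi> (x + sqrt \<tau> *\<^sub>R T z) \<partial>gauss)"
      unfolding heat_def comm using shift[of \<phi> u "sqrt \<tau>" x] u \<tau> by simp
    also have "\<dots> = (\<integral>z. Y z * \<phi> (x + sqrt \<tau> *\<^sub>R T z) + \<phi> (x + sqrt \<tau> *\<^sub>R T z)
        + (u \<bullet> T z) * \<phi> (x + sqrt \<tau> *\<^sub>R T z) \<partial>gauss)"
      by (simp add: Y_def algebra_simps)
    also have "\<dots> = (\<integral>z. Y z * \<phi> (x + sqrt \<tau> *\<^sub>R T z) \<partial>gauss) + heat T \<tau> \<phi> x + v x \<bullet> w"
      using int1 int2 int3 by (simp add: heat_def v_inner u_def[symmetric])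
    finally have "\<bar>heat T \<tau> \<phi> (x + w) - heat T \<tau> \<phi> x - v x \<bullet> w\<bar> = \<bar>\<integral>z. Y z * \<phi> (x + sqrt \<tau> *\<^sub>R T z) \<partial>gauss\<bar>"
      by simp
    also have "\<dots> \<le> (\<integral>z. \<bar>Y z * \<phi> (x + sqrt \<tau> *\<^sub>R T z)\<bar> \<partial>gauss)"
      by (rule integral_abs_bound)
    also have "\<dots> \<le> (\<integral>z. B * ((u \<bullet> u) * D) * exp ((z \<bullet> z) / 4) \<partial>(gauss :: 'a measure))"
      using int3 int_exp bound by (intro Bochner_Integration.integral_mono) auto
    finally show ?thesis by (simp add: E_def u(3) mult_ac)
  qed
  have heatB: "\<bar>heat T \<tau> \<phi> x\<bar> \<le> B" for x
    using heat_bounds[of \<phi> "-B" B \<tau> x] B by (auto simp: abs_le_iff minus_le_iff)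
  define P where "P = B * (D + 2) * E"
  have D1: "1 \<le> D" using exp_ge_add_one_self[of 6] by (simp add: D_def)
  have "B \<le> B * E" using mult_left_mono[OF E1 B0] by simp
  moreover have "B * E \<le> B * D * E"
    using mult_left_mono[OF D1, of "B * E"] B0 E1 by (simp add: mult_ac)
  moreover have "P = B * D * E + 2 * (B * E)" by (simp add: P_def algebra_simps)
  ultimately have P: "B * E \<le> P" "B * D * E \<le> P" "2 * B \<le> P" "B * E + B * D * E \<le> P" "2 * B + B * E \<le> P" "0 \<le> P"
    using B0 by linarith+
  have K: "K = P * (1 / sqrt \<tau> + 1 / \<tau>)" by (simp add: K_def P_def)
  show ?thesis
    unfolding C11_def
  proof (intro exI bexI[of _ v] allI conjI ballI)
    show "v \<in> borel_measurable borel" unfolding v_def by measurable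
    fix x
    show "norm (v x) \<le> K"
    proof -
      have "norm (v x) \<le> P * (1 / sqrt \<tau>)"
        using nv[of x] mult_right_mono[OF P(1), of "1 / sqrt \<tau>"] \<tau> by simp
      also have "\<dots> \<le> K" unfolding K using \<tau> P(6) by (intro mult_left_mono) auto
      finally show ?thesis .
    qed
    fix w assume w: "w \<in> S"
    \<comment> \<open>The displacement in units of the smoothing scale. Its size relative to
      \<open>1\<close> decides which estimate is used.\<close>
    define q where "q = norm w / sqrt \<tau>"
    have q: "0 \<le> q" "q\<^sup>2 = w \<bullet> w / \<tau>"
      using \<tau> by (simp_all add: q_def power_divide dot_square_norm)
    have Kq: "P * q \<le> K * norm w"
      unfolding K q_def using \<tau> P(6) by (auto simp: algebra_simps)
    have Kq2: "P * q\<^sup>2 \<le> K * (w \<bullet> w)"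
      unfolding K q(2) using \<tau> P(6) by (auto simp: algebra_simps)
    have vw: "\<bar>v x \<bullet> w\<bar> \<le> B * E * q"
    proof -
      have "\<bar>v x \<bullet> w\<bar> \<le> norm (v x) * norm w" by (rule Cauchy_Schwarz_ineq2)
      also have "\<dots> \<le> B * E * (1 / sqrt \<tau>) * norm w" by (rule mult_right_mono[OF nv]) simp
      finally show ?thesis by (simp add: q_def)
    qed
    have diff: "\<bar>heat T \<tau> \<phi> (x + w) - heat T \<tau> \<phi> x\<bar> \<le> 2 * B"
      using heatB[of x] heatB[of "x + w"] by linarith
    have "\<bar>heat T \<tau> \<phi> (x + w) - heat T \<tau> \<phi> x\<bar> \<le> P * q
      \<and> \<bar>heat T \<tau> \<phi> (x + w) - heat T \<tau> \<phi> x - v x \<bullet> w\<bar> \<le> P * q\<^sup>2"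
    \<comment> \<open>Up to the scale \<open>1\<close> the expansion applies and
      \<open>q\<^sup>2 \<le> q\<close>. Beyond it \<open>q \<le> q\<^sup>2\<close>, and the crude
      bounds on the average and on \<open>v\<close> already suffice.\<close>
    proof (cases "w \<bullet> w \<le> \<tau>")
      case True
      have "q\<^sup>2 \<le> 1" using True \<tau> q by simp
      then have "q \<le> 1" using q(1) by (simp add: power_le_one_iff abs_le_square_iff[of q 1, simplified])
      then have qq: "q\<^sup>2 \<le> q" using q(1) by (simp add: power2_eq_square mult_left_le)
      have *: "\<bar>heat T \<tau> \<phi> (x + w) - heat T \<tau> \<phi> x - v x \<bullet> w\<bar> \<le> B * D * E * q\<^sup>2"
        using quad[OF w True, of x] q by simp
      have "B * D * E * q\<^sup>2 \<le> B * D * E * q"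
        using qq B0 E1 D1 by (intro mult_left_mono) auto
      with * vw have "\<bar>heat T \<tau> \<phi> (x + w) - heat T \<tau> \<phi> x\<bar> \<le> (B * E + B * D * E) * q"
        unfolding distrib_right by linarith
      then show ?thesis
        using * mult_right_mono[OF P(4) q(1)] mult_right_mono[OF P(2), of "q\<^sup>2"] by auto
    next
      case False
      then have "1 \<le> q\<^sup>2" using \<tau> q by simp
      then have "1 \<le> q" using q(1) abs_le_square_iff[of 1 q] by simp
      then have qq: "q \<le> q\<^sup>2" "1 \<le> q\<^sup>2" by (simp_all add: self_le_power)
      have "2 * B \<le> P * q"
        using mult_mono[OF P(3) \<open>1 \<le> q\<close>] P(6) by simp
      moreover have "\<bar>heat T \<tau> \<phi> (x + w) - heat T \<tau> \<phi> x - v x \<bullet> w\<bar> \<le> P * q\<^sup>2"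
      proof -
        have "2 * B * 1 \<le> 2 * B * q\<^sup>2"
          by (rule mult_left_mono) (use qq B0 in auto)
        moreover have "B * E * q \<le> B * E * q\<^sup>2"
          by (rule mult_left_mono) (use qq B0 E1 in auto)
        moreover have "(2 * B + B * E) * q\<^sup>2 \<le> P * q\<^sup>2"
          using P(5) by (rule mult_right_mono) simp
        ultimately show ?thesis using diff vw unfolding distrib_right by linarith
      qed
      ultimately show ?thesis using diff by simp
    qed
    then show "\<bar>heat T \<tau> \<phi> (x + w) - heat T \<tau> \<phi> x\<bar> \<le> K * norm w"
      "\<bar>heat T \<tau> \<phi> (x + w) - heat T \<tau> \<phi> x - v x \<bullet> w\<bar> \<le> K * (w \<bullet> w)"
      using Kq Kq2 by auto
  qed
qed

end

section \<open>Recovering a measurable function from its Gaussian averages\<close>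

lemma gauss_continuous_approx:
  fixes \<phi> :: "'a::euclidean_space \<Rightarrow> real"
  assumes [measurable]: "\<phi> \<in> borel_measurable borel" and B: "\<And>x. \<bar>\<phi> x\<bar> \<le> B" and "0 < \<epsilon>"
  shows "\<exists>g. continuous_on UNIV g \<and> (\<forall>x. \<bar>g x\<bar> \<le> B) \<and> (\<integral>z. \<bar>\<phi> z - g z\<bar> \<partial>gauss) < \<epsilon>"
proof -
  \<comment> \<open>\<open>measurable_on\<close> provides continuous functions converging to
    \<open>\<phi>\<close> off a Lebesgue null set, which is also a \<open>gauss\<close> null
    set.\<close>
  have "\<phi> measurable_on UNIV"
  proof -
    have "\<phi> \<in> borel_measurable lebesgue" by (rule measurable_completion) simp
    then show ?thesis
      using measurable_on_iff_borel_measurable[of UNIV \<phi>] by (simp add: lebesgue_on_UNIV_eq)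
  qed
  then obtain N g where N: "negligible N" and g: "\<And>n. continuous_on UNIV (g n)"
    and lim: "\<And>x. x \<notin> N \<Longrightarrow> (\<lambda>n. g n x) \<longlonglongrightarrow> \<phi> x"
    unfolding measurable_on_def by auto
  \<comment> \<open>Clipping at \<open>B\<close> leaves the limit \<open>\<phi>\<close> unchanged
    and supplies the dominating constant.\<close>
  define g' where "g' n x = max (- B) (min B (g n x))" for n :: nat and x
  have B0: "0 \<le> B" using B[of 0] by linarith
  have g': "continuous_on UNIV (g' n)" "\<bar>g' n x\<bar> \<le> B" for n x
    unfolding g'_def using g B0 by (auto intro!: continuous_intros)
  then have [measurable]: "g' n \<in> borel_measurable borel" for n
    by (intro borel_measurable_continuous_onI) auto
  have "AE x in lebesgue. x \<notin> N"
    using N by (simp add: negligible_iff_null_sets AE_not_in)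
  then have "AE x in lborel. x \<notin> N"
    by (simp add: AE_completion_iff)
  then have "AE x in gauss. x \<notin> N"
    unfolding gauss_def by (subst AE_density) (auto simp del: std_normal_density_def)
  then have "AE x in gauss. (\<lambda>n. \<bar>\<phi> x - g' n x\<bar>) \<longlonglongrightarrow> 0"
  proof eventually_elim
    fix x assume "x \<notin> N"
    then have "(\<lambda>n. \<bar>\<phi> x - g' n x\<bar>) \<longlonglongrightarrow> \<bar>\<phi> x - max (- B) (min B (\<phi> x))\<bar>"
      unfolding g'_def by (intro tendsto_intros lim)
    moreover have "max (- B) (min B (\<phi> x)) = \<phi> x" using B[of x] by auto
    ultimately show "(\<lambda>n. \<bar>\<phi> x - g' n x\<bar>) \<longlonglongrightarrow> 0" by simp
  qed
  then have "(\<lambda>n. \<integral>x. \<bar>\<phi> x - g' n x\<bar> \<partial>gauss) \<longlonglongrightarrow> (\<integral>x. 0 \<partial>(gauss :: 'a measure))"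
  proof (rule integral_dominated_convergence[rotated 3])
    show "AE x in gauss. norm \<bar>\<phi> x - g' n x\<bar> \<le> 2 * B" for n
    proof (rule AE_I2)
      fix x show "norm \<bar>\<phi> x - g' n x\<bar> \<le> 2 * B"
        using B[of x] g'(2)[of n x] unfolding real_norm_def by linarith
    qed
  qed auto
  then have "\<forall>\<^sub>F n in sequentially. (\<integral>x. \<bar>\<phi> x - g' n x\<bar> \<partial>gauss) < \<epsilon>"
    using \<open>0 < \<epsilon>\<close> by (intro order_tendstoD(2)) auto
  then obtain n where "(\<integral>x. \<bar>\<phi> x - g' n x\<bar> \<partial>gauss) < \<epsilon>"
    by (meson eventually_happens sequentially_bot)
  then show ?thesis using g' by blast
qed

text \<open>The rotated variable is again standard Gaussian for every \<open>n\<close>. Replacing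
  \<open>\<phi>\<close> by a continuous \<open>g\<close> therefore costs the same at the rotated
  point as at \<open>z\<close>, and for \<open>g\<close> dominated convergence applies.\<close>

lemma mehler_L1_continuous:
  fixes \<phi> :: "'a::euclidean_space \<Rightarrow> real"
  assumes [measurable]: "\<phi> \<in> borel_measurable borel" and B: "\<And>x. \<bar>\<phi> x\<bar> \<le> B"
    and \<tau>: "\<And>n. 0 \<le> \<tau> n" "\<And>n. \<tau> n \<le> 1" "\<tau> \<longlonglongrightarrow> 0"
  shows "(\<lambda>n. \<integral>(z, z'). \<bar>\<phi> (sqrt (1 - \<tau> n) *\<^sub>R z + sqrt (\<tau> n) *\<^sub>R z') - \<phi> z\<bar> \<partial>(gauss \<Otimes>\<^sub>M gauss)) \<longlonglongrightarrow> 0"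
proof -
  interpret P: pair_prob_space "gauss :: 'a measure" "gauss :: 'a measure" ..
  have diff_le: "\<bar>a - b\<bar> \<le> 2 * B" if "\<bar>a\<bar> \<le> B" "\<bar>b\<bar> \<le> B" for a b
    using that by linarith
  let ?P = "gauss \<Otimes>\<^sub>M gauss :: ('a \<times> 'a) measure"
  define X where "X n p = sqrt (1 - \<tau> n) *\<^sub>R fst p + sqrt (\<tau> n) *\<^sub>R snd p" for n and p :: "'a \<times> 'a"
  have [measurable]: "X n \<in> ?P \<rightarrow>\<^sub>M borel" for n unfolding X_def by measurable
  have lawX: "(\<integral>p. f (X n p) \<partial>?P) = (\<integral>z. f z \<partial>gauss)"
    if [measurable]: "f \<in> borel_measurable borel" for f :: "'a \<Rightarrow> real" and n
  proof -
    have "(\<integral>p. f (X n p) \<partial>?P) = (\<integral>z. f z \<partial>distr ?P borel (X n))"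
      by (rule integral_distr[symmetric]) auto
    also have "distr ?P borel (X n) = distr gauss borel (\<lambda>z. 1 *\<^sub>R z)"
      using gauss_conv_distr[of "sqrt (1 - \<tau> n)" "sqrt (\<tau> n)" 1] \<tau>
      by (simp add: X_def[abs_def] case_prod_unfold)
    finally show ?thesis by (simp add: distr_id2)
  qed
  have lawfst: "(\<integral>p. f (fst p) \<partial>?P) = (\<integral>z. f z \<partial>gauss)"
    if [measurable]: "f \<in> borel_measurable borel" for f :: "'a \<Rightarrow> real"
  proof -
    have "(\<integral>p. f (fst p) \<partial>?P) = (\<integral>z. f z \<partial>distr ?P gauss fst)"
      by (rule integral_distr[symmetric]) auto
    then show ?thesis by (simp add: gauss.distr_pair_fst)
  qed
  have "(\<lambda>n. \<integral>p. \<bar>\<phi> (X n p) - \<phi> (fst p)\<bar> \<partial>?P) \<longlonglongrightarrow> 0"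
  proof (rule LIMSEQ_I)
    fix r :: real assume r: "0 < r"
    obtain g where g: "continuous_on UNIV g" "\<And>x. \<bar>g x\<bar> \<le> B" "(\<integral>z. \<bar>\<phi> z - g z\<bar> \<partial>gauss) < r / 3"
      using gauss_continuous_approx[of \<phi> B "r / 3"] r B by auto
    have [measurable]: "g \<in> borel_measurable borel"
      using g(1) by (rule borel_measurable_continuous_onI)
    have "(\<lambda>n. \<integral>p. \<bar>g (X n p) - g (fst p)\<bar> \<partial>?P) \<longlonglongrightarrow> (\<integral>p. 0 \<partial>?P)"
    proof (rule integral_dominated_convergence[where w="\<lambda>_. 2 * B"])
      show "AE p in ?P. (\<lambda>n. \<bar>g (X n p) - g (fst p)\<bar>) \<longlonglongrightarrow> 0"
      proof (rule AE_I2)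
        fix p :: "'a \<times> 'a"
        have "(\<lambda>n. X n p) \<longlonglongrightarrow> sqrt (1 - 0) *\<^sub>R fst p + sqrt 0 *\<^sub>R snd p"
          unfolding X_def by (intro tendsto_intros \<tau>)
        then have "(\<lambda>n. g (X n p)) \<longlonglongrightarrow> g (fst p)"
          using g(1) by (intro continuous_on_tendsto_compose[OF g(1)]) auto
        then have "(\<lambda>n. \<bar>g (X n p) - g (fst p)\<bar>) \<longlonglongrightarrow> \<bar>g (fst p) - g (fst p)\<bar>"
          by (intro tendsto_intros)
        then show "(\<lambda>n. \<bar>g (X n p) - g (fst p)\<bar>) \<longlonglongrightarrow> 0" by simp
      qed
      show "AE p in ?P. norm \<bar>g (X n p) - g (fst p)\<bar> \<le> 2 * B" for n
        by (intro AE_I2) (simp only: real_norm_def abs_abs, intro diff_le g(2))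
    qed auto
    then have "\<forall>\<^sub>F n in sequentially. (\<integral>p. \<bar>g (X n p) - g (fst p)\<bar> \<partial>?P) < r / 3"
      using r by (intro order_tendstoD(2)) auto
    then obtain no where no: "\<And>n. no \<le> n \<Longrightarrow> (\<integral>p. \<bar>g (X n p) - g (fst p)\<bar> \<partial>?P) < r / 3"
      unfolding eventually_sequentially by blast
    show "\<exists>no. \<forall>n\<ge>no. norm ((\<integral>p. \<bar>\<phi> (X n p) - \<phi> (fst p)\<bar> \<partial>?P) - 0) < r"
    proof (intro exI[of _ no] allI impI)
      fix n assume n: "no \<le> n"
      have int: "integrable ?P (\<lambda>p. \<bar>\<phi> (X n p) - g (X n p)\<bar>)" "integrable ?P (\<lambda>p. \<bar>g (X n p) - g (fst p)\<bar>)"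
          "integrable ?P (\<lambda>p. \<bar>\<phi> (fst p) - g (fst p)\<bar>)" "integrable ?P (\<lambda>p. \<bar>\<phi> (X n p) - \<phi> (fst p)\<bar>)"
        by (rule P.integrable_const_bound[where B="2 * B"], rule AE_I2,
            simp only: real_norm_def abs_abs, intro diff_le B g(2), measurable)+
      have "(\<integral>p. \<bar>\<phi> (X n p) - \<phi> (fst p)\<bar> \<partial>?P)
        \<le> (\<integral>p. \<bar>\<phi> (X n p) - g (X n p)\<bar> + \<bar>g (X n p) - g (fst p)\<bar> + \<bar>\<phi> (fst p) - g (fst p)\<bar> \<partial>?P)"
        using int by (intro Bochner_Integration.integral_mono) auto
      also have "\<dots> = (\<integral>p. \<bar>\<phi> (X n p) - g (X n p)\<bar> \<partial>?P) + (\<integral>p. \<bar>g (X n p) - g (fst p)\<bar> \<partial>?P)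
          + (\<integral>p. \<bar>\<phi> (fst p) - g (fst p)\<bar> \<partial>?P)"
        using int by simp
      also have "(\<integral>p. \<bar>\<phi> (X n p) - g (X n p)\<bar> \<partial>?P) = (\<integral>z. \<bar>\<phi> z - g z\<bar> \<partial>gauss)"
        by (rule lawX[of "\<lambda>z. \<bar>\<phi> z - g z\<bar>"]) simp
      also have "(\<integral>p. \<bar>\<phi> (fst p) - g (fst p)\<bar> \<partial>?P) = (\<integral>z. \<bar>\<phi> z - g z\<bar> \<partial>gauss)"
        by (rule lawfst[of "\<lambda>z. \<bar>\<phi> z - g z\<bar>"]) simp
      finally have "(\<integral>p. \<bar>\<phi> (X n p) - \<phi> (fst p)\<bar> \<partial>?P) < r"
        using no[OF n] g(3) by linarith
      moreover have "0 \<le> (\<integral>p. \<bar>\<phi> (X n p) - \<phi> (fst p)\<bar> \<partial>?P)" by simp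
      ultimately show "norm ((\<integral>p. \<bar>\<phi> (X n p) - \<phi> (fst p)\<bar> \<partial>?P) - 0) < r" by simp
    qed
  qed
  then show ?thesis by (simp add: X_def case_prod_unfold)
qed

context coisometry begin

text \<open>The times \<open>1 - \<tau> n\<close> and \<open>\<tau> n\<close> add up to
  \<open>1\<close>, so inner and outer noise form the pair of \<open>mehler_L1_continuous\<close>;
  \<open>exp\<close> is Lipschitz on the range of \<open>\<phi>\<close>, and convergence in mean is
  enough.\<close>

lemma heat_exp_heat_tendsto:
  assumes [measurable]: "\<phi> \<in> borel_measurable borel" and B: "\<And>x. \<bar>\<phi> x\<bar> \<le> B"
    and \<tau>: "\<And>n. 0 \<le> \<tau> n" "\<And>n. \<tau> n \<le> 1" "\<tau> \<longlonglongrightarrow> 0"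
  shows "(\<lambda>n. heat T (1 - \<tau> n) (\<lambda>x. exp (heat T (\<tau> n) \<phi> x)) 0) \<longlonglongrightarrow> heat T 1 (\<lambda>x. exp (\<phi> x)) 0"
proof -
  interpret P: pair_prob_space "gauss :: 'a measure" "gauss :: 'a measure" ..
  define f where "f z = \<phi> (T z)" for z
  have [measurable]: "f \<in> borel_measurable borel" unfolding f_def by measurable
  have fB: "\<bar>f z\<bar> \<le> B" for z by (simp add: f_def B)
  define M where "M n z = (\<integral>z'. f (sqrt (1 - \<tau> n) *\<^sub>R z + sqrt (\<tau> n) *\<^sub>R z') \<partial>gauss)" for n z
  have [measurable]: "M n \<in> borel_measurable borel" for n unfolding M_def by measurable
  have fint: "integrable gauss (\<lambda>z'. f (a + b *\<^sub>R z'))" for a b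
    by (rule gauss_integrable_bounded[where C=B]) (use fB in auto)
  have MB: "\<bar>M n z\<bar> \<le> B" for n z
  proof -
    have "M n z \<le> B" unfolding M_def
      using fB by (intro gauss.integral_le_const fint) (simp add: abs_le_iff)
    moreover have "- B \<le> M n z" unfolding M_def
      using fB by (intro gauss.integral_ge_const fint) (simp add: abs_le_iff minus_le_iff)
    ultimately show ?thesis by (simp add: abs_le_iff)
  qed
  have lhs: "heat T (1 - \<tau> n) (\<lambda>x. exp (heat T (\<tau> n) \<phi> x)) 0 = (\<integral>z. exp (M n z) \<partial>gauss)" for n
    by (simp add: heat_def M_def f_def linear_add[OF linear] linear_scale[OF linear])
  have rhs: "heat T 1 (\<lambda>x. exp (\<phi> x)) 0 = (\<integral>z. exp (f z) \<partial>gauss)"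
    by (simp add: heat_def f_def)
  let ?I = "\<lambda>n. \<integral>(z, z'). \<bar>f (sqrt (1 - \<tau> n) *\<^sub>R z + sqrt (\<tau> n) *\<^sub>R z') - f z\<bar> \<partial>(gauss \<Otimes>\<^sub>M gauss)"
  have exp_lip: "\<bar>exp a - exp b\<bar> \<le> exp B * \<bar>a - b\<bar>" if "\<bar>a\<bar> \<le> B" "\<bar>b\<bar> \<le> B" for a b :: real
    using that by (intro exp_lipschitz) auto
  have bound: "\<bar>(\<integral>z. exp (M n z) \<partial>gauss) - (\<integral>z. exp (f z) \<partial>gauss)\<bar> \<le> exp B * ?I n" for n
  proof -
    have int: "integrable gauss (\<lambda>z. exp (M n z))" "integrable gauss (\<lambda>z. exp (f z))"
    proof -
      have "\<bar>exp a\<bar> \<le> exp B" if "\<bar>a\<bar> \<le> B" for a using that by simp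
      then show "integrable gauss (\<lambda>z. exp (M n z))" "integrable gauss (\<lambda>z. exp (f z))"
        by (intro gauss_integrable_bounded[where C="exp B"] MB fB; measurable)+
    qed
    have intM: "integrable gauss (\<lambda>z. \<bar>M n z - f z\<bar>)"
    proof (rule gauss_integrable_bounded)
      show "\<bar>\<bar>M n z - f z\<bar>\<bar> \<le> 2 * B" for z
        using MB[of n z] fB[of z] by linarith
    qed measurable
    have intP: "integrable (gauss \<Otimes>\<^sub>M gauss) (\<lambda>(z, z'). \<bar>f (sqrt (1 - \<tau> n) *\<^sub>R z + sqrt (\<tau> n) *\<^sub>R z') - f z\<bar>)"
    proof (rule P.integrable_const_bound[where B="2 * B"], rule AE_I2)
      fix p :: "'a \<times> 'a"
      show "norm (case p of (z, z') \<Rightarrow> \<bar>f (sqrt (1 - \<tau> n) *\<^sub>R z + sqrt (\<tau> n) *\<^sub>R z') - f z\<bar>) \<le> 2 * B"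
        using fB[of "sqrt (1 - \<tau> n) *\<^sub>R fst p + sqrt (\<tau> n) *\<^sub>R snd p"] fB[of "fst p"]
        unfolding case_prod_unfold real_norm_def by linarith
    qed measurable
    have "\<bar>(\<integral>z. exp (M n z) \<partial>gauss) - (\<integral>z. exp (f z) \<partial>gauss)\<bar> = \<bar>\<integral>z. exp (M n z) - exp (f z) \<partial>gauss\<bar>"
      using int by simp
    also have "\<dots> \<le> (\<integral>z. \<bar>exp (M n z) - exp (f z)\<bar> \<partial>gauss)"
      by (rule integral_abs_bound)
    also have "\<dots> \<le> (\<integral>z. exp B * \<bar>M n z - f z\<bar> \<partial>gauss)"
      by (intro Bochner_Integration.integral_mono integrable_abs Bochner_Integration.integrable_diff int
          integrable_mult_right intM exp_lip MB fB)
    also have "\<dots> = exp B * (\<integral>z. \<bar>M n z - f z\<bar> \<partial>gauss)" by simp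
    finally have *: "\<bar>(\<integral>z. exp (M n z) \<partial>gauss) - (\<integral>z. exp (f z) \<partial>gauss)\<bar>
        \<le> exp B * (\<integral>z. \<bar>M n z - f z\<bar> \<partial>gauss)" .
    have "(\<integral>z. \<bar>M n z - f z\<bar> \<partial>gauss)
        \<le> (\<integral>z. (\<integral>z'. \<bar>f (sqrt (1 - \<tau> n) *\<^sub>R z + sqrt (\<tau> n) *\<^sub>R z') - f z\<bar> \<partial>gauss) \<partial>gauss)"
    proof (rule Bochner_Integration.integral_mono[OF intM P.integrable_fst[OF intP]])
      fix z :: 'a
      have "M n z - f z = (\<integral>z'. f (sqrt (1 - \<tau> n) *\<^sub>R z + sqrt (\<tau> n) *\<^sub>R z') - f z \<partial>gauss)"
        unfolding M_def using fint by simp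
      then show "\<bar>M n z - f z\<bar> \<le> (\<integral>z'. \<bar>f (sqrt (1 - \<tau> n) *\<^sub>R z + sqrt (\<tau> n) *\<^sub>R z') - f z\<bar> \<partial>gauss)"
        by (simp add: integral_abs_bound)
    qed
    also have "\<dots> = ?I n"
      by (rule P.integral_fst[OF intP])
    finally have "exp B * (\<integral>z. \<bar>M n z - f z\<bar> \<partial>gauss) \<le> exp B * ?I n"
      by (rule mult_left_mono) simp
    with * show ?thesis by (rule order_trans)
  qed
  have lim: "(\<lambda>n. exp B * ?I n) \<longlonglongrightarrow> 0"
    by (rule tendsto_mult_right_zero, rule mehler_L1_continuous[OF _ fB \<tau>]) measurable
  have "(\<lambda>n. (\<integral>z. exp (M n z) \<partial>gauss) - (\<integral>z. exp (f z) \<partial>gauss)) \<longlonglongrightarrow> 0"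
    by (rule Lim_null_comparison[OF always_eventually lim]) (simp only: real_norm_def bound simp_thms)
  then show ?thesis
    unfolding lhs rhs by (simp add: LIM_zero_iff)
qed

end

section \<open>The Gaussian inequality\<close>

lemma heat_0: "heat T 0 \<phi> x = \<phi> x"
  by (simp add: heat_def)

text \<open>\<open>A\<close> is a square root of \<open>\<Sigma>\<close>, so that \<open>A z\<close> has covariance \<open>\<Sigma>\<close> under \<open>gauss\<close>.\<close>
locale gaussian_coupling =
  fixes I :: "'i set" and J :: "'j set"
    and E :: "'i \<Rightarrow> 'e::euclidean_space set" and F :: "'j \<Rightarrow> 'f::euclidean_space set"
    and P :: "'i \<Rightarrow> 'x::euclidean_space \<Rightarrow> 'e" and Q :: "'j \<Rightarrow> 'x \<Rightarrow> 'f"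
    and A :: "'a::euclidean_space \<Rightarrow> 'x" and c :: "'i \<Rightarrow> real" and d :: "'j \<Rightarrow> real"
  assumes finite: "finite I" "finite J"
    and c_pos: "i \<in> I \<Longrightarrow> 0 < c i" and d_pos: "j \<in> J \<Longrightarrow> 0 < d j"
    and linear_P: "i \<in> I \<Longrightarrow> linear (P i)" and linear_Q: "j \<in> J \<Longrightarrow> linear (Q j)"
    and Q_range: "j \<in> J \<Longrightarrow> Q j x \<in> F j"
    and coisometry_P: "i \<in> I \<Longrightarrow> coisometry (\<lambda>z. P i (A z)) (E i)"
    and coisometry_Q: "j \<in> J \<Longrightarrow> coisometry (\<lambda>z. Q j (A z)) (F j)"
    and lift: "(\<And>i. i \<in> I \<Longrightarrow> u i \<in> E i) \<Longrightarrow> \<exists>x. \<forall>i\<in>I. P i x = u i"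
    and energy: "(\<Sum>j\<in>J. d j * (Q j x \<bullet> Q j x)) \<le> (\<Sum>i\<in>I. c i * (P i x \<bullet> P i x))"
begin

abbreviation "heatP i \<equiv> heat (\<lambda>z. P i (A z))"
abbreviation "heatQ j \<equiv> heat (\<lambda>z. Q j (A z))"

text \<open>All averages are driven by the same \<open>z\<close>: the hypothesis at the point
  \<open>x + sqrt t *\<^sub>R A z\<close> is integrated over \<open>z\<close>. The slack
  \<open>e\<close> carries the errors accumulated in earlier steps.\<close>

lemma heat_sum_le:
  assumes \<phi> [measurable]: "\<And>i. i \<in> I \<Longrightarrow> \<phi> i \<in> borel_measurable borel"
    and \<phi>B: "\<And>i x. i \<in> I \<Longrightarrow> \<bar>\<phi> i x\<bar> \<le> B"
    and \<psi> [measurable]: "\<And>j. j \<in> J \<Longrightarrow> \<psi> j \<in> borel_measurable borel"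
    and \<psi>B: "\<And>j y. j \<in> J \<Longrightarrow> \<bar>\<psi> j y\<bar> \<le> B"
    and le: "\<And>x. (\<Sum>i\<in>I. c i * \<phi> i (P i x)) \<le> (\<Sum>j\<in>J. d j * \<psi> j (Q j x)) + e"
  shows "(\<Sum>i\<in>I. c i * heatP i t (\<phi> i) (P i x)) \<le> (\<Sum>j\<in>J. d j * heatQ j t (\<psi> j) (Q j x)) + e"
proof -
  have intP: "integrable gauss (\<lambda>z. \<phi> i (P i x + sqrt t *\<^sub>R P i (A z)))" if "i \<in> I" for i
  proof -
    interpret coisometry "\<lambda>z. P i (A z)" "E i" using that by (rule coisometry_P)
    show ?thesis by (rule gauss_integrable_bounded[where C=B]) (use that \<phi> \<phi>B in auto)
  qed
  have intQ: "integrable gauss (\<lambda>z. \<psi> j (Q j x + sqrt t *\<^sub>R Q j (A z)))" if "j \<in> J" for j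
  proof -
    interpret coisometry "\<lambda>z. Q j (A z)" "F j" using that by (rule coisometry_Q)
    show ?thesis by (rule gauss_integrable_bounded[where C=B]) (use that \<psi> \<psi>B in auto)
  qed
  have "(\<Sum>i\<in>I. c i * heatP i t (\<phi> i) (P i x)) = (\<integral>z. (\<Sum>i\<in>I. c i * \<phi> i (P i x + sqrt t *\<^sub>R P i (A z))) \<partial>gauss)"
    unfolding heat_def using intP by simp
  also have "\<dots> \<le> (\<integral>z. (\<Sum>j\<in>J. d j * \<psi> j (Q j x + sqrt t *\<^sub>R Q j (A z))) + e \<partial>gauss)"
  proof (rule Bochner_Integration.integral_mono)
    fix z
    have "P i (x + sqrt t *\<^sub>R A z) = P i x + sqrt t *\<^sub>R P i (A z)" if "i \<in> I" for i
      by (simp add: linear_add[OF linear_P[OF that]] linear_scale[OF linear_P[OF that]])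
    moreover have "Q j (x + sqrt t *\<^sub>R A z) = Q j x + sqrt t *\<^sub>R Q j (A z)" if "j \<in> J" for j
      by (simp add: linear_add[OF linear_Q[OF that]] linear_scale[OF linear_Q[OF that]])
    ultimately show "(\<Sum>i\<in>I. c i * \<phi> i (P i x + sqrt t *\<^sub>R P i (A z)))
        \<le> (\<Sum>j\<in>J. d j * \<psi> j (Q j x + sqrt t *\<^sub>R Q j (A z))) + e"
      using le[of "x + sqrt t *\<^sub>R A z"] by simp
  qed (use intP intQ in auto)
  also have "\<dots> = (\<Sum>j\<in>J. d j * heatQ j t (\<psi> j) (Q j x)) + e"
    unfolding heat_def using intQ by simp
  finally show ?thesis .
qed

definition step_error :: "real \<Rightarrow> real" where
  "step_error K = 2048 * K\<^sup>2 * exp (K\<^sup>2 / 8) * (\<integral>z. exp ((z \<bullet> z) / 4) \<partial>(gauss :: 'a measure))"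

lemma step:
  assumes \<phi> [measurable]: "\<And>i. i \<in> I \<Longrightarrow> \<phi> i \<in> borel_measurable borel"
    and \<phi>B: "\<And>i x. i \<in> I \<Longrightarrow> \<bar>\<phi> i x\<bar> \<le> B"
    and C11: "\<And>i. i \<in> I \<Longrightarrow> C11 (E i) K (\<phi> i)"
    and \<psi> [measurable]: "\<And>j. j \<in> J \<Longrightarrow> \<psi> j \<in> borel_measurable borel"
    and \<psi>B: "\<And>j y. j \<in> J \<Longrightarrow> \<bar>\<psi> j y\<bar> \<le> B"
    and h: "0 < h" "h \<le> 1" "32 * K * h \<le> 1"
    and le: "\<And>x. (\<Sum>i\<in>I. c i * \<phi> i (P i x)) \<le> (\<Sum>j\<in>J. d j * \<psi> j (Q j x)) + e"
  shows "(\<Sum>i\<in>I. c i * ln (heatP i h (\<lambda>x. exp (\<phi> i x)) (P i x)))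
    \<le> (\<Sum>j\<in>J. d j * ln (heatQ j h (\<lambda>y. exp (\<psi> j y)) (Q j x))) + (e + (\<Sum>i\<in>I. c i) * step_error K * h\<^sup>2)"
proof -
  have "\<exists>u. u \<in> E i \<and> norm u \<le> K \<and> (\<forall>w\<in>E i. \<bar>\<phi> i (P i x + w) - \<phi> i (P i x) - u \<bullet> w\<bar> \<le> K * (w \<bullet> w))"
    if i: "i \<in> I" for i
  proof -
    interpret coisometry "\<lambda>z. P i (A z)" "E i" using i by (rule coisometry_P)
    obtain v where v: "norm v \<le> K" "\<And>w. w \<in> E i \<Longrightarrow> \<bar>\<phi> i (P i x + w) - \<phi> i (P i x) - v \<bullet> w\<bar> \<le> K * (w \<bullet> w)"
      using C11[OF i] unfolding C11_def by blast
    \<comment> \<open>The gradient from \<open>C11\<close> need not lie in \<open>E i\<close>, as a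
      drift must. Projecting it changes no inner product with \<open>E i\<close> and does not
      increase the norm.\<close>
    let ?u = "orth_proj (E i) v"
    note op = orth_proj(1)[OF subspace, of v] orth_proj(2)[OF subspace, where x=v]
    have uw: "?u \<bullet> w = v \<bullet> w" if "w \<in> E i" for w
      using op(2)[OF that] by (simp add: inner_diff_left)
    have "norm ?u * norm ?u \<le> norm v * norm ?u"
      using uw[OF op(1)] norm_cauchy_schwarz[of v ?u] by (simp add: dot_square_norm power2_eq_square)
    then have "norm ?u \<le> norm v"
      by (cases "norm ?u = 0") (simp_all add: mult_le_cancel_right)
    with v uw op(1) show ?thesis by (intro exI[of _ ?u]) auto
  qed
  then obtain u where u: "\<And>i. i \<in> I \<Longrightarrow> u i \<in> E i" "\<And>i. i \<in> I \<Longrightarrow> norm (u i) \<le> K"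
    "\<And>i w. i \<in> I \<Longrightarrow> w \<in> E i \<Longrightarrow> \<bar>\<phi> i (P i x + w) - \<phi> i (P i x) - u i \<bullet> w\<bar> \<le> K * (w \<bullet> w)"
    by metis
  \<comment> \<open>One vector \<open>U\<close> carries all drifts \<open>u i\<close> at once; its
    images \<open>Q j U\<close> then serve as drifts for the \<open>\<psi> j\<close>.\<close>
  obtain U where U: "\<And>i. i \<in> I \<Longrightarrow> P i U = u i"
    using lift[of u] u(1) by blast
  let ?x = "x + h *\<^sub>R U"
  have PU: "P i ?x = P i x + h *\<^sub>R u i" if "i \<in> I" for i
    by (simp add: linear_add[OF linear_P[OF that]] linear_scale[OF linear_P[OF that]] U that)
  have QU: "Q j ?x = Q j x + h *\<^sub>R Q j U" if "j \<in> J" for j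
    by (simp add: linear_add[OF linear_Q[OF that]] linear_scale[OF linear_Q[OF that]])
  have "(\<Sum>i\<in>I. c i * ln (heatP i h (\<lambda>x. exp (\<phi> i x)) (P i x)))
      \<le> (\<Sum>i\<in>I. c i * (heatP i h (\<phi> i) (P i ?x) - h * (u i \<bullet> u i) / 2 + step_error K * h\<^sup>2))"
  proof (intro sum_mono mult_left_mono)
    fix i assume i: "i \<in> I"
    interpret coisometry "\<lambda>z. P i (A z)" "E i" using i by (rule coisometry_P)
    show "ln (heatP i h (\<lambda>x. exp (\<phi> i x)) (P i x))
        \<le> heatP i h (\<phi> i) (P i ?x) - h * (u i \<bullet> u i) / 2 + step_error K * h\<^sup>2"
      unfolding PU[OF i] step_error_def
      by (rule heat_exp_upper) (use \<phi> \<phi>B u h i in auto)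
    show "0 \<le> c i" using c_pos[OF i] by simp
  qed
  also have "\<dots> = (\<Sum>i\<in>I. c i * heatP i h (\<phi> i) (P i ?x)) - h / 2 * (\<Sum>i\<in>I. c i * (P i U \<bullet> P i U))
      + (\<Sum>i\<in>I. c i) * step_error K * h\<^sup>2"
    using U by (simp add: sum.distrib sum_subtractf sum_distrib_left sum_distrib_right algebra_simps)
  \<comment> \<open>\<open>heat_sum_le\<close> at the drifted point compares the averages, and
    \<open>energy\<close> at \<open>U\<close> compares the drift costs; the latter enter with a
    minus sign, so both comparisons point the same way.\<close>
  also have "\<dots> \<le> (\<Sum>j\<in>J. d j * heatQ j h (\<psi> j) (Q j ?x)) + e - h / 2 * (\<Sum>j\<in>J. d j * (Q j U \<bullet> Q j U))
      + (\<Sum>i\<in>I. c i) * step_error K * h\<^sup>2"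
    by (intro add_right_mono diff_mono heat_sum_le[where B=B] mult_left_mono energy)
       (use \<phi> \<phi>B \<psi> \<psi>B le h in auto)
  also have "\<dots> = (\<Sum>j\<in>J. d j * (heatQ j h (\<psi> j) (Q j x + h *\<^sub>R Q j U) - h * (Q j U \<bullet> Q j U) / 2))
      + (e + (\<Sum>i\<in>I. c i) * step_error K * h\<^sup>2)"
    using QU by (simp add: sum.distrib sum_subtractf sum_distrib_left algebra_simps)
  also have "\<dots> \<le> (\<Sum>j\<in>J. d j * ln (heatQ j h (\<lambda>y. exp (\<psi> j y)) (Q j x)))
      + (e + (\<Sum>i\<in>I. c i) * step_error K * h\<^sup>2)"
  proof (intro add_right_mono sum_mono mult_left_mono)
    fix j assume j: "j \<in> J"
    interpret coisometry "\<lambda>z. Q j (A z)" "F j" using j by (rule coisometry_Q)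
    show "heatQ j h (\<psi> j) (Q j x + h *\<^sub>R Q j U) - h * (Q j U \<bullet> Q j U) / 2 \<le> ln (heatQ j h (\<lambda>y. exp (\<psi> j y)) (Q j x))"
      by (rule heat_exp_lower) (use \<psi> \<psi>B h j Q_range in auto)
    show "0 \<le> d j" using d_pos[OF j] by simp
  qed
  finally show ?thesis .
qed

text \<open>\<open>step\<close> is applied \<open>n\<close> times with step \<open>t / n\<close> to
  the logarithms of the evolved functions. For this their bounds and gradient constants must hold at
  all times.\<close>

lemma heat_exp_C11:
  assumes \<phi> [measurable]: "\<And>i. i \<in> I \<Longrightarrow> \<phi> i \<in> borel_measurable borel"
    and \<phi>B: "\<And>i x. i \<in> I \<Longrightarrow> \<bar>\<phi> i x\<bar> \<le> B"
    and C11: "\<And>i. i \<in> I \<Longrightarrow> \<exists>K. C11 (E i) K (\<phi> i)"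
    and \<psi> [measurable]: "\<And>j. j \<in> J \<Longrightarrow> \<psi> j \<in> borel_measurable borel"
    and \<psi>B: "\<And>j y. j \<in> J \<Longrightarrow> \<bar>\<psi> j y\<bar> \<le> B"
    and le: "\<And>x. (\<Sum>i\<in>I. c i * \<phi> i (P i x)) \<le> (\<Sum>j\<in>J. d j * \<psi> j (Q j x))"
    and t: "0 < t"
  shows "(\<Sum>i\<in>I. c i * ln (heatP i t (\<lambda>x. exp (\<phi> i x)) (P i x)))
    \<le> (\<Sum>j\<in>J. d j * ln (heatQ j t (\<lambda>y. exp (\<psi> j y)) (Q j x)))"
proof -
  define f where "f i x = exp (\<phi> i x)" for i x
  define g where "g j y = exp (\<psi> j y)" for j y
  have f_meas: "f i \<in> borel_measurable borel" if "i \<in> I" for i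
    unfolding f_def using \<phi>[OF that] by measurable
  have g_meas: "g j \<in> borel_measurable borel" if "j \<in> J" for j
    unfolding g_def using \<psi>[OF that] by measurable
  have fB: "f i x \<in> {exp (- B)..exp B}" if "i \<in> I" for i x
    using \<phi>B[OF that, of x] by (simp add: f_def abs_le_iff minus_le_iff)
  have gB: "g j y \<in> {exp (- B)..exp B}" if "j \<in> J" for j y
    using \<psi>B[OF that, of y] by (simp add: g_def abs_le_iff minus_le_iff)
  have heatP_meas: "heatP i s (f i) \<in> borel_measurable borel"
    and heatP_B: "heatP i s (f i) y \<in> {exp (- B)..exp B}" if "i \<in> I" for i s y
  proof -
    interpret coisometry "\<lambda>z. P i (A z)" "E i" using that by (rule coisometry_P)
    show "heatP i s (f i) \<in> borel_measurable borel" using f_meas[OF that] by measurable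
    show "heatP i s (f i) y \<in> {exp (- B)..exp B}"
      by (rule heat_bounds[OF f_meas[OF that] fB[OF that]])
  qed
  have heatQ_meas: "heatQ j s (g j) \<in> borel_measurable borel"
    and heatQ_B: "heatQ j s (g j) y \<in> {exp (- B)..exp B}" if "j \<in> J" for j s y
  proof -
    interpret coisometry "\<lambda>z. Q j (A z)" "F j" using that by (rule coisometry_Q)
    show "heatQ j s (g j) \<in> borel_measurable borel" using g_meas[OF that] by measurable
    show "heatQ j s (g j) y \<in> {exp (- B)..exp B}"
      by (rule heat_bounds[OF g_meas[OF that] gB[OF that]])
  qed
  have ln_B: "\<bar>ln a\<bar> \<le> B" "exp (ln a) = a" if "a \<in> {exp (- B)..exp B}" for a
  proof -
    have "0 < a" using that less_le_trans[OF exp_gt_zero[of "- B"], of a] by simp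
    then show "exp (ln a) = a" by simp
    show "\<bar>ln a\<bar> \<le> B"
      using that \<open>0 < a\<close> ln_le_cancel_iff[of "exp (- B)" a] ln_le_cancel_iff[of a "exp B"]
      by (simp add: abs_le_iff minus_le_iff)
  qed
  \<comment> \<open>One constant for all times: \<open>exp\<close> is applied once, the heat flow
    keeps the constant, and \<open>ln\<close> costs a factor depending only on the lower bound
    \<open>exp (- B)\<close>, which the flow preserves.\<close>
  have "\<exists>K. \<forall>s. C11 (E i) K (\<lambda>x. ln (heatP i s (f i) x))" if i: "i \<in> I" for i
  proof -
    interpret coisometry "\<lambda>z. P i (A z)" "E i" using i by (rule coisometry_P)
    obtain K where "C11 (E i) K (\<phi> i)" using C11[OF i] by blast
    then have "\<exists>K. C11 (E i) K (f i)"
      unfolding f_def[abs_def]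
      using C11_exp[of "E i" K "\<phi> i" "- B" B] \<phi>[OF i] \<phi>B[OF i]
      by (auto simp: abs_le_iff minus_le_iff)
    then obtain K1 where K1: "C11 (E i) K1 (f i)" by blast
    have "C11 (E i) K1 (heatP i s (f i))" for s
    proof (rule C11_heat[OF f_meas[OF i] _ K1])
      show "\<bar>f i x\<bar> \<le> exp B" for x using \<phi>B[OF i, of x] by (simp add: f_def abs_le_iff)
    qed
    from C11_ln[OF this heatP_meas[OF i] heatP_B[OF i]] show ?thesis by auto
  qed
  then obtain K0 where K0: "\<And>i s. i \<in> I \<Longrightarrow> C11 (E i) (K0 i) (\<lambda>x. ln (heatP i s (f i) x))"
    by metis
  define K where "K = (\<Sum>i\<in>I. \<bar>K0 i\<bar>)"
  have K: "C11 (E i) K (\<lambda>x. ln (heatP i s (f i) x))" if "i \<in> I" for i s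
  proof (rule C11_mono[OF K0[OF that]])
    have "\<bar>K0 i\<bar> \<le> K" unfolding K_def using finite that by (intro member_le_sum) auto
    then show "K0 i \<le> K" by simp
  qed
  have K_nonneg: "0 \<le> K" by (simp add: K_def sum_nonneg)
  define D where "D = (\<Sum>i\<in>I. c i) * step_error K"
  have iter: "(\<Sum>i\<in>I. c i * ln (heatP i (real n * h) (f i) (P i x)))
      \<le> (\<Sum>j\<in>J. d j * ln (heatQ j (real n * h) (g j) (Q j x))) + real n * D * h\<^sup>2"
    if h: "0 < h" "h \<le> 1" "32 * K * h \<le> 1" for n h x
  proof (induction n arbitrary: x)
    case 0
    then show ?case using le[of x] by (simp add: heat_0 f_def g_def)
  next
    case (Suc n)
    let ?s = "real n * h"
    \<comment> \<open>Exponentiating the evolved logarithm gives back the evolved function, so a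
      further step of length \<open>h\<close> only advances the time in the semigroup.\<close>
    have eqP: "heatP i h (\<lambda>x. exp (ln (heatP i ?s (f i) x))) y = heatP i (real (Suc n) * h) (f i) y"
      if i: "i \<in> I" for i y
    proof -
      interpret coisometry "\<lambda>z. P i (A z)" "E i" using i by (rule coisometry_P)
      have "heatP i h (heatP i ?s (f i)) y = heatP i (h + ?s) (f i) y"
        by (rule heat_heat[where C="exp B"]) (use f_meas[OF i] fB[OF i] h in \<open>auto simp: f_def\<close>)
      then show ?thesis using heatP_B[OF i] by (simp add: ln_B algebra_simps)
    qed
    have eqQ: "heatQ j h (\<lambda>x. exp (ln (heatQ j ?s (g j) x))) y = heatQ j (real (Suc n) * h) (g j) y"
      if j: "j \<in> J" for j y
    proof -
      interpret coisometry "\<lambda>z. Q j (A z)" "F j" using j by (rule coisometry_Q)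
      have "heatQ j h (heatQ j ?s (g j)) y = heatQ j (h + ?s) (g j) y"
        by (rule heat_heat[where C="exp B"]) (use g_meas[OF j] gB[OF j] h in \<open>auto simp: g_def\<close>)
      then show ?thesis using heatQ_B[OF j] by (simp add: ln_B algebra_simps)
    qed
    have "(\<Sum>i\<in>I. c i * ln (heatP i h (\<lambda>x. exp (ln (heatP i ?s (f i) x))) (P i x)))
      \<le> (\<Sum>j\<in>J. d j * ln (heatQ j h (\<lambda>y. exp (ln (heatQ j ?s (g j) y))) (Q j x)))
        + (real n * D * h\<^sup>2 + (\<Sum>i\<in>I. c i) * step_error K * h\<^sup>2)"
    proof (rule step[where B=B])
      show "(\<lambda>x. ln (heatP i ?s (f i) x)) \<in> borel_measurable borel" if "i \<in> I" for i
        using heatP_meas[OF that] by measurable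
      show "(\<lambda>x. ln (heatQ j ?s (g j) x)) \<in> borel_measurable borel" if "j \<in> J" for j
        using heatQ_meas[OF that] by measurable
    qed (use ln_B heatP_B heatQ_B K h Suc.IH in auto)
    then have "(\<Sum>i\<in>I. c i * ln (heatP i (real (Suc n) * h) (f i) (P i x)))
      \<le> (\<Sum>j\<in>J. d j * ln (heatQ j (real (Suc n) * h) (g j) (Q j x)))
        + (real n * D * h\<^sup>2 + (\<Sum>i\<in>I. c i) * step_error K * h\<^sup>2)"
      by (simp only: eqP eqQ cong: sum.cong)
    also have "real n * D * h\<^sup>2 + (\<Sum>i\<in>I. c i) * step_error K * h\<^sup>2 = real (Suc n) * D * h\<^sup>2"
      by (simp add: D_def distrib_right)
    finally show ?case .
  qed
  let ?L = "\<Sum>i\<in>I. c i * ln (heatP i t (f i) (P i x))"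
  let ?R = "\<Sum>j\<in>J. d j * ln (heatQ j t (g j) (Q j x))"
  have "\<forall>\<^sub>F n in sequentially. t / real n \<le> 1 \<and> 32 * K * (t / real n) \<le> 1 \<and> 0 < n"
  proof (intro eventually_conj)
    have "(\<lambda>n. t / real n) \<longlonglongrightarrow> 0" by (rule lim_const_over_n)
    then show "\<forall>\<^sub>F n in sequentially. t / real n \<le> 1"
      by (rule eventually_mono[OF order_tendstoD(2)[of _ 0 _ 1]]) auto
    have "(\<lambda>n. 32 * K * (t / real n)) \<longlonglongrightarrow> 32 * K * 0"
      by (intro tendsto_mult tendsto_const lim_const_over_n)
    then show "\<forall>\<^sub>F n in sequentially. 32 * K * (t / real n) \<le> 1"
      by (intro eventually_mono[OF order_tendstoD(2)[of _ 0 _ 1]]) auto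
  qed (rule eventually_gt_at_top)
  \<comment> \<open>The \<open>n\<close> errors of size \<open>D * (t / n)\<^sup>2\<close> sum to
    \<open>D * t\<^sup>2 / n\<close>, which vanishes in the limit.\<close>
  then have "\<forall>\<^sub>F n in sequentially. ?L \<le> ?R + D * t\<^sup>2 / real n"
  proof eventually_elim
    case (elim n)
    then have n: "0 < real n" by simp
    have "?L \<le> ?R + real n * D * (t / real n)\<^sup>2"
      using iter[of "t / real n" n x] elim t n by simp
    also have "real n * D * (t / real n)\<^sup>2 = D * t\<^sup>2 / real n"
      using n by (simp add: power2_eq_square field_simps)
    finally show ?case .
  qed
  moreover have "(\<lambda>n. ?R + D * t\<^sup>2 / real n) \<longlonglongrightarrow> ?R + 0"
    by (intro tendsto_add tendsto_const lim_const_over_n)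
  ultimately have "?L \<le> ?R + 0"
    by (intro tendsto_lowerbound) auto
  then show ?thesis by (simp add: f_def[abs_def] g_def[abs_def])
qed

theorem gaussian_inequality:
  assumes \<phi> [measurable]: "\<And>i. i \<in> I \<Longrightarrow> \<phi> i \<in> borel_measurable borel"
    and \<phi>B: "\<And>i x. i \<in> I \<Longrightarrow> \<bar>\<phi> i x\<bar> \<le> B"
    and \<psi> [measurable]: "\<And>j. j \<in> J \<Longrightarrow> \<psi> j \<in> borel_measurable borel"
    and \<psi>B: "\<And>j y. j \<in> J \<Longrightarrow> \<bar>\<psi> j y\<bar> \<le> B"
    and le: "\<And>x. (\<Sum>i\<in>I. c i * \<phi> i (P i x)) \<le> (\<Sum>j\<in>J. d j * \<psi> j (Q j x))"
  shows "(\<Sum>i\<in>I. c i * ln (\<integral>z. exp (\<phi> i (P i (A z))) \<partial>gauss))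
    \<le> (\<Sum>j\<in>J. d j * ln (\<integral>z. exp (\<psi> j (Q j (A z))) \<partial>gauss))"
proof -
  \<comment> \<open>The offset by two keeps both \<open>\<tau> n\<close> and
    \<open>1 - \<tau> n\<close> positive: the first is needed for smoothing, the second for the
    remaining flow.\<close>
  define \<tau> where "\<tau> n = 1 / real (Suc (Suc n))" for n
  have \<tau>: "0 < \<tau> n" "\<tau> n < 1" for n by (auto simp: \<tau>_def)
  have \<tau>lim: "\<tau> \<longlonglongrightarrow> 0"
    unfolding \<tau>_def using LIMSEQ_Suc[OF LIMSEQ_Suc[OF lim_1_over_n[where 'a=real]]] by simp
  have P0: "P i 0 = 0" if "i \<in> I" for i using linear_0[OF linear_P[OF that]] .
  have Q0: "Q j 0 = 0" if "j \<in> J" for j using linear_0[OF linear_Q[OF that]] .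
  let ?L = "\<lambda>n. \<Sum>i\<in>I. c i * ln (heatP i (1 - \<tau> n) (\<lambda>x. exp (heatP i (\<tau> n) (\<phi> i) x)) 0)"
  let ?R = "\<Sum>j\<in>J. d j * ln (heatQ j 1 (\<lambda>y. exp (\<psi> j y)) 0)"
  have heatP_meas: "heatP i s (\<phi> i) \<in> borel_measurable borel"
    and heatP_B: "\<bar>heatP i s (\<phi> i) y\<bar> \<le> B" if i: "i \<in> I" for i s y
  proof -
    interpret coisometry "\<lambda>z. P i (A z)" "E i" using i by (rule coisometry_P)
    show "heatP i s (\<phi> i) \<in> borel_measurable borel" using \<phi>[OF i] by measurable
    show "\<bar>heatP i s (\<phi> i) y\<bar> \<le> B"
      using heat_bounds[OF \<phi>[OF i], of "- B" B s y] \<phi>B[OF i] by (simp add: abs_le_iff minus_le_iff)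
  qed
  have heatQ_meas: "heatQ j s (\<psi> j) \<in> borel_measurable borel"
    and heatQ_B: "\<bar>heatQ j s (\<psi> j) y\<bar> \<le> B" if j: "j \<in> J" for j s y
  proof -
    interpret coisometry "\<lambda>z. Q j (A z)" "F j" using j by (rule coisometry_Q)
    show "heatQ j s (\<psi> j) \<in> borel_measurable borel" using \<psi>[OF j] by measurable
    show "\<bar>heatQ j s (\<psi> j) y\<bar> \<le> B"
      using heat_bounds[OF \<psi>[OF j], of "- B" B s y] \<psi>B[OF j] by (simp add: abs_le_iff minus_le_iff)
  qed
  have "?L n \<le> ?R" for n
  proof -
    have "?L n \<le> (\<Sum>j\<in>J. d j * ln (heatQ j (1 - \<tau> n) (\<lambda>y. exp (heatQ j (\<tau> n) (\<psi> j) y)) 0))"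
    proof -
      have smooth: "\<exists>K. C11 (E i) K (heatP i (\<tau> n) (\<phi> i))" if "i \<in> I" for i
        by (rule coisometry.C11_heat_smoothing[OF coisometry_P[OF that] \<phi>[OF that] \<phi>B[OF that] \<tau>(1)])
      have "(\<Sum>i\<in>I. c i * heatP i (\<tau> n) (\<phi> i) (P i x)) \<le> (\<Sum>j\<in>J. d j * heatQ j (\<tau> n) (\<psi> j) (Q j x))" for x
        using heat_sum_le[of \<phi> B \<psi> 0 "\<tau> n" x] \<phi> \<phi>B \<psi> \<psi>B le by simp
      then show ?thesis
        using heat_exp_C11[of "\<lambda>i. heatP i (\<tau> n) (\<phi> i)" B "\<lambda>j. heatQ j (\<tau> n) (\<psi> j)" "1 - \<tau> n" 0]
          heatP_meas heatP_B heatQ_meas heatQ_B smooth \<tau>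
        by (simp add: P0 Q0)
    qed
    \<comment> \<open>Jensen under the short flow and the semigroup law give a bound free of
      \<open>n\<close>. The right side thus needs neither regularity nor a limit.\<close>
    also have "\<dots> \<le> ?R"
    proof (intro sum_mono mult_left_mono)
      fix j assume j: "j \<in> J"
      show "0 \<le> d j" using d_pos[OF j] by simp
      interpret coisometry "\<lambda>z. Q j (A z)" "F j" using j by (rule coisometry_Q)
      note m [measurable] = \<psi>[OF j]
      let ?g = "\<lambda>y. exp (\<psi> j y)"
      have g: "?g y \<in> {exp (- B)..exp B}" for y
        using \<psi>B[OF j, of y] by (simp add: abs_le_iff minus_le_iff)
      have int\<psi>: "integrable gauss (\<lambda>z. \<psi> j (y + b *\<^sub>R Q j (A z)))" for y b
        by (rule gauss_integrable_bounded[where C=B]) (use \<psi>B[OF j] in auto)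
      have intg: "integrable gauss (\<lambda>z. exp (\<psi> j (y + b *\<^sub>R Q j (A z))))" for y b
        by (rule gauss_integrable_bounded[where C="exp B"]) (use g in auto)
      have "heatQ j (1 - \<tau> n) (\<lambda>y. exp (heatQ j (\<tau> n) (\<psi> j) y)) 0 \<le> heatQ j (1 - \<tau> n) (heatQ j (\<tau> n) ?g) 0"
        unfolding heat_def[of _ "1 - \<tau> n"]
      proof (rule Bochner_Integration.integral_mono)
        show "integrable gauss (\<lambda>z. exp (heatQ j (\<tau> n) (\<psi> j) (0 + sqrt (1 - \<tau> n) *\<^sub>R Q j (A z))))"
          by (rule gauss_integrable_bounded[where C="exp B"]) (use heatQ_B[OF j] in \<open>auto simp: abs_le_iff\<close>)
        have "\<bar>heatQ j (\<tau> n) ?g y\<bar> \<le> exp B" for y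
        proof -
          have "heatQ j (\<tau> n) ?g y \<in> {exp (- B)..exp B}"
            by (rule heat_bounds[OF _ g]) simp
          then have "exp (- B) \<le> heatQ j (\<tau> n) ?g y" "heatQ j (\<tau> n) ?g y \<le> exp B" by simp_all
          then show ?thesis using exp_gt_zero[of "- B"] by linarith
        qed
        then show "integrable gauss (\<lambda>z. heatQ j (\<tau> n) ?g (0 + sqrt (1 - \<tau> n) *\<^sub>R Q j (A z)))"
          by (intro gauss_integrable_bounded[where C="exp B"]) auto
        show "exp (heatQ j (\<tau> n) (\<psi> j) (0 + sqrt (1 - \<tau> n) *\<^sub>R Q j (A z)))
          \<le> heatQ j (\<tau> n) ?g (0 + sqrt (1 - \<tau> n) *\<^sub>R Q j (A z))" for z
          unfolding heat_def by (rule gauss_jensen_exp[OF int\<psi> intg])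
      qed
      also have "\<dots> = heatQ j 1 ?g 0"
        using heat_heat[of ?g "exp B" "1 - \<tau> n" "\<tau> n" 0] g \<tau>[of n] by (simp add: less_imp_le)
      finally have le: "heatQ j (1 - \<tau> n) (\<lambda>y. exp (heatQ j (\<tau> n) (\<psi> j) y)) 0 \<le> heatQ j 1 ?g 0" .
      have "exp (- B) \<le> heatQ j (1 - \<tau> n) (\<lambda>y. exp (heatQ j (\<tau> n) (\<psi> j) y)) 0"
        using heat_bounds[of "\<lambda>y. exp (heatQ j (\<tau> n) (\<psi> j) y)" "exp (- B)" "exp B" "1 - \<tau> n" 0] heatQ_B[OF j]
        by (auto simp: abs_le_iff minus_le_iff)
      then have "0 < heatQ j (1 - \<tau> n) (\<lambda>y. exp (heatQ j (\<tau> n) (\<psi> j) y)) 0"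
        by (rule less_le_trans[OF exp_gt_zero])
      with le show "ln (heatQ j (1 - \<tau> n) (\<lambda>y. exp (heatQ j (\<tau> n) (\<psi> j) y)) 0) \<le> ln (heatQ j 1 ?g 0)"
        by (simp add: ln_mono)
    qed
    finally show ?thesis .
  qed
  moreover have "?L \<longlonglongrightarrow> (\<Sum>i\<in>I. c i * ln (heatP i 1 (\<lambda>x. exp (\<phi> i x)) 0))"
  proof (intro tendsto_sum tendsto_mult tendsto_const tendsto_ln)
    fix i assume i: "i \<in> I"
    interpret coisometry "\<lambda>z. P i (A z)" "E i" using i by (rule coisometry_P)
    note m [measurable] = \<phi>[OF i]
    show "(\<lambda>n. heatP i (1 - \<tau> n) (\<lambda>x. exp (heatP i (\<tau> n) (\<phi> i) x)) 0) \<longlonglongrightarrow> heatP i 1 (\<lambda>x. exp (\<phi> i x)) 0"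
      by (rule heat_exp_heat_tendsto[OF m \<phi>B[OF i]]) (use \<tau> \<tau>lim in \<open>auto simp: less_imp_le\<close>)
    have "exp (- B) \<le> heatP i 1 (\<lambda>x. exp (\<phi> i x)) 0"
      using heat_bounds[of "\<lambda>x. exp (\<phi> i x)" "exp (- B)" "exp B" 1 0] \<phi>B[OF i]
      by (auto simp: abs_le_iff minus_le_iff)
    then show "heatP i 1 (\<lambda>x. exp (\<phi> i x)) 0 \<noteq> 0"
      using exp_gt_zero[of "- B"] by linarith
  qed
  ultimately have "(\<Sum>i\<in>I. c i * ln (heatP i 1 (\<lambda>x. exp (\<phi> i x)) 0)) \<le> ?R"
    by (intro LIMSEQ_le_const2) auto
  then show ?thesis by (simp add: heat_def)
qed

end

section \<open>From Gaussian to Lebesgue measure\<close>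

text \<open>Left unnormalised on purpose: the weight is at most \<open>1\<close> and increases to
  \<open>1\<close> with \<open>R\<close>, so monotone convergence leads to the Lebesgue
  integral.\<close>

definition gauss_mass :: "'c::euclidean_space set \<Rightarrow> real \<Rightarrow> ('c \<Rightarrow> real) \<Rightarrow> ennreal" where
  "gauss_mass S R f = (\<integral>\<^sup>+y. ennreal (exp (- (y \<bullet> y) / (2 * R\<^sup>2))) * ennreal (f y) \<partial>lebesgue_subspace S)"

lemma borel_measurable_lebesgue_subspace:
  assumes [measurable]: "f \<in> borel_measurable borel"
  shows "f \<in> borel_measurable (lebesgue_subspace S)"
  unfolding lebesgue_subspace_def Let_def
  by (rule measurable_completion) (simp add: measurable_restrict_space1)

text \<open>The pointwise hypothesis has to hold at every point, and an almost everywhere Borel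
  version could destroy it. A Borel minorant and a Borel majorant preserve it on the two sides
  without changing the integrals.\<close>

lemma lebesgue_subspace_borel_bounds:
  assumes S: "subspace S" and f: "f \<in> borel_measurable (lebesgue_subspace S)"
    and range: "\<And>y. y \<in> S \<Longrightarrow> f y \<in> {lo..hi::real}"
  shows "\<exists>f1 f2. f1 \<in> borel_measurable borel \<and> f2 \<in> borel_measurable borel
    \<and> (\<forall>y. f1 y \<in> {lo..hi} \<and> f2 y \<in> {lo..hi}) \<and> (\<forall>y\<in>S. f1 y \<le> f y \<and> f y \<le> f2 y)
    \<and> (AE y in lebesgue_subspace S. f1 y = f y \<and> f2 y = f y)"
proof -
  define M where "M = (let B = (SOME B. orthonormal_basis_of S B)
      in distr (\<Pi>\<^sub>M b\<in>B. lborel) (restrict_space borel S) (\<lambda>t. \<Sum>b\<in>B. t b *\<^sub>R b))"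
  have leb: "lebesgue_subspace S = completion M"
    by (simp add: lebesgue_subspace_def M_def Let_def)
  have sets_M: "sets M = sets (restrict_space borel S)" and space_M: "space M = S"
    by (simp_all add: M_def Let_def space_restrict_space)
  have S_borel: "S \<in> sets borel" by (rule borel_closed[OF closed_subspace[OF S]])
  have "lo \<le> hi" using range[OF subspace_0[OF S]] by simp
  obtain f' where f': "f' \<in> borel_measurable M" "AE y in M. f y = f' y"
    using completion_ex_borel_measurable_real[OF f[unfolded leb]] by blast
  then obtain N where N: "N \<in> null_sets M" "{y \<in> space M. f y \<noteq> f' y} \<subseteq> N"
    by (auto simp: eventually_ae_filter)
  have [measurable]: "N \<in> sets borel"
    using N(1) S_borel by (auto simp: null_sets_def sets_M sets_restrict_space_iff)
  have m: "(\<lambda>y. if y \<in> S then f' y else c) \<in> borel_measurable borel" for c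
    using f'(1) S_borel measurable_cong_sets[OF sets_M refl, of borel]
    by (subst measurable_restrict_space_iff[symmetric]) auto
  \<comment> \<open>Off \<open>S\<close> and on a Borel null set containing the exceptional points
    the value is the constant \<open>c\<close>; the choices \<open>lo\<close> and \<open>hi\<close>
    give the minorant and the majorant.\<close>
  define fc where "fc c y = (if y \<in> N then c else if y \<in> S then f' y else c)" for c y
  have "fc c \<in> borel_measurable borel" for c
    unfolding fc_def using m[of c] by measurable
  moreover have eq: "fc c y = f y" if "y \<in> S" "y \<notin> N" for c y
    using that N(2) by (auto simp: fc_def space_M)
  have out: "fc c y = c" if "\<not> (y \<in> S \<and> y \<notin> N)" for c y
    using that by (auto simp: fc_def)
  have "fc lo y \<in> {lo..hi} \<and> fc hi y \<in> {lo..hi}" for y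
    using range[of y] eq[of y] out[of y] \<open>lo \<le> hi\<close> by (cases "y \<in> S \<and> y \<notin> N") auto
  moreover have "fc lo y \<le> f y \<and> f y \<le> fc hi y" if "y \<in> S" for y
    using range[OF that] eq[of y] out[of y] by (cases "y \<in> S \<and> y \<notin> N") auto
  moreover have "AE y in lebesgue_subspace S. y \<notin> N"
    using N(1) unfolding leb by (intro AE_completion AE_not_in)
  then have "AE y in lebesgue_subspace S. fc lo y = f y \<and> fc hi y = f y"
    using AE_space by eventually_elim (simp add: eq)
  ultimately show ?thesis by blast
qed

context coisometry begin

lemma gauss_mass_eq:
  assumes f: "f \<in> borel_measurable (lebesgue_subspace S)" and f': "f' \<in> borel_measurable borel"
    and AE: "AE y in lebesgue_subspace S. f' y = f y"
    and nonneg: "\<And>y. 0 \<le> f' y" "\<And>y. f' y \<le> hi" and "0 < R"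
  shows "gauss_mass S R f = ennreal ((\<integral>z. f' (R *\<^sub>R T z) \<partial>gauss) * (sqrt (2 * pi) * R) ^ dim S)"
proof -
  note [measurable] = f'
  have "gauss_mass S R f = (\<integral>\<^sup>+y. ennreal (exp (- (y \<bullet> y) / (2 * R\<^sup>2))) * ennreal (f' y) \<partial>lebesgue_subspace S)"
    unfolding gauss_mass_def by (rule nn_integral_cong_AE) (use AE in eventually_elim, simp)
  also have "\<dots> = (\<integral>\<^sup>+z. ennreal (f' (R *\<^sub>R T z)) \<partial>gauss) * ennreal (sqrt (2 * pi) * R) ^ dim S"
    by (rule law[symmetric]) (use \<open>0 < R\<close> in auto)
  also have "(\<integral>\<^sup>+z. ennreal (f' (R *\<^sub>R T z)) \<partial>gauss) = ennreal (\<integral>z. f' (R *\<^sub>R T z) \<partial>gauss)"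
    by (rule nn_integral_eq_integral[OF gauss_integrable_bounded[where C=hi]]) (use nonneg in auto)
  finally show ?thesis
    using \<open>0 < R\<close> nonneg by (simp add: ennreal_power ennreal_mult[symmetric])
qed

lemma gauss_mass_const:
  assumes "0 \<le> a" "0 < R"
  shows "gauss_mass S R (\<lambda>_. a) = ennreal (a * (sqrt (2 * pi) * R) ^ dim S)"
  by (subst gauss_mass_eq[of _ "\<lambda>_. a" a]) (use assms in auto)

end

text \<open>Makes both sides bounded and positive so that logarithms exist. A value
  \<open>a i\<close> below a tiny \<open>\<delta>\<close> forces the left side below every possible
  right side; a value \<open>b j\<close> above a huge \<open>M'\<close> forces the right side above
  every possible left side. Otherwise the left side is unchanged and the right side can only
  grow.\<close>

lemma truncation:
  fixes c :: "'i \<Rightarrow> real" and d :: "'j \<Rightarrow> real"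
  assumes fin: "finite I" "finite J"
    and c: "\<And>i. i \<in> I \<Longrightarrow> 0 < c i" and d: "\<And>j. j \<in> J \<Longrightarrow> 0 < d j"
    and "1 \<le> M" "0 < \<eta>" "\<eta> < 1"
  shows "\<exists>\<delta> M'. 0 < \<delta> \<and> \<delta> \<le> 1 \<and> 1 \<le> M' \<and> (\<forall>a b.
      (\<forall>i\<in>I. 0 \<le> a i \<and> a i \<le> M) \<longrightarrow> (\<forall>j\<in>J. 0 \<le> b j) \<longrightarrow>
      (\<Prod>i\<in>I. a i powr c i) \<le> (\<Prod>j\<in>J. b j powr d j) \<longrightarrow>
      (\<Prod>i\<in>I. max (a i) \<delta> powr c i) \<le> (\<Prod>j\<in>J. max (min (b j) M') \<eta> powr d j))"
proof -
  \<comment> \<open>\<open>C\<close> is the largest possible truncated left side and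
    \<open>D\<close> the smallest possible truncated right side; \<open>\<delta>\<close> and
    \<open>M'\<close> are chosen from them.\<close>
  define C where "C = (\<Prod>i\<in>I. M powr c i)"
  define D where "D = (\<Prod>j\<in>J. \<eta> powr d j)"
  have C1: "1 \<le> C" unfolding C_def using assms c by (intro prod_ge_1 ge_one_powr_ge_zero) (auto intro: less_imp_le)
  have D0: "0 < D" unfolding D_def using assms by (intro prod_pos) auto
  have "\<forall>\<^sub>F \<delta> in at_right 0. \<forall>i\<in>I. \<delta> powr c i * C \<le> D"
  proof (rule eventually_ball_finite[OF fin(1)], rule ballI)
    fix i assume "i \<in> I"
    have "((\<lambda>\<delta>::real. \<delta> powr c i * C) \<longlongrightarrow> 0 * C) (at_right 0)"
      using c[OF \<open>i \<in> I\<close>]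
      by (intro tendsto_mult tendsto_const tendsto_zero_powrI[OF tendsto_ident_at tendsto_const])
         (auto simp: eventually_at_right_less less_imp_le eventually_at_filter)
    then show "\<forall>\<^sub>F \<delta> in at_right 0. \<delta> powr c i * C \<le> D"
      using D0 by (intro eventually_mono[OF order_tendstoD(2)[of _ 0 _ D]]) auto
  qed
  then have "\<forall>\<^sub>F \<delta> in at_right 0. 0 < \<delta> \<and> \<delta> < 1 \<and> (\<forall>i\<in>I. \<delta> powr c i * C \<le> D)"
    using eventually_at_right_less[of "0::real"] eventually_at_right_real[OF zero_less_one[where 'a=real]]
    by eventually_elim auto
  then obtain \<delta> :: real where \<delta>: "0 < \<delta>" "\<delta> < 1" "\<And>i. i \<in> I \<Longrightarrow> \<delta> powr c i * C \<le> D"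
    by (auto dest: eventually_happens)
  have "\<forall>\<^sub>F M' in at_top. \<forall>j\<in>J. C / D \<le> M' powr d j"
  proof (rule eventually_ball_finite[OF fin(2)], rule ballI)
    fix j assume "j \<in> J"
    show "\<forall>\<^sub>F M' in at_top. C / D \<le> M' powr d j"
    proof (rule eventually_mono[OF eventually_ge_at_top[of "(C / D) powr (1 / d j)"]])
      fix M' assume "(C / D) powr (1 / d j) \<le> M'"
      then have "((C / D) powr (1 / d j)) powr d j \<le> M' powr d j"
        using d[OF \<open>j \<in> J\<close>] by (intro powr_mono2) auto
      then show "C / D \<le> M' powr d j"
        using d[OF \<open>j \<in> J\<close>] C1 D0 by (simp add: powr_powr)
    qed
  qed
  then have "\<forall>\<^sub>F M' in at_top. 1 \<le> M' \<and> (\<forall>j\<in>J. C / D \<le> M' powr d j)"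
    using eventually_ge_at_top[of "1::real"] by eventually_elim auto
  then obtain M' :: real where M': "1 \<le> M'" "\<And>j. j \<in> J \<Longrightarrow> C / D \<le> M' powr d j"
    by (auto dest: eventually_happens)
  have "(\<Prod>i\<in>I. max (a i) \<delta> powr c i) \<le> (\<Prod>j\<in>J. max (min (b j) M') \<eta> powr d j)" (is "?L \<le> ?R")
    if a: "\<And>i. i \<in> I \<Longrightarrow> 0 \<le> a i \<and> a i \<le> M" and b: "\<And>j. j \<in> J \<Longrightarrow> 0 \<le> b j"
      and le: "(\<Prod>i\<in>I. a i powr c i) \<le> (\<Prod>j\<in>J. b j powr d j)" for a b
  proof -
    have powrM: "max (a i) \<delta> powr c i \<le> M powr c i" if "i \<in> I" for i
      using a[OF that] c[OF that] \<delta> assms by (intro powr_mono2) auto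
    have M1: "1 \<le> M powr c i" if "i \<in> I" for i
      using c[OF that] assms by (intro ge_one_powr_ge_zero) auto
    have \<eta>le: "\<eta> powr d j \<le> max (min (b j) M') \<eta> powr d j" if "j \<in> J" for j
      using d[OF that] assms by (intro powr_mono2) auto
    have \<eta>1: "\<eta> powr d j \<le> 1" if "j \<in> J" for j
      using d[OF that] assms by (intro powr_le1) auto
    consider i where "i \<in> I" "a i < \<delta>" | j where "j \<in> J" "M' < b j" "\<And>i. i \<in> I \<Longrightarrow> \<delta> \<le> a i"
      | "\<And>i. i \<in> I \<Longrightarrow> \<delta> \<le> a i" "\<And>j. j \<in> J \<Longrightarrow> b j \<le> M'"
      by (meson not_le)
    then show ?thesis
    proof cases
      case 1
      have "?L = \<delta> powr c i * (\<Prod>i\<in>I - {i}. max (a i) \<delta> powr c i)"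
        using 1 fin by (subst prod.remove[of _ i]) auto
      also have "\<dots> \<le> \<delta> powr c i * (\<Prod>i\<in>I - {i}. M powr c i)"
        by (intro mult_left_mono prod_mono) (use powrM in auto)
      also have "\<dots> \<le> \<delta> powr c i * C"
        unfolding C_def using 1 fin M1 by (intro mult_left_mono prod_mono2) auto
      also have "\<dots> \<le> D" by (rule \<delta>(3)[OF 1(1)])
      also have "\<dots> \<le> ?R"
        unfolding D_def by (intro prod_mono) (use \<eta>le in auto)
      finally show ?thesis .
    next
      case 2
      have "?L \<le> C"
        unfolding C_def by (intro prod_mono) (use powrM in auto)
      also have "\<dots> \<le> M' powr d j * D"
        using M'(2)[OF 2(1)] D0 by (simp add: pos_divide_le_eq)
      also have "\<dots> \<le> M' powr d j * (\<Prod>j\<in>J - {j}. \<eta> powr d j)"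
      proof (rule mult_left_mono)
        have "D = \<eta> powr d j * (\<Prod>j\<in>J - {j}. \<eta> powr d j)"
          unfolding D_def using 2 fin by (subst prod.remove[of _ j]) auto
        also have "\<dots> \<le> 1 * (\<Prod>j\<in>J - {j}. \<eta> powr d j)"
          by (intro mult_right_mono \<eta>1 prod_nonneg) (use 2 in auto)
        finally show "D \<le> (\<Prod>j\<in>J - {j}. \<eta> powr d j)" by simp
      qed simp
      also have "\<dots> \<le> M' powr d j * (\<Prod>j\<in>J - {j}. max (min (b j) M') \<eta> powr d j)"
        by (intro mult_left_mono prod_mono) (use \<eta>le in auto)
      also have "\<dots> = ?R"
      proof -
        have "max (min (b j) M') \<eta> = M'" using 2 M'(1) assms by auto
        then show ?thesis using 2 fin by (subst (2) prod.remove[of _ j]) auto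
      qed
      finally show ?thesis .
    next
      case 3
      have "?L = (\<Prod>i\<in>I. a i powr c i)"
        using 3(1) by (intro prod.cong) (auto simp: max_absorb1)
      also have "\<dots> \<le> (\<Prod>j\<in>J. b j powr d j)" by (rule le)
      also have "\<dots> \<le> ?R"
        using 3(2) b d by (intro prod_mono conjI powr_mono2) (auto intro: less_imp_le)
      finally show ?thesis .
    qed
  qed
  then show ?thesis
    using \<delta> M' by (intro exI[of _ \<delta>] exI[of _ M']) (auto simp: less_imp_le)
qed

section \<open>Linear algebra of the covariance and of the orthogonal projections\<close>

lemma psd_iff_inner:
  "psd \<Sigma> \<longleftrightarrow> linear \<Sigma> \<and> (\<forall>x y. \<Sigma> x \<bullet> y = x \<bullet> \<Sigma> y) \<and> (\<forall>x. 0 \<le> \<Sigma> x \<bullet> x)"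
  unfolding psd_def self_adjoint_def
  by (metis adjoint_unique adjoint_works inner_commute)

text \<open>Cauchy--Schwarz for the possibly degenerate form of \<open>\<Sigma>\<close>, by
  evaluating the nonnegative quadratic in \<open>s\<close> and \<open>t\<close>.\<close>

lemma psd_inner_square_le:
  assumes "psd \<Sigma>"
  shows "(\<Sigma> x \<bullet> y)\<^sup>2 \<le> (\<Sigma> x \<bullet> x) * (\<Sigma> y \<bullet> y)"
proof -
  have lin: "linear \<Sigma>" and sym: "\<Sigma> x \<bullet> y = x \<bullet> \<Sigma> y" and nn: "0 \<le> \<Sigma> x \<bullet> x" for x y
    using assms by (auto simp: psd_iff_inner)
  define a where "a = \<Sigma> x \<bullet> x"
  define b where "b = \<Sigma> x \<bullet> y"
  define c where "c = \<Sigma> y \<bullet> y"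
  have quad: "0 \<le> s\<^sup>2 * a + 2 * s * t * b + t\<^sup>2 * c" for s t
  proof -
    have "\<Sigma> y \<bullet> x = b" using sym[of y x] by (simp add: b_def inner_commute)
    then have "\<Sigma> (s *\<^sub>R x + t *\<^sub>R y) \<bullet> (s *\<^sub>R x + t *\<^sub>R y) = s\<^sup>2 * a + 2 * s * t * b + t\<^sup>2 * c"
      by (simp add: linear_add[OF lin] linear_scale[OF lin] inner_add_left inner_add_right a_def b_def c_def
          power2_eq_square algebra_simps)
    then show ?thesis using nn[of "s *\<^sub>R x + t *\<^sub>R y"] by simp
  qed
  have "0 \<le> a" "0 \<le> c" using nn by (auto simp: a_def c_def)
  show ?thesis
  proof (cases "c = 0")
    case True
    have "b = 0"
    proof (rule ccontr)
      assume "b \<noteq> 0"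
      \<comment> \<open>With \<open>c = 0\<close> the form is linear in \<open>t\<close>, and at
        \<open>s = 1\<close> this \<open>t\<close> gives it the value \<open>-1\<close>.\<close>
      then have "2 * 1 * (- (a + 1) / (2 * b)) * b = - (a + 1)" by simp
      then show False using quad[of 1 "- (a + 1) / (2 * b)"] True by simp
    qed
    then show ?thesis using \<open>0 \<le> a\<close> \<open>0 \<le> c\<close> by (simp add: a_def[symmetric] b_def[symmetric] c_def[symmetric])
  next
    case False
    then have "0 < c" using \<open>0 \<le> c\<close> by simp
    have "0 \<le> c * (c * a - b\<^sup>2)"
      using quad[of c "- b"] by (simp add: power2_eq_square algebra_simps)
    then have "b\<^sup>2 \<le> a * c" using \<open>0 < c\<close> by (simp add: zero_le_mult_iff mult.commute)
    then show ?thesis by (simp add: a_def b_def c_def)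
  qed
qed

text \<open>Cholesky elimination, one basis vector at a time.\<close>
lemma psd_factorization:
  fixes \<Sigma> :: "'a::euclidean_space \<Rightarrow> 'a"
  assumes "psd \<Sigma>"
  shows "\<exists>A :: 'a \<Rightarrow> 'a. linear A \<and> (\<forall>x. A (adjoint A x) = \<Sigma> x)"
proof -
  have "\<exists>a \<Sigma>'. psd \<Sigma>' \<and> (\<forall>b\<in>D. \<Sigma>' b = 0) \<and> (\<forall>x. \<Sigma> x = (\<Sum>b\<in>D. (a b \<bullet> x) *\<^sub>R a b) + \<Sigma>' x)"
    if "finite D" for D :: "'a set"
    using that
  proof induction
    case empty
    show ?case using assms by (intro exI[of _ "\<lambda>_. 0"] exI[of _ \<Sigma>]) simp
  next
    case (insert b D)
    then obtain a \<Sigma>' where psd': "psd \<Sigma>'" and ker: "\<And>b. b \<in> D \<Longrightarrow> \<Sigma>' b = 0"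
      and \<Sigma>: "\<And>x. \<Sigma> x = (\<Sum>b\<in>D. (a b \<bullet> x) *\<^sub>R a b) + \<Sigma>' x" by blast
    have lin: "linear \<Sigma>'" and sym: "\<Sigma>' x \<bullet> y = x \<bullet> \<Sigma>' y" and nn: "0 \<le> \<Sigma>' x \<bullet> x" for x y
      using psd' by (auto simp: psd_iff_inner)
    \<comment> \<open>The next Cholesky column. If the pivot \<open>\<Sigma>' b \<bullet> b\<close>
      vanishes, division by zero yields \<open>v = 0\<close> and nothing is subtracted.\<close>
    define v where "v = (1 / sqrt (\<Sigma>' b \<bullet> b)) *\<^sub>R \<Sigma>' b"
    define \<Sigma>'' where "\<Sigma>'' x = \<Sigma>' x - (v \<bullet> x) *\<^sub>R v" for x
    have sum: "(\<Sum>b'\<in>insert b D. ((a(b := v)) b' \<bullet> x) *\<^sub>R (a(b := v)) b') = (v \<bullet> x) *\<^sub>R v + (\<Sum>b\<in>D. (a b \<bullet> x) *\<^sub>R a b)" for x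
      using insert.hyps by (simp, intro sum.cong) auto
    have vv: "(v \<bullet> x) *\<^sub>R v = ((\<Sigma>' b \<bullet> x) / (\<Sigma>' b \<bullet> b)) *\<^sub>R \<Sigma>' b" for x
      using nn[of b] by (simp add: v_def field_simps flip: real_sqrt_mult)
    have "psd \<Sigma>''"
      unfolding psd_iff_inner
    proof (intro conjI allI)
      show "linear \<Sigma>''"
        unfolding \<Sigma>''_def
        by (intro linear_compose_sub lin linearI) (auto simp: inner_add_right algebra_simps)
      show "\<Sigma>'' x \<bullet> y = x \<bullet> \<Sigma>'' y" for x y
        by (simp add: \<Sigma>''_def inner_diff_left inner_diff_right sym inner_commute[of x v])
      show "0 \<le> \<Sigma>'' x \<bullet> x" for x
      proof (cases "\<Sigma>' b \<bullet> b = 0")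
        case True
        then show ?thesis using nn[of x] by (simp add: \<Sigma>''_def v_def)
      next
        case False
        then have "0 < \<Sigma>' b \<bullet> b" using nn[of b] by simp
        then have "(\<Sigma>' b \<bullet> x) * (\<Sigma>' b \<bullet> x) / (\<Sigma>' b \<bullet> b) \<le> \<Sigma>' x \<bullet> x"
          using psd_inner_square_le[OF psd', of b x] by (simp add: power2_eq_square pos_divide_le_eq mult.commute)
        then show ?thesis by (simp add: \<Sigma>''_def vv inner_diff_left)
      qed
    qed
    moreover have "\<Sigma>'' b' = 0" if "b' \<in> insert b D" for b'
    proof (cases "b' = b")
      case True
      show ?thesis
      proof (cases "\<Sigma>' b \<bullet> b = 0")
        case True
        \<comment> \<open>A vanishing pivot forces the whole column \<open>\<Sigma>' b\<close> to
          vanish, so \<open>b\<close> is already eliminated.\<close>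
        then have "(\<Sigma>' b \<bullet> \<Sigma>' b)\<^sup>2 \<le> 0"
          using psd_inner_square_le[OF psd', of b "\<Sigma>' b"] by simp
        then have "\<Sigma>' b = 0" by simp
        then show ?thesis using \<open>b' = b\<close> by (simp add: \<Sigma>''_def vv)
      qed (simp add: \<Sigma>''_def vv \<open>b' = b\<close>)
    next
      case False
      then have "\<Sigma>' b' = 0" using that ker by simp
      moreover have "\<Sigma>' b \<bullet> b' = 0" using sym[of b b'] \<open>\<Sigma>' b' = 0\<close> by simp
      ultimately show ?thesis by (simp add: \<Sigma>''_def vv)
    qed
    moreover have "\<Sigma> x = (\<Sum>b'\<in>insert b D. ((a(b := v)) b' \<bullet> x) *\<^sub>R (a(b := v)) b') + \<Sigma>'' x" for x
      unfolding sum \<Sigma> \<Sigma>''_def by simp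
    ultimately show ?case by blast
  qed
  from this[OF finite_Basis] obtain a :: "'a \<Rightarrow> 'a" and \<Sigma>' where
    *: "psd \<Sigma>' \<and> (\<forall>b\<in>Basis. \<Sigma>' b = 0) \<and> (\<forall>x. \<Sigma> x = (\<Sum>b\<in>Basis. (a b \<bullet> x) *\<^sub>R a b) + \<Sigma>' x)"
    by (elim exE)
  then have psd': "psd \<Sigma>'" and ker: "\<And>b. b \<in> Basis \<Longrightarrow> \<Sigma>' b = 0"
    and \<Sigma>: "\<And>x. \<Sigma> x = (\<Sum>b\<in>Basis. (a b \<bullet> x) *\<^sub>R a b) + \<Sigma>' x" by auto
  have "\<Sigma>' x = 0" for x
  proof -
    have "linear \<Sigma>'" using psd' by (simp add: psd_iff_inner)
    then have "\<Sigma>' (\<Sum>b\<in>Basis. (x \<bullet> b) *\<^sub>R b) = 0"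
      by (simp add: linear_sum linear_scale ker)
    then show ?thesis by (simp add: euclidean_representation)
  qed
  \<comment> \<open>The matrix with columns \<open>a b\<close>; composed with its adjoint it is the
    sum of the rank one terms.\<close>
  define A where "A z = (\<Sum>b\<in>Basis. (z \<bullet> b) *\<^sub>R a b)" for z :: 'a
  have "linear A"
    unfolding A_def by (intro linear_compose_sum ballI linearI) (auto simp: inner_add_left algebra_simps)
  moreover have "adjoint A = (\<lambda>x. \<Sum>b\<in>Basis. (a b \<bullet> x) *\<^sub>R b)"
    by (rule adjoint_unique) (simp add: A_def inner_sum_left inner_sum_right mult.commute)
  then have "A (adjoint A x) = \<Sigma> x" for x
    by (simp add: A_def \<Sigma> \<open>\<And>x. \<Sigma>' x = 0\<close>)
  ultimately show ?thesis by blast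
qed

lemma orth_proj_inner:
  assumes "subspace S"
  shows "z \<in> S \<Longrightarrow> orth_proj S x \<bullet> z = x \<bullet> z" "orth_proj S x \<bullet> y = x \<bullet> orth_proj S y"
proof -
  show *: "orth_proj S x \<bullet> z = x \<bullet> z" if "z \<in> S" for x z
    using orth_proj(2)[OF assms that, of x] by (simp add: inner_diff_left)
  show "orth_proj S x \<bullet> y = x \<bullet> orth_proj S y"
    using *[OF orth_proj(1)[OF assms], of x y] *[OF orth_proj(1)[OF assms], of y x]
    by (simp add: inner_commute)
qed

lemma linear_orth_proj:
  assumes "subspace S"
  shows "linear (orth_proj S)"
proof (rule linearI)
  note S = orth_proj(1)[OF assms] orth_proj_inner(1)[OF assms]
  show "orth_proj S (x + y) = orth_proj S x + orth_proj S y" for x y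
    by (rule orth_proj_unique[OF assms])
      (auto simp: S subspace_add[OF assms] inner_diff_left inner_add_left)
  show "orth_proj S (r *\<^sub>R x) = r *\<^sub>R orth_proj S x" for r x
    by (rule orth_proj_unique[OF assms])
      (auto simp: S subspace_scale[OF assms] inner_diff_left)
qed

text \<open>The adjoint of the projected \<open>A\<close> is \<open>adjoint A\<close> after the
  projection, so the claim is that \<open>\<Sigma>\<close> compressed to \<open>E i\<close> is the
  identity. Only its quadratic form on \<open>E i\<close> is given.\<close>

lemma coisometry_coupling_id:
  fixes E :: "'i \<Rightarrow> 'a::euclidean_space set"
  assumes "\<Sigma> \<in> coupling_id I E" "i \<in> I" "subspace (E i)"
    and A: "linear A" "\<And>x. A (adjoint A x) = \<Sigma> x"
  shows "coisometry (\<lambda>z. orth_proj (E i) (A z)) (E i)"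
proof (rule coisometry.intro)
  have psd: "psd \<Sigma>" and id: "\<And>x. x \<in> E i \<Longrightarrow> \<Sigma> x \<bullet> x = x \<bullet> x"
    using assms by (auto simp: coupling_id_def)
  then have lin: "linear \<Sigma>" and sym: "\<Sigma> x \<bullet> y = x \<bullet> \<Sigma> y" for x y
    by (auto simp: psd_iff_inner)
  note proj = orth_proj(1)[OF assms(3)]
  have linT: "linear (\<lambda>z. orth_proj (E i) (A z))"
    using linear_compose[OF A(1) linear_orth_proj[OF assms(3)]] by (simp add: o_def)
  then show "linear (\<lambda>z. orth_proj (E i) (A z))" .
  have adj: "adjoint (\<lambda>z. orth_proj (E i) (A z)) = (\<lambda>y. adjoint A (orth_proj (E i) y))"
    by (rule adjoint_unique) (simp add: orth_proj_inner(2)[OF assms(3)] adjoint_works[OF A(1)])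
  show "orth_proj (E i) (A z) \<in> E i" for z by (rule proj)
  fix y assume y: "y \<in> E i"
  then have "orth_proj (E i) y = y" by (intro orth_proj_unique assms) auto
  moreover have "orth_proj (E i) (\<Sigma> y) = y"
  proof (rule orth_proj_unique[OF assms(3) y], rule ballI)
    fix z assume z: "z \<in> E i"
    \<comment> \<open>Polarisation recovers the bilinear identity from the quadratic one.\<close>
    have "\<Sigma> (y + z) \<bullet> (y + z) = (y + z) \<bullet> (y + z)"
      using id[OF subspace_add[OF assms(3) y z]] .
    moreover have "\<Sigma> z \<bullet> y = \<Sigma> y \<bullet> z"
      using sym[of z y] by (simp add: inner_commute)
    ultimately have "\<Sigma> y \<bullet> z = y \<bullet> z"
      using id[OF y] id[OF z]
      by (simp add: linear_add[OF lin] inner_add_left inner_add_right inner_commute[of z y])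
    then show "(\<Sigma> y - y) \<bullet> z = 0" by (simp add: inner_diff_left)
  qed
  ultimately show "orth_proj (E i) (A (adjoint (\<lambda>z. orth_proj (E i) (A z)) y)) = y"
    by (simp add: adj A(2))
qed (fact assms)

text \<open>Composing \<open>Q\<close> after \<open>A\<close> with its adjoint gives
  \<open>Q\<close> after \<open>\<Sigma>\<close> after \<open>adjoint Q\<close>, so the covariance
  hypothesis on \<open>Q\<close> is the coisometry condition.\<close>

lemma coisometry_comp:
  fixes A :: "'a::euclidean_space \<Rightarrow> 'x::euclidean_space" and Q :: "'x \<Rightarrow> 'b::euclidean_space"
  assumes "linear Q" "range Q \<subseteq> F" "subspace F" "\<And>y. y \<in> F \<Longrightarrow> Q (\<Sigma> (adjoint Q y)) = y"
    and A: "linear A" "\<And>x. A (adjoint A x) = \<Sigma> x"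
  shows "coisometry (\<lambda>z. Q (A z)) F"
proof (rule coisometry.intro)
  show "linear (\<lambda>z. Q (A z))"
    using linear_compose[OF A(1) assms(1)] by (simp add: o_def)
  have "adjoint (\<lambda>z. Q (A z)) = (\<lambda>y. adjoint A (adjoint Q y))"
    by (rule adjoint_unique) (simp add: adjoint_works[OF A(1)] adjoint_works[OF assms(1)])
  then show "Q (A (adjoint (\<lambda>z. Q (A z)) y)) = y" if "y \<in> F" for y
    using assms(4)[OF that] by (simp add: A(2))
qed (use assms in auto)

lemma orthogonal_direct_sum_lift:
  assumes E: "orthogonal_direct_sum I E" and "finite I" and u: "\<And>i. i \<in> I \<Longrightarrow> u i \<in> E i"
  shows "\<exists>x. \<forall>i\<in>I. orth_proj (E i) x = u i"
proof (intro exI ballI)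
  fix i assume i: "i \<in> I"
  have "(\<Sum>i'\<in>I. u i') - u i = (\<Sum>i'\<in>I - {i}. u i')"
    using assms(2) i by (simp add: sum_diff1)
  moreover have "(\<Sum>i'\<in>I - {i}. u i') \<bullet> z = 0" if "z \<in> E i" for z
    unfolding inner_sum_left
  proof (intro sum.neutral ballI)
    fix i' assume "i' \<in> I - {i}"
    then show "u i' \<bullet> z = 0"
      using E u[of i'] i that unfolding orthogonal_direct_sum_def by blast
  qed
  ultimately show "orth_proj (E i) (\<Sum>i'\<in>I. u i') = u i"
    using E i u by (intro orth_proj_unique) (auto simp: orthogonal_direct_sum_def)
qed

lemma loewner_energy:
  fixes E :: "'i \<Rightarrow> 'a::euclidean_space set" and Q :: "'j \<Rightarrow> 'a \<Rightarrow> 'b::euclidean_space"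
  assumes le: "loewner_le (\<lambda>x. \<Sum>j\<in>J. d j *\<^sub>R adjoint (Q j) (Q j x)) (direct_sum_scaling I E c)"
    and E: "\<And>i. i \<in> I \<Longrightarrow> subspace (E i)" and Q: "\<And>j. j \<in> J \<Longrightarrow> linear (Q j)"
  shows "(\<Sum>j\<in>J. d j * (Q j x \<bullet> Q j x)) \<le> (\<Sum>i\<in>I. c i * (orth_proj (E i) x \<bullet> orth_proj (E i) x))"
proof -
  have "0 \<le> (direct_sum_scaling I E c x - (\<Sum>j\<in>J. d j *\<^sub>R adjoint (Q j) (Q j x))) \<bullet> x"
    using le by (simp add: loewner_le_def psd_def)
  moreover have "direct_sum_scaling I E c x \<bullet> x = (\<Sum>i\<in>I. c i * (orth_proj (E i) x \<bullet> orth_proj (E i) x))"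
    unfolding direct_sum_scaling_def inner_sum_left
    by (intro sum.cong) (auto simp: orth_proj_inner(1)[OF E orth_proj(1)[OF E]] inner_commute)
  moreover have "(\<Sum>j\<in>J. d j *\<^sub>R adjoint (Q j) (Q j x)) \<bullet> x = (\<Sum>j\<in>J. d j * (Q j x \<bullet> Q j x))"
    unfolding inner_sum_left by (intro sum.cong) (auto simp: adjoint_clauses(2)[OF Q])
  ultimately show ?thesis by (simp add: inner_diff_left)
qed

lemma prod_powr_eq_exp:
  fixes x p :: "'k \<Rightarrow> real"
  assumes "finite K" "\<And>i. i \<in> K \<Longrightarrow> 0 < x i"
  shows "(\<Prod>i\<in>K. x i powr p i) = exp (\<Sum>i\<in>K. p i * ln (x i))"
  unfolding exp_sum[OF assms(1)]
proof (intro prod.cong refl)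
  fix i assume "i \<in> K"
  from assms(2)[OF this] show "x i powr p i = exp (p i * ln (x i))"
    by (simp add: powr_def)
qed

context gaussian_coupling begin

text \<open>The Gaussian inequality for functions measurable in the completed sense:
  \<open>f\<close> is lowered to a Borel minorant and \<open>g\<close> raised to a Borel majorant,
  so the hypothesis is only weakened at null sets of points.\<close>

lemma gauss_mass_bounded:
  assumes f: "\<And>i. i \<in> I \<Longrightarrow> f i \<in> borel_measurable (lebesgue_subspace (E i))"
    and f_range: "\<And>i x. i \<in> I \<Longrightarrow> x \<in> E i \<Longrightarrow> f i x \<in> {lo..hi}"
    and g: "\<And>j. j \<in> J \<Longrightarrow> g j \<in> borel_measurable (lebesgue_subspace (F j))"
    and g_range: "\<And>j y. j \<in> J \<Longrightarrow> y \<in> F j \<Longrightarrow> g j y \<in> {lo..hi}"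
    and P_range: "\<And>i x. i \<in> I \<Longrightarrow> P i x \<in> E i"
    and lo: "0 < lo" and R: "0 < R"
    and le: "\<And>x. (\<Prod>i\<in>I. f i (P i x) powr c i) \<le> (\<Prod>j\<in>J. g j (Q j x) powr d j)"
  defines "\<kappa> \<equiv> sqrt (2 * pi) * R"
  shows "(\<Prod>i\<in>I. (enn2real (gauss_mass (E i) R (f i)) / \<kappa> ^ dim (E i)) powr c i)
    \<le> (\<Prod>j\<in>J. (enn2real (gauss_mass (F j) R (g j)) / \<kappa> ^ dim (F j)) powr d j)"
proof -
  have \<kappa>: "0 < \<kappa>" using R by (simp add: \<kappa>_def)
  have "\<forall>i\<in>I. \<exists>f'. f' \<in> borel_measurable borel \<and> (\<forall>x. f' x \<in> {lo..hi})
      \<and> (\<forall>x\<in>E i. f' x \<le> f i x) \<and> (AE x in lebesgue_subspace (E i). f' x = f i x)"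
  proof
    fix i assume i: "i \<in> I"
    from lebesgue_subspace_borel_bounds[OF coisometry.subspace[OF coisometry_P[OF i]] f[OF i] f_range[OF i]]
    show "\<exists>f'. f' \<in> borel_measurable borel \<and> (\<forall>x. f' x \<in> {lo..hi})
      \<and> (\<forall>x\<in>E i. f' x \<le> f i x) \<and> (AE x in lebesgue_subspace (E i). f' x = f i x)"
      by (auto elim: AE_mp)
  qed
  from bchoice[OF this] obtain f' where "\<forall>i\<in>I. f' i \<in> borel_measurable borel \<and> (\<forall>x. f' i x \<in> {lo..hi})
      \<and> (\<forall>x\<in>E i. f' i x \<le> f i x) \<and> (AE x in lebesgue_subspace (E i). f' i x = f i x)"
    by (elim exE)
  then have f': "\<And>i. i \<in> I \<Longrightarrow> f' i \<in> borel_measurable borel"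
    "\<And>i x. i \<in> I \<Longrightarrow> f' i x \<in> {lo..hi}" "\<And>i x. i \<in> I \<Longrightarrow> x \<in> E i \<Longrightarrow> f' i x \<le> f i x"
    "\<And>i. i \<in> I \<Longrightarrow> AE x in lebesgue_subspace (E i). f' i x = f i x" by blast+
  have "\<forall>j\<in>J. \<exists>g'. g' \<in> borel_measurable borel \<and> (\<forall>y. g' y \<in> {lo..hi})
      \<and> (\<forall>y\<in>F j. g j y \<le> g' y) \<and> (AE y in lebesgue_subspace (F j). g' y = g j y)"
  proof
    fix j assume j: "j \<in> J"
    from lebesgue_subspace_borel_bounds[OF coisometry.subspace[OF coisometry_Q[OF j]] g[OF j] g_range[OF j]]
    show "\<exists>g'. g' \<in> borel_measurable borel \<and> (\<forall>y. g' y \<in> {lo..hi})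
      \<and> (\<forall>y\<in>F j. g j y \<le> g' y) \<and> (AE y in lebesgue_subspace (F j). g' y = g j y)"
      by (auto elim: AE_mp)
  qed
  from bchoice[OF this] obtain g' where "\<forall>j\<in>J. g' j \<in> borel_measurable borel \<and> (\<forall>y. g' j y \<in> {lo..hi})
      \<and> (\<forall>y\<in>F j. g j y \<le> g' j y) \<and> (AE y in lebesgue_subspace (F j). g' j y = g j y)"
    by (elim exE)
  then have g': "\<And>j. j \<in> J \<Longrightarrow> g' j \<in> borel_measurable borel"
    "\<And>j y. j \<in> J \<Longrightarrow> g' j y \<in> {lo..hi}" "\<And>j y. j \<in> J \<Longrightarrow> y \<in> F j \<Longrightarrow> g j y \<le> g' j y"
    "\<And>j. j \<in> J \<Longrightarrow> AE y in lebesgue_subspace (F j). g' j y = g j y" by blast+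
  \<comment> \<open>Dilating the argument by \<open>R\<close> converts variance
    \<open>R\<^sup>2\<close> into variance one; by linearity of \<open>P i\<close> and
    \<open>Q j\<close> the hypothesis is then used at \<open>R *\<^sub>R x\<close>.\<close>
  define \<phi> where "\<phi> i x = ln (f' i (R *\<^sub>R x))" for i x
  define \<psi> where "\<psi> j y = ln (g' j (R *\<^sub>R y))" for j y
  have exp_ln_f: "exp (\<phi> i x) = f' i (R *\<^sub>R x)" if "i \<in> I" for i x
    using f'(2)[OF that, of "R *\<^sub>R x"] lo by (simp add: \<phi>_def)
  have exp_ln_g: "exp (\<psi> j y) = g' j (R *\<^sub>R y)" if "j \<in> J" for j y
    using g'(2)[OF that, of "R *\<^sub>R y"] lo by (simp add: \<psi>_def)
  have ln_bound: "\<bar>ln a\<bar> \<le> \<bar>ln lo\<bar> + \<bar>ln hi\<bar>" if "a \<in> {lo..hi}" for a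
  proof -
    have "ln lo \<le> ln a" "ln a \<le> ln hi" using that lo by auto
    then show ?thesis by linarith
  qed
  have "(\<Sum>i\<in>I. c i * ln (\<integral>z. exp (\<phi> i (P i (A z))) \<partial>gauss))
      \<le> (\<Sum>j\<in>J. d j * ln (\<integral>z. exp (\<psi> j (Q j (A z))) \<partial>gauss))"
  proof (rule gaussian_inequality)
    show "\<phi> i \<in> borel_measurable borel" if "i \<in> I" for i
      unfolding \<phi>_def using f'(1)[OF that] by measurable
    show "\<psi> j \<in> borel_measurable borel" if "j \<in> J" for j
      unfolding \<psi>_def using g'(1)[OF that] by measurable
    show "\<bar>\<phi> i x\<bar> \<le> \<bar>ln lo\<bar> + \<bar>ln hi\<bar>" if "i \<in> I" for i x
      unfolding \<phi>_def by (rule ln_bound[OF f'(2)[OF that]])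
    show "\<bar>\<psi> j y\<bar> \<le> \<bar>ln lo\<bar> + \<bar>ln hi\<bar>" if "j \<in> J" for j y
      unfolding \<psi>_def by (rule ln_bound[OF g'(2)[OF that]])
    fix x
    have scale: "R *\<^sub>R P i x = P i (R *\<^sub>R x)" if "i \<in> I" for i
      by (simp add: linear_scale[OF linear_P[OF that]])
    have scaleQ: "R *\<^sub>R Q j x = Q j (R *\<^sub>R x)" if "j \<in> J" for j
      by (simp add: linear_scale[OF linear_Q[OF that]])
    have "exp (\<Sum>i\<in>I. c i * \<phi> i (P i x)) = (\<Prod>i\<in>I. f' i (P i (R *\<^sub>R x)) powr c i)"
      using f'(2) lo finite by (subst prod_powr_eq_exp) (auto simp: \<phi>_def scale intro: less_le_trans)
    also have "\<dots> \<le> (\<Prod>i\<in>I. f i (P i (R *\<^sub>R x)) powr c i)"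
    proof (intro prod_mono conjI powr_mono2)
      fix i assume i: "i \<in> I"
      show "0 \<le> c i" using c_pos[OF i] by simp
      show "0 \<le> f' i (P i (R *\<^sub>R x))" using f'(2)[OF i] lo by (meson atLeastAtMost_iff less_imp_le order_trans)
      show "f' i (P i (R *\<^sub>R x)) \<le> f i (P i (R *\<^sub>R x))" by (rule f'(3)[OF i P_range[OF i]])
    qed simp
    also have "\<dots> \<le> (\<Prod>j\<in>J. g j (Q j (R *\<^sub>R x)) powr d j)" by (rule le)
    also have "\<dots> \<le> (\<Prod>j\<in>J. g' j (Q j (R *\<^sub>R x)) powr d j)"
    proof (intro prod_mono conjI powr_mono2)
      fix j assume j: "j \<in> J"
      show "0 \<le> d j" using d_pos[OF j] by simp
      show "0 \<le> g j (Q j (R *\<^sub>R x))"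
        using g_range[OF j Q_range[OF j]] lo by (meson atLeastAtMost_iff less_imp_le order_trans)
      show "g j (Q j (R *\<^sub>R x)) \<le> g' j (Q j (R *\<^sub>R x))" by (rule g'(3)[OF j Q_range[OF j]])
    qed simp
    also have "\<dots> = exp (\<Sum>j\<in>J. d j * \<psi> j (Q j x))"
      using g'(2) lo finite by (subst prod_powr_eq_exp) (auto simp: \<psi>_def scaleQ intro: less_le_trans)
    finally show "(\<Sum>i\<in>I. c i * \<phi> i (P i x)) \<le> (\<Sum>j\<in>J. d j * \<psi> j (Q j x))" by simp
  qed
  moreover have mf: "(\<integral>z. exp (\<phi> i (P i (A z))) \<partial>gauss) = enn2real (gauss_mass (E i) R (f i)) / \<kappa> ^ dim (E i)
      \<and> lo \<le> (\<integral>z. exp (\<phi> i (P i (A z))) \<partial>gauss)" if i: "i \<in> I" for i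
  proof -
    interpret coisometry "\<lambda>z. P i (A z)" "E i" using i by (rule coisometry_P)
    note [measurable] = f'(1)[OF i]
    have nn: "0 \<le> f' i y" "f' i y \<le> hi" for y
      using f'(2)[OF i, of y] lo by auto
    have "integrable gauss (\<lambda>z. f' i (R *\<^sub>R P i (A z)))"
      by (rule gauss_integrable_bounded[where C=hi]) (use nn in auto)
    then have "lo \<le> (\<integral>z. f' i (R *\<^sub>R P i (A z)) \<partial>gauss)"
      using f'(2)[OF i] by (intro gauss.integral_ge_const) auto
    moreover have "enn2real (gauss_mass (E i) R (f i)) = (\<integral>z. f' i (R *\<^sub>R P i (A z)) \<partial>gauss) * \<kappa> ^ dim (E i)"
      by (subst gauss_mass_eq[OF f[OF i] f'(1)[OF i] f'(4)[OF i] nn R])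
         (use nn \<kappa> in \<open>simp add: \<kappa>_def[symmetric]\<close>)
    ultimately show ?thesis using \<kappa> by (simp add: exp_ln_f[OF i])
  qed
  moreover have mg: "(\<integral>z. exp (\<psi> j (Q j (A z))) \<partial>gauss) = enn2real (gauss_mass (F j) R (g j)) / \<kappa> ^ dim (F j)
      \<and> lo \<le> (\<integral>z. exp (\<psi> j (Q j (A z))) \<partial>gauss)" if j: "j \<in> J" for j
  proof -
    interpret coisometry "\<lambda>z. Q j (A z)" "F j" using j by (rule coisometry_Q)
    note [measurable] = g'(1)[OF j]
    have nn: "0 \<le> g' j y" "g' j y \<le> hi" for y
      using g'(2)[OF j, of y] lo by auto
    have "integrable gauss (\<lambda>z. g' j (R *\<^sub>R Q j (A z)))"
      by (rule gauss_integrable_bounded[where C=hi]) (use nn in auto)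
    then have "lo \<le> (\<integral>z. g' j (R *\<^sub>R Q j (A z)) \<partial>gauss)"
      using g'(2)[OF j] by (intro gauss.integral_ge_const) auto
    moreover have "enn2real (gauss_mass (F j) R (g j)) = (\<integral>z. g' j (R *\<^sub>R Q j (A z)) \<partial>gauss) * \<kappa> ^ dim (F j)"
      by (subst gauss_mass_eq[OF g[OF j] g'(1)[OF j] g'(4)[OF j] nn R])
         (use nn \<kappa> in \<open>simp add: \<kappa>_def[symmetric]\<close>)
    ultimately show ?thesis using \<kappa> by (simp add: exp_ln_g[OF j])
  qed
  ultimately have "(\<Sum>i\<in>I. c i * ln (enn2real (gauss_mass (E i) R (f i)) / \<kappa> ^ dim (E i)))
      \<le> (\<Sum>j\<in>J. d j * ln (enn2real (gauss_mass (F j) R (g j)) / \<kappa> ^ dim (F j)))"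
    by simp
  moreover have "0 < enn2real (gauss_mass (E i) R (f i)) / \<kappa> ^ dim (E i)" if "i \<in> I" for i
    using mf[OF that] less_le_trans[OF lo] by metis
  moreover have "0 < enn2real (gauss_mass (F j) R (g j)) / \<kappa> ^ dim (F j)" if "j \<in> J" for j
    using mg[OF that] less_le_trans[OF lo] by metis
  ultimately show ?thesis
    using finite by (simp only: prod_powr_eq_exp exp_le_cancel_iff)
qed

end

section \<open>Removing the bounds and letting the variance grow\<close>

lemma gauss_mass_mono:
  assumes "\<And>y. y \<in> S \<Longrightarrow> f y \<le> g y"
  shows "gauss_mass S R f \<le> gauss_mass S R g"
  unfolding gauss_mass_def
  by (intro nn_integral_mono mult_left_mono) (simp_all add: assms ennreal_leI)

lemma gauss_mass_le_nn_integral: "gauss_mass S R f \<le> (\<integral>\<^sup>+y. ennreal (f y) \<partial>lebesgue_subspace S)"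
proof -
  have "ennreal (exp (- (y \<bullet> y) / (2 * R\<^sup>2))) * ennreal (f y) \<le> 1 * ennreal (f y)" for y :: 'a
  proof (rule mult_right_mono)
    have "exp (- (y \<bullet> y) / (2 * R\<^sup>2)) \<le> 1" by simp
    then show "ennreal (exp (- (y \<bullet> y) / (2 * R\<^sup>2))) \<le> 1"
      using ennreal_leI by fastforce
  qed simp
  then show ?thesis
    unfolding gauss_mass_def by (intro nn_integral_mono) simp
qed

text \<open>The Gaussian weight never vanishes, so only the null set where \<open>f\<close> is
  positive matters.\<close>

lemma gauss_mass_eq_0_iff:
  assumes f: "f \<in> borel_measurable (lebesgue_subspace S)"
  shows "gauss_mass S R f = 0 \<longleftrightarrow> (\<integral>\<^sup>+y. ennreal (f y) \<partial>lebesgue_subspace S) = 0"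
proof -
  have [measurable]: "(\<lambda>y. exp (- (y \<bullet> y) / (2 * R\<^sup>2))) \<in> borel_measurable (lebesgue_subspace S)"
    by (rule borel_measurable_lebesgue_subspace) measurable
  note [measurable] = f
  have m: "(\<lambda>y. ennreal (exp (- (y \<bullet> y) / (2 * R\<^sup>2))) * ennreal (f y)) \<in> borel_measurable (lebesgue_subspace S)"
    by measurable
  have m': "(\<lambda>y. ennreal (f y)) \<in> borel_measurable (lebesgue_subspace S)"
    by measurable
  show ?thesis
    unfolding gauss_mass_def nn_integral_0_iff_AE[OF m] nn_integral_0_iff_AE[OF m'] by simp
qed

text \<open>Truncation height and standard deviation grow together, so one monotone convergence
  argument removes both. The successor keeps the variance positive.\<close>

lemma gauss_mass_tendsto:
  assumes f: "f \<in> borel_measurable (lebesgue_subspace S)"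
  shows "(\<lambda>n. gauss_mass S (real (Suc n)) (\<lambda>y. min (f y) (real n)))
    \<longlonglongrightarrow> (\<integral>\<^sup>+y. ennreal (f y) \<partial>lebesgue_subspace S)"
  unfolding gauss_mass_def
proof (rule nn_integral_LIMSEQ)
  have [measurable]: "(\<lambda>y. exp (- (y \<bullet> y) / (2 * (real (Suc n))\<^sup>2))) \<in> borel_measurable (lebesgue_subspace S)" for n
    by (rule borel_measurable_lebesgue_subspace) measurable
  note [measurable] = f
  show "(\<lambda>y. ennreal (exp (- (y \<bullet> y) / (2 * (real (Suc n))\<^sup>2))) * ennreal (min (f y) (real n)))
      \<in> borel_measurable (lebesgue_subspace S)" for n
    by measurable
  show "incseq (\<lambda>n y. ennreal (exp (- (y \<bullet> y) / (2 * (real (Suc n))\<^sup>2))) * ennreal (min (f y) (real n)))"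
  proof (intro incseq_SucI le_funI mult_mono ennreal_leI)
    fix n and y :: 'a
    have "(y \<bullet> y) / (2 * (real (Suc (Suc n)))\<^sup>2) \<le> (y \<bullet> y) / (2 * (real (Suc n))\<^sup>2)"
      by (intro divide_left_mono mult_left_mono power_mono) auto
    then show "exp (- (y \<bullet> y) / (2 * (real (Suc n))\<^sup>2)) \<le> exp (- (y \<bullet> y) / (2 * (real (Suc (Suc n)))\<^sup>2))"
      by simp
  qed auto
  fix y :: 'a
  have "(\<lambda>n. ennreal (min (f y) (real n))) \<longlonglongrightarrow> ennreal (f y)"
  proof (rule tendsto_eventually)
    obtain N :: nat where "f y \<le> real N" using real_arch_simple by blast
    then have "min (f y) (real n) = f y" if "N \<le> n" for n
      using that by (simp add: min_def order_trans[of "f y" "real N" "real n"])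
    then show "\<forall>\<^sub>F n in sequentially. ennreal (min (f y) (real n)) = ennreal (f y)"
      by (intro eventually_sequentiallyI[of N]) simp
  qed
  moreover have "(\<lambda>n. ennreal (exp (- (y \<bullet> y) / (2 * (real (Suc n))\<^sup>2)))) \<longlonglongrightarrow> ennreal (exp 0)"
  proof (intro tendsto_ennrealI tendsto_exp)
    have eq: "- (y \<bullet> y) / 2 * (inverse s)\<^sup>2 = - (y \<bullet> y) / (2 * s\<^sup>2)" for s :: real
      by (simp only: divide_inverse inverse_mult_distrib power_inverse mult.assoc)
    have "(\<lambda>n. (inverse (real (Suc n)))\<^sup>2) \<longlonglongrightarrow> 0"
      using tendsto_power[OF LIMSEQ_inverse_real_of_nat, of 2] by (simp only: zero_power2)
    from tendsto_mult_right_zero[OF this, of "- (y \<bullet> y) / 2"]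
    show "(\<lambda>n. - (y \<bullet> y) / (2 * (real (Suc n))\<^sup>2)) \<longlonglongrightarrow> 0"
      unfolding eq .
  qed
  ultimately show "(\<lambda>n. ennreal (exp (- (y \<bullet> y) / (2 * (real (Suc n))\<^sup>2))) * ennreal (min (f y) (real n)))
      \<longlonglongrightarrow> ennreal (f y)"
    using tendsto_mult_ennreal[of _ "ennreal (exp 0)" _ _ "ennreal (f y)"] by simp
qed

lemma ennreal_powr_tendsto:
  assumes X: "X \<longlonglongrightarrow> L" and p: "0 < p"
  shows "(\<lambda>n. ennreal_powr (X n) p) \<longlonglongrightarrow> ennreal_powr L p"
proof (cases L)
  case (real r)
  have "\<forall>\<^sub>F n in sequentially. X n < \<infinity>"
    using X by (rule order_tendstoD(2)) (simp add: real)
  then have ev: "\<forall>\<^sub>F n in sequentially. ennreal (enn2real (X n) powr p) = ennreal_powr (X n) p"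
    by eventually_elim (auto simp: ennreal_powr_def)
  have "(\<lambda>n. enn2real (X n) powr p) \<longlonglongrightarrow> r powr p"
    using X real p by (intro tendsto_powr' tendsto_enn2real tendsto_const) auto
  then have "(\<lambda>n. ennreal (enn2real (X n) powr p)) \<longlonglongrightarrow> ennreal (r powr p)"
    by (rule tendsto_ennrealI)
  then have "(\<lambda>n. ennreal_powr (X n) p) \<longlonglongrightarrow> ennreal (r powr p)"
    using ev by (rule Lim_transform_eventually)
  then show ?thesis using real by (simp add: ennreal_powr_def)
next
  case top
  have "(\<lambda>n. ennreal_powr (X n) p) \<longlonglongrightarrow> top"
    unfolding tendsto_top_iff_ennreal
  proof (intro allI impI)
    fix l :: real assume l: "0 \<le> l"
    have "\<forall>\<^sub>F n in sequentially. ennreal (l powr (1 / p)) < X n"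
      using X top by (intro order_tendstoD(1)) auto
    then show "\<forall>\<^sub>F n in sequentially. ennreal l < ennreal_powr (X n) p"
    proof eventually_elim
      case (elim n)
      show ?case
      proof (cases "X n = \<infinity>")
        case False
        then obtain x where x: "X n = ennreal x" "0 \<le> x" by (cases "X n") auto
        then have "l powr (1 / p) < x" using elim by (simp add: ennreal_less_iff)
        then have "(l powr (1 / p)) powr p < x powr p"
          using p by (intro powr_less_mono2) auto
        then have "l < x powr p" using p l by (simp add: powr_powr)
        then show ?thesis using x l by (simp add: ennreal_powr_def ennreal_less_iff)
      qed (simp add: ennreal_powr_def)
    qed
  qed
  then show ?thesis using top by (simp add: ennreal_powr_def)
qed

lemma ennreal_powr_finite: "x < \<infinity> \<Longrightarrow> ennreal (enn2real x powr p) = ennreal_powr x p"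
  by (auto simp: ennreal_powr_def)

lemma ennreal_powr_eq_0_iff: "ennreal_powr x p = 0 \<longleftrightarrow> x = 0"
  by (cases x) (auto simp: ennreal_powr_def)

text \<open>Multiplication of extended nonnegative numbers is discontinuous only at zero times
  infinity; nonzero limits exclude this, and the induction also carries that the product is
  nonzero.\<close>

lemma tendsto_prod_ennreal_nonzero:
  fixes X :: "'i \<Rightarrow> nat \<Rightarrow> ennreal"
  assumes "finite I" "\<And>i. i \<in> I \<Longrightarrow> X i \<longlonglongrightarrow> L i" "\<And>i. i \<in> I \<Longrightarrow> L i \<noteq> 0"
  shows "(\<lambda>n. \<Prod>i\<in>I. X i n) \<longlonglongrightarrow> (\<Prod>i\<in>I. L i) \<and> (\<Prod>i\<in>I. L i) \<noteq> 0"
  using assms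
proof (induction I)
  case (insert i I)
  then have "(\<lambda>n. X i n * (\<Prod>i\<in>I. X i n)) \<longlonglongrightarrow> L i * (\<Prod>i\<in>I. L i)"
    by (intro tendsto_mult_ennreal) auto
  then show ?case using insert by simp
qed simp

context gaussian_coupling begin

text \<open>Drops the positive lower bounds and the upper bound on \<open>g\<close>. The truncated
  \<open>g\<close> exceeds the original by at most \<open>\<eta>\<close>, an error that is sent to
  zero after normalisation.\<close>

lemma gauss_mass_inequality:
  assumes f: "\<And>i. i \<in> I \<Longrightarrow> f i \<in> borel_measurable (lebesgue_subspace (E i))"
    and f_range: "\<And>i x. i \<in> I \<Longrightarrow> x \<in> E i \<Longrightarrow> 0 \<le> f i x \<and> f i x \<le> M"
    and g: "\<And>j. j \<in> J \<Longrightarrow> g j \<in> borel_measurable (lebesgue_subspace (F j))"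
    and g_nonneg: "\<And>j y. j \<in> J \<Longrightarrow> y \<in> F j \<Longrightarrow> 0 \<le> g j y"
    and g_finite: "\<And>j. j \<in> J \<Longrightarrow> gauss_mass (F j) R (g j) < \<infinity>"
    and P_range: "\<And>i x. i \<in> I \<Longrightarrow> P i x \<in> E i" and R: "0 < R"
    and dims: "(\<Sum>i\<in>I. c i * real (dim (E i))) = (\<Sum>j\<in>J. d j * real (dim (F j)))"
    and le: "\<And>x. (\<Prod>i\<in>I. f i (P i x) powr c i) \<le> (\<Prod>j\<in>J. g j (Q j x) powr d j)"
  shows "(\<Prod>i\<in>I. enn2real (gauss_mass (E i) R (f i)) powr c i)
    \<le> (\<Prod>j\<in>J. enn2real (gauss_mass (F j) R (g j)) powr d j)"
proof -
  define \<kappa> where "\<kappa> = sqrt (2 * pi) * R"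
  have \<kappa>: "0 < \<kappa>" using R by (simp add: \<kappa>_def)
  define m where "m i = enn2real (gauss_mass (E i) R (f i)) / \<kappa> ^ dim (E i)" for i
  define m' where "m' j = enn2real (gauss_mass (F j) R (g j)) / \<kappa> ^ dim (F j)" for j
  have m_nonneg: "0 \<le> m i" "0 \<le> m' j" for i j using \<kappa> by (simp_all add: m_def m'_def)
  have \<eta>_le: "(\<Prod>i\<in>I. m i powr c i) \<le> (\<Prod>j\<in>J. (m' j + \<eta>) powr d j)" if \<eta>: "0 < \<eta>" "\<eta> < 1" for \<eta>
  proof -
    have "\<exists>\<delta> M'. 0 < \<delta> \<and> \<delta> \<le> 1 \<and> 1 \<le> M' \<and> (\<forall>a b.
      (\<forall>i\<in>I. 0 \<le> a i \<and> a i \<le> max M 1) \<longrightarrow> (\<forall>j\<in>J. 0 \<le> b j) \<longrightarrow>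
      (\<Prod>i\<in>I. a i powr c i) \<le> (\<Prod>j\<in>J. b j powr d j) \<longrightarrow>
      (\<Prod>i\<in>I. max (a i) \<delta> powr c i) \<le> (\<Prod>j\<in>J. max (min (b j) M') \<eta> powr d j))"
      using \<eta> by (intro truncation finite c_pos d_pos) auto
    then obtain \<delta> M' where \<delta>: "0 < \<delta>" "\<delta> \<le> 1" and M': "1 \<le> M'" and trunc: "\<forall>a b.
      (\<forall>i\<in>I. 0 \<le> a i \<and> a i \<le> max M 1) \<longrightarrow> (\<forall>j\<in>J. 0 \<le> b j) \<longrightarrow>
      (\<Prod>i\<in>I. a i powr c i) \<le> (\<Prod>j\<in>J. b j powr d j) \<longrightarrow>
      (\<Prod>i\<in>I. max (a i) \<delta> powr c i) \<le> (\<Prod>j\<in>J. max (min (b j) M') \<eta> powr d j)"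
      by (elim exE conjE)
    define f' where "f' i x = max (f i x) \<delta>" for i x
    define g' where "g' j y = max (min (g j y) M') \<eta>" for j y
    let ?hi = "max (max M 1) M'"
    have f'_meas: "f' i \<in> borel_measurable (lebesgue_subspace (E i))" if "i \<in> I" for i
      unfolding f'_def using f[OF that] by measurable
    have g'_meas: "g' j \<in> borel_measurable (lebesgue_subspace (F j))" if "j \<in> J" for j
      unfolding g'_def using g[OF that] by measurable
    have main: "(\<Prod>i\<in>I. (enn2real (gauss_mass (E i) R (f' i)) / \<kappa> ^ dim (E i)) powr c i)
        \<le> (\<Prod>j\<in>J. (enn2real (gauss_mass (F j) R (g' j)) / \<kappa> ^ dim (F j)) powr d j)"
      unfolding \<kappa>_def
    proof (rule gauss_mass_bounded[OF f'_meas _ g'_meas _ P_range _ R])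
      show "f' i x \<in> {min \<delta> \<eta>..?hi}" if "i \<in> I" "x \<in> E i" for i x
        using f_range[OF that] \<delta> by (auto simp: f'_def)
      show "g' j y \<in> {min \<delta> \<eta>..?hi}" for j y
        using \<eta> M' by (auto simp: g'_def)
      show "0 < min \<delta> \<eta>" using \<delta> \<eta> by simp
      show "(\<Prod>i\<in>I. f' i (P i x) powr c i) \<le> (\<Prod>j\<in>J. g' j (Q j x) powr d j)" for x
        unfolding f'_def g'_def
        by (rule trunc[rule_format]) (use f_range[OF _ P_range] g_nonneg[OF _ Q_range] le in \<open>auto simp: le_max_iff_disj\<close>)
    qed
    have mf: "m i \<le> enn2real (gauss_mass (E i) R (f' i)) / \<kappa> ^ dim (E i)" if i: "i \<in> I" for i
    proof -
      interpret coisometry "\<lambda>z. P i (A z)" "E i" using i by (rule coisometry_P)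
      have "gauss_mass (E i) R (f' i) \<le> gauss_mass (E i) R (\<lambda>_. ?hi)"
      proof (rule gauss_mass_mono)
        fix x assume "x \<in> E i"
        from f_range[OF i this] show "f' i x \<le> ?hi"
          using \<delta> by (auto simp: f'_def le_max_iff_disj)
      qed
      also have "\<dots> < \<infinity>"
        using R M' by (subst gauss_mass_const) auto
      finally have "gauss_mass (E i) R (f' i) < \<infinity>" .
      moreover have "gauss_mass (E i) R (f i) \<le> gauss_mass (E i) R (f' i)"
        by (rule gauss_mass_mono) (simp add: f'_def)
      ultimately have "enn2real (gauss_mass (E i) R (f i)) \<le> enn2real (gauss_mass (E i) R (f' i))"
        by (intro enn2real_mono) auto
      then show ?thesis unfolding m_def using \<kappa> by (intro divide_right_mono) auto
    qed
    \<comment> \<open>The constant \<open>\<eta>\<close> has Gaussian mass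
      \<open>\<eta> * \<kappa> ^ dim (F j)\<close>, so it contributes exactly \<open>\<eta>\<close>
      once normalised.\<close>
    have mg: "enn2real (gauss_mass (F j) R (g' j)) / \<kappa> ^ dim (F j) \<le> m' j + \<eta>" if j: "j \<in> J" for j
    proof -
      interpret coisometry "\<lambda>z. Q j (A z)" "F j" using j by (rule coisometry_Q)
      have [measurable]: "(\<lambda>y. exp (- (y \<bullet> y) / (2 * R\<^sup>2))) \<in> borel_measurable (lebesgue_subspace (F j))"
        by (rule borel_measurable_lebesgue_subspace) measurable
      note [measurable] = g[OF j]
      have "gauss_mass (F j) R (g' j) \<le> gauss_mass (F j) R (\<lambda>y. g j y + \<eta>)"
        by (rule gauss_mass_mono) (use g_nonneg[OF j] \<eta> in \<open>auto simp: g'_def\<close>)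
      also have "\<dots> = (\<integral>\<^sup>+y. ennreal (exp (- (y \<bullet> y) / (2 * R\<^sup>2))) * ennreal (g j y)
          + ennreal (exp (- (y \<bullet> y) / (2 * R\<^sup>2))) * ennreal \<eta> \<partial>lebesgue_subspace (F j))"
        unfolding gauss_mass_def
        by (intro nn_integral_cong) (use g_nonneg[OF j] \<eta> in \<open>simp add: ennreal_plus distrib_left\<close>)
      also have "\<dots> = gauss_mass (F j) R (g j) + gauss_mass (F j) R (\<lambda>_. \<eta>)"
        unfolding gauss_mass_def by (intro nn_integral_add) measurable
      also have "gauss_mass (F j) R (\<lambda>_. \<eta>) = ennreal (\<eta> * \<kappa> ^ dim (F j))"
        unfolding \<kappa>_def using \<eta> R by (intro gauss_mass_const) auto
      also have "gauss_mass (F j) R (g j) + ennreal (\<eta> * \<kappa> ^ dim (F j))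
          = ennreal (enn2real (gauss_mass (F j) R (g j)) + \<eta> * \<kappa> ^ dim (F j))"
        using g_finite[OF j] \<eta> \<kappa> by (subst ennreal_plus) auto
      finally have "enn2real (gauss_mass (F j) R (g' j)) \<le> enn2real (gauss_mass (F j) R (g j)) + \<eta> * \<kappa> ^ dim (F j)"
        using \<eta> \<kappa> by (intro enn2real_leI) auto
      then show ?thesis unfolding m'_def using \<kappa> by (simp add: field_simps)
    qed
    have "(\<Prod>i\<in>I. m i powr c i) \<le> (\<Prod>i\<in>I. (enn2real (gauss_mass (E i) R (f' i)) / \<kappa> ^ dim (E i)) powr c i)"
    proof (intro prod_mono conjI powr_mono2)
      show "0 \<le> c i" if "i \<in> I" for i using c_pos[OF that] by simp
    qed (use mf m_nonneg in auto)
    also note main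
    also have "(\<Prod>j\<in>J. (enn2real (gauss_mass (F j) R (g' j)) / \<kappa> ^ dim (F j)) powr d j)
        \<le> (\<Prod>j\<in>J. (m' j + \<eta>) powr d j)"
    proof (intro prod_mono conjI powr_mono2)
      show "0 \<le> d j" if "j \<in> J" for j using d_pos[OF that] by simp
    qed (use mg \<kappa> in auto)
    finally show ?thesis .
  qed
  have "(\<Prod>i\<in>I. m i powr c i) \<le> (\<Prod>j\<in>J. m' j powr d j)"
  proof (rule tendsto_lowerbound)
    show "((\<lambda>\<eta>. \<Prod>j\<in>J. (m' j + \<eta>) powr d j) \<longlongrightarrow> (\<Prod>j\<in>J. m' j powr d j)) (at_right 0)"
    proof (rule tendsto_prod)
      fix j assume j: "j \<in> J"
      have "((\<lambda>\<eta>. m' j + \<eta>) \<longlongrightarrow> m' j + 0) (at_right 0)"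
        by (intro tendsto_intros)
      moreover have "\<forall>\<^sub>F \<eta> in at_right 0. 0 \<le> m' j + \<eta>"
        using eventually_at_right_less[of "0::real"] by eventually_elim (simp add: m_nonneg)
      ultimately show "((\<lambda>\<eta>. (m' j + \<eta>) powr d j) \<longlongrightarrow> m' j powr d j) (at_right 0)"
        using d_pos[OF j] by (intro tendsto_powr' tendsto_const) auto
    qed
    show "\<forall>\<^sub>F \<eta> in at_right 0. (\<Prod>i\<in>I. m i powr c i) \<le> (\<Prod>j\<in>J. (m' j + \<eta>) powr d j)"
      using eventually_at_right_real[OF zero_less_one[where 'a=real]]
      by eventually_elim (use \<eta>_le in auto)
  qed simp
  \<comment> \<open>Pulling the constants out yields \<open>\<kappa>\<close> to the two weighted
    dimension sums, which agree by \<open>dims\<close> and cancel.\<close>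
  moreover have powr: "(a / \<kappa> ^ n) powr p = a powr p / \<kappa> powr (p * real n)" if "0 \<le> a" for a p :: real and n
    using that \<kappa> by (simp add: powr_divide powr_powr powr_realpow[symmetric] mult.commute)
  have "(\<Prod>i\<in>I. m i powr c i) = (\<Prod>i\<in>I. enn2real (gauss_mass (E i) R (f i)) powr c i)
      / \<kappa> powr (\<Sum>i\<in>I. c i * real (dim (E i)))"
    using \<kappa> by (simp add: m_def powr prod_dividef powr_sum finite)
  moreover have "(\<Prod>j\<in>J. m' j powr d j) = (\<Prod>j\<in>J. enn2real (gauss_mass (F j) R (g j)) powr d j)
      / \<kappa> powr (\<Sum>j\<in>J. d j * real (dim (F j)))"
    using \<kappa> by (simp add: m'_def powr prod_dividef powr_sum finite)
  ultimately show ?thesis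
    using \<kappa> by (simp add: dims divide_le_cancel)
qed

text \<open>If some \<open>a i\<close> vanishes the left side is zero; if some \<open>b j\<close> is
  infinite and none vanishes the right side is infinite. A vanishing \<open>b j0\<close> is
  delicate, because another factor may be infinite: then some \<open>a i\<close> must be shown to
  vanish. When all \<open>b j\<close> are finite, the Gaussian inequality passes to the
  limit.\<close>

theorem lebesgue_inequality:
  assumes f: "\<And>i. i \<in> I \<Longrightarrow> f i \<in> borel_measurable (lebesgue_subspace (E i))"
    and f_nonneg: "\<And>i x. i \<in> I \<Longrightarrow> x \<in> E i \<Longrightarrow> 0 \<le> f i x"
    and g: "\<And>j. j \<in> J \<Longrightarrow> g j \<in> borel_measurable (lebesgue_subspace (F j))"
    and g_nonneg: "\<And>j y. j \<in> J \<Longrightarrow> y \<in> F j \<Longrightarrow> 0 \<le> g j y"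
    and P_range: "\<And>i x. i \<in> I \<Longrightarrow> P i x \<in> E i"
    and dims: "(\<Sum>i\<in>I. c i * real (dim (E i))) = (\<Sum>j\<in>J. d j * real (dim (F j)))"
    and le: "\<And>x. (\<Prod>i\<in>I. f i (P i x) powr c i) \<le> (\<Prod>j\<in>J. g j (Q j x) powr d j)"
  shows "(\<Prod>i\<in>I. ennreal_powr (\<integral>\<^sup>+x. ennreal (f i x) \<partial>lebesgue_subspace (E i)) (c i))
    \<le> (\<Prod>j\<in>J. ennreal_powr (\<integral>\<^sup>+y. ennreal (g j y) \<partial>lebesgue_subspace (F j)) (d j))"
proof -
  define a where "a i = (\<integral>\<^sup>+x. ennreal (f i x) \<partial>lebesgue_subspace (E i))" for i
  define b where "b j = (\<integral>\<^sup>+y. ennreal (g j y) \<partial>lebesgue_subspace (F j))" for j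
  have min_meas: "(\<lambda>x. min (f i x) r) \<in> borel_measurable (lebesgue_subspace (E i))" if "i \<in> I" for i and r :: real
    using f[OF that] by measurable
  have prod_le: "(\<Prod>i\<in>I. min (f i (P i x)) r powr c i) \<le> (\<Prod>j\<in>J. g j (Q j x) powr d j)" if "0 \<le> r" for x r
  proof (rule order_trans[OF prod_mono le], rule conjI)
    fix i assume i: "i \<in> I"
    show "min (f i (P i x)) r powr c i \<le> f i (P i x) powr c i"
      using that f_nonneg[OF i P_range[OF i]] c_pos[OF i] by (intro powr_mono2) auto
  qed simp
  have "(\<Prod>i\<in>I. ennreal_powr (a i) (c i)) \<le> (\<Prod>j\<in>J. ennreal_powr (b j) (d j))"
  proof (cases "\<exists>i\<in>I. a i = 0")
    case True
    then have eq: "(\<Prod>i\<in>I. ennreal_powr (a i) (c i)) = 0"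
      using finite(1) by (auto intro!: prod_zero simp: ennreal_powr_eq_0_iff)
    show ?thesis unfolding eq by simp
  next
    case False
    then have a_pos: "a i \<noteq> 0" if "i \<in> I" for i using that by blast
    consider j0 where "j0 \<in> J" "b j0 = 0" | "\<And>j. j \<in> J \<Longrightarrow> b j \<noteq> 0" "\<exists>j\<in>J. b j = \<infinity>"
      | "\<And>j. j \<in> J \<Longrightarrow> b j < \<infinity>"
      by (metis infinity_ennreal_def less_top)
    then show ?thesis
    proof cases
      case 1
      text \<open>The other \<open>b j\<close> may be infinite, so \<open>g\<close> is first replaced by functions with finite
        Gaussian mass; this suffices for the truncations \<open>min (f i) 1\<close>.\<close>
      define g' where "g' j y = (if j = j0 then of_bool (0 < g j y) else 1 :: real)" for j y
      have g'_meas: "g' j \<in> borel_measurable (lebesgue_subspace (F j))" if "j \<in> J" for j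
        unfolding g'_def using g[OF that] by measurable
      have g'_finite: "gauss_mass (F j) 1 (g' j) < \<infinity>" if j: "j \<in> J" for j
      proof -
        interpret coisometry "\<lambda>z. Q j (A z)" "F j" using j by (rule coisometry_Q)
        have "gauss_mass (F j) 1 (g' j) \<le> gauss_mass (F j) 1 (\<lambda>_. 1)"
          by (rule gauss_mass_mono) (simp add: g'_def)
        also have "\<dots> < \<infinity>" by (subst gauss_mass_const) auto
        finally show ?thesis .
      qed
      \<comment> \<open>Only the vanishing of integrals is at stake, so height \<open>1\<close> and
        variance \<open>1\<close> suffice: both \<open>min\<close> with a positive constant and the
        Gaussian weight preserve where a nonnegative function is positive.\<close>
      have "(\<Prod>i\<in>I. enn2real (gauss_mass (E i) 1 (\<lambda>x. min (f i x) 1)) powr c i)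
          \<le> (\<Prod>j\<in>J. enn2real (gauss_mass (F j) 1 (g' j)) powr d j)"
      proof (rule gauss_mass_inequality[OF min_meas _ g'_meas _ g'_finite P_range _ dims, where M=1])
        fix x
        show "(\<Prod>i\<in>I. min (f i (P i x)) 1 powr c i) \<le> (\<Prod>j\<in>J. g' j (Q j x) powr d j)"
        proof (cases "0 < g j0 (Q j0 x)")
          case True
          then have "(\<Prod>j\<in>J. g' j (Q j x) powr d j) = 1"
            by (intro prod.neutral) (auto simp: g'_def)
          moreover have "(\<Prod>i\<in>I. min (f i (P i x)) 1 powr c i) \<le> 1"
          proof (rule prod_le_1, rule conjI)
            fix i assume i: "i \<in> I"
            show "min (f i (P i x)) 1 powr c i \<le> 1"
              using f_nonneg[OF i P_range[OF i], of x] c_pos[OF i] by (intro powr_le1) auto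
          qed simp
          ultimately show ?thesis by simp
        next
          case False
          then have "g j0 (Q j0 x) = 0" using g_nonneg[OF 1(1) Q_range[OF 1(1)], of x] by simp
          then have "(\<Prod>j\<in>J. g j (Q j x) powr d j) = 0"
            using 1(1) finite by (intro prod_zero) auto
          then have "(\<Prod>i\<in>I. min (f i (P i x)) 1 powr c i) \<le> 0" using prod_le[of 1 x] by simp
          also have "0 \<le> (\<Prod>j\<in>J. g' j (Q j x) powr d j)" by (intro prod_nonneg) auto
          finally show ?thesis .
        qed
      qed (use f_nonneg in \<open>auto simp: g'_def\<close>)
      moreover have "gauss_mass (F j0) 1 (g' j0) = 0"
      proof -
        have "AE y in lebesgue_subspace (F j0). ennreal (g j0 y) = 0"
          using 1 g[OF 1(1)] by (simp add: b_def nn_integral_0_iff_AE)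
        then have "(\<integral>\<^sup>+y. ennreal (g' j0 y) \<partial>lebesgue_subspace (F j0)) = (\<integral>\<^sup>+y. 0 \<partial>lebesgue_subspace (F j0))"
          by (intro nn_integral_cong_AE) (auto simp: g'_def ennreal_eq_0_iff)
        then show ?thesis using gauss_mass_eq_0_iff[OF g'_meas[OF 1(1)]] by simp
      qed
      then have "(\<Prod>j\<in>J. enn2real (gauss_mass (F j) 1 (g' j)) powr d j) = 0"
        using finite(2) by (intro prod_zero bexI[OF _ 1(1)]) simp_all
      ultimately have "(\<Prod>i\<in>I. enn2real (gauss_mass (E i) 1 (\<lambda>x. min (f i x) 1)) powr c i) \<le> 0"
        by simp
      then have "(\<Prod>i\<in>I. enn2real (gauss_mass (E i) 1 (\<lambda>x. min (f i x) 1)) powr c i) = 0"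
        by (intro antisym prod_nonneg) auto
      then obtain i where i: "i \<in> I" "enn2real (gauss_mass (E i) 1 (\<lambda>x. min (f i x) 1)) = 0"
        using finite by (auto simp: prod_zero_iff)
      interpret coisometry "\<lambda>z. P i (A z)" "E i" using i(1) by (rule coisometry_P)
      have "gauss_mass (E i) 1 (\<lambda>x. min (f i x) 1) \<le> gauss_mass (E i) 1 (\<lambda>_. 1)"
        by (rule gauss_mass_mono) simp
      also have "\<dots> < \<infinity>" by (subst gauss_mass_const) auto
      finally have "gauss_mass (E i) 1 (\<lambda>x. min (f i x) 1) = 0"
        using i(2) by (auto simp: enn2real_eq_0_iff)
      then have "AE x in lebesgue_subspace (E i). ennreal (min (f i x) 1) = 0"
        using min_meas[OF i(1)] by (simp add: gauss_mass_eq_0_iff nn_integral_0_iff_AE)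
      then have "a i = (\<integral>\<^sup>+x. 0 \<partial>lebesgue_subspace (E i))"
        unfolding a_def by (intro nn_integral_cong_AE) (auto simp: ennreal_eq_0_iff min_def split: if_splits)
      then show ?thesis using a_pos[OF i(1)] by simp
    next
      case 2
      obtain j where "j \<in> J" "ennreal_powr (b j) (d j) = top"
        using 2(2) by (auto simp: ennreal_powr_def)
      moreover have "ennreal_powr (b j) (d j) \<noteq> 0" if "j \<in> J" for j
        using 2(1)[OF that] by (simp only: ennreal_powr_eq_0_iff not_False_eq_True)
      ultimately have eq: "(\<Prod>j\<in>J. ennreal_powr (b j) (d j)) = top"
        unfolding ennreal_prod_eq_top using finite(2) by blast
      show ?thesis unfolding eq by simp
    next
      case 3
      define X where "X i n = gauss_mass (E i) (real (Suc n)) (\<lambda>x. min (f i x) (real n))" for i n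
      have X_finite: "X i n < \<infinity>" if i: "i \<in> I" for i n
      proof -
        interpret coisometry "\<lambda>z. P i (A z)" "E i" using i by (rule coisometry_P)
        have "X i n \<le> gauss_mass (E i) (real (Suc n)) (\<lambda>_. real n)"
          unfolding X_def by (rule gauss_mass_mono) simp
        also have "\<dots> < \<infinity>" by (subst gauss_mass_const) auto
        finally show ?thesis .
      qed
      \<comment> \<open>The right side is bounded at once by the Lebesgue integrals, so only the
        left side has a limit to take; there no \<open>a i\<close> is zero, which makes the product
        continuous at the limit.\<close>
      have "(\<Prod>i\<in>I. ennreal_powr (X i n) (c i)) \<le> (\<Prod>j\<in>J. ennreal_powr (b j) (d j))" for n
      proof -
        let ?Y = "\<lambda>j. gauss_mass (F j) (real (Suc n)) (g j)"
        have Y: "?Y j \<le> b j" for j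
          unfolding b_def by (rule gauss_mass_le_nn_integral)
        have Y_finite: "?Y j < \<infinity>" if "j \<in> J" for j
          using Y 3[OF that] by (rule le_less_trans)
        have "(\<Prod>i\<in>I. enn2real (X i n) powr c i) \<le> (\<Prod>j\<in>J. enn2real (?Y j) powr d j)"
          unfolding X_def
          by (rule gauss_mass_inequality[OF min_meas _ g g_nonneg Y_finite P_range _ dims prod_le, where M="real n"])
             (use f_nonneg in auto)
        also have "\<dots> \<le> (\<Prod>j\<in>J. enn2real (b j) powr d j)"
          using d_pos 3 Y by (intro prod_mono conjI powr_mono2 enn2real_mono) (auto intro: less_imp_le)
        finally have "ennreal (\<Prod>i\<in>I. enn2real (X i n) powr c i) \<le> ennreal (\<Prod>j\<in>J. enn2real (b j) powr d j)"
          by (rule ennreal_leI)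
        moreover have "ennreal (\<Prod>i\<in>I. enn2real (X i n) powr c i) = (\<Prod>i\<in>I. ennreal_powr (X i n) (c i))"
          by (subst prod_ennreal[symmetric]) (simp, intro prod.cong refl ennreal_powr_finite X_finite)
        moreover have "ennreal (\<Prod>j\<in>J. enn2real (b j) powr d j) = (\<Prod>j\<in>J. ennreal_powr (b j) (d j))"
          by (subst prod_ennreal[symmetric]) (simp, intro prod.cong refl ennreal_powr_finite 3)
        ultimately show ?thesis by simp
      qed
      moreover have "(\<lambda>n. \<Prod>i\<in>I. ennreal_powr (X i n) (c i)) \<longlonglongrightarrow> (\<Prod>i\<in>I. ennreal_powr (a i) (c i))"
      proof -
        have "(\<lambda>n. ennreal_powr (X i n) (c i)) \<longlonglongrightarrow> ennreal_powr (a i) (c i)" if "i \<in> I" for i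
          unfolding X_def a_def by (intro ennreal_powr_tendsto gauss_mass_tendsto f c_pos that)
        then show ?thesis
          using tendsto_prod_ennreal_nonzero[OF finite(1), of "\<lambda>i n. ennreal_powr (X i n) (c i)"] a_pos
          by (auto simp: ennreal_powr_eq_0_iff)
      qed
      ultimately show ?thesis by (intro LIMSEQ_le_const2) auto
    qed
  qed
  then show ?thesis by (simp only: a_def b_def)
qed

end

theorem corollary1p17:
  fixes k m :: nat
    and E :: "nat \<Rightarrow> 'a::euclidean_space set"
    and F :: "nat \<Rightarrow> 'b::euclidean_space set"
    and c d :: "nat \<Rightarrow> real"
    and Q :: "nat \<Rightarrow> 'a \<Rightarrow> 'b"
    and \<Sigma> :: "'a \<Rightarrow> 'a"
    and f :: "nat \<Rightarrow> 'a \<Rightarrow> real"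
    and g :: "nat \<Rightarrow> 'b \<Rightarrow> real"
  assumes "orthogonal_direct_sum {1..k} E"
    and "\<forall>j\<in>{1..m}. subspace (F j)"
    and "\<forall>i\<in>{1..k}. 0 < c i"
    and "\<forall>j\<in>{1..m}. 0 < d j"
    and "(\<Sum>i=1..k. c i * real (dim (E i))) = (\<Sum>j=1..m. d j * real (dim (F j)))"
    and "\<forall>j\<in>{1..m}. linear (Q j) \<and> range (Q j) \<subseteq> F j"
    and "\<Sigma> \<in> coupling_id {1..k} E"
    and "\<forall>j\<in>{1..m}. \<forall>y\<in>F j. Q j (\<Sigma> (adjoint (Q j) y)) = y"
    and "loewner_le (\<lambda>x. \<Sum>j=1..m. d j *\<^sub>R adjoint (Q j) (Q j x))
           (direct_sum_scaling {1..k} E c)"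
    and "\<forall>i\<in>{1..k}. f i \<in> borel_measurable (lebesgue_subspace (E i)) \<and> (\<forall>x\<in>E i. 0 \<le> f i x)"
    and "\<forall>j\<in>{1..m}. g j \<in> borel_measurable (lebesgue_subspace (F j)) \<and> (\<forall>y\<in>F j. 0 \<le> g j y)"
    and "\<forall>x. (\<Prod>i=1..k. f i (orth_proj (E i) x) powr c i) \<le> (\<Prod>j=1..m. g j (Q j x) powr d j)"
  shows "(\<Prod>i=1..k. ennreal_powr (\<integral>\<^sup>+ x. ennreal (f i x) \<partial>lebesgue_subspace (E i)) (c i))
       \<le> (\<Prod>j=1..m. ennreal_powr (\<integral>\<^sup>+ y. ennreal (g j y) \<partial>lebesgue_subspace (F j)) (d j))"
proof -
  have E: "subspace (E i)" if "i \<in> {1..k}" for i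
    using assms(1) that by (simp add: orthogonal_direct_sum_def)
  have "psd \<Sigma>" using assms(7) by (simp add: coupling_id_def)
  then obtain A :: "'a \<Rightarrow> 'a" where A: "linear A" "\<And>x. A (adjoint A x) = \<Sigma> x"
    using psd_factorization by blast
  \<comment> \<open>Everything is now expressed through \<open>A z\<close>: membership in
    \<open>coupling_id\<close> and the condition on each \<open>Q j\<close> say that its projections
    and images are standard Gaussian, and the operator inequality becomes
    \<open>energy\<close>.\<close>
  interpret gaussian_coupling "{1..k}" "{1..m}" E F "\<lambda>i. orth_proj (E i)" Q A c d
  proof (rule gaussian_coupling.intro)
    show "coisometry (\<lambda>z. orth_proj (E i) (A z)) (E i)" if "i \<in> {1..k}" for i
      using assms(7) that E[OF that] A by (rule coisometry_coupling_id)
    show "coisometry (\<lambda>z. Q j (A z)) (F j)" if "j \<in> {1..m}" for j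
      by (rule coisometry_comp[OF _ _ _ _ A]) (use assms that in auto)
    show "\<exists>x. \<forall>i\<in>{1..k}. orth_proj (E i) x = u i" if "\<And>i. i \<in> {1..k} \<Longrightarrow> u i \<in> E i" for u
      using assms(1) finite_atLeastAtMost that by (rule orthogonal_direct_sum_lift)
    show "(\<Sum>j=1..m. d j * (Q j x \<bullet> Q j x)) \<le> (\<Sum>i=1..k. c i * (orth_proj (E i) x \<bullet> orth_proj (E i) x))" for x
      by (rule loewner_energy[OF assms(9)]) (use E assms(6) in auto)
    show "linear (orth_proj (E i))" if "i \<in> {1..k}" for i
      by (rule linear_orth_proj[OF E[OF that]])
    show "Q j x \<in> F j" if "j \<in> {1..m}" for j x
      using assms(6) that by blast
  qed (use assms in auto)
  show ?thesis
    by (rule lebesgue_inequality) (use assms E in \<open>auto simp: orth_proj(1)\<close>)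
qed

end
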